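(* Let $d\ge1$ and let $f\in\mathcal{S}_d$ be a standard Schur function that extends to a holomorphic function $\tilde f:\overline{\mathbb{D}}^d\to\mathbb{D}$. Let $r:\mathbb{Z}_+\to\mathbb{D}$ be its sequence of Schur parameters and $\nu:\mathbb{Z}_{>0}\to\{1,\dots,d\}$ its variable allocation map. Then, for every $\eta=(\eta_1,\dots,\eta_d)\in\mathbb{R}_{>0}^d$, the function $\tilde f\circ\ell_\eta:\mathbb{R}\to\mathbb{D}$, where $\ell_\eta(\omega)=(e^{i\eta_1\omega},\dots,e^{i\eta_d\omega})$, is almost periodic, represented by the absolutely convergent series $$\tilde f\circ\ell_\eta(\omega)=\sum_{\alpha\in A}c_\alpha(r)\,e^{i\langle\alpha,\eta\circ\nu\rangle\omega},\qquad \langle\alpha,\eta\circ\nu\rangle=\sum_{j=1}^\infty\alpha_j\eta_{\nu_j},$$ and $$\lim_{L\to\infty}\frac{1}{2L}\int_{-L}^L-\log\left(1-\bigl|\tilde f\circ\ell_\eta(\omega)\bigr|^2\right)d\omega=\sum_{j=1}^\infty-\log(1-|r_j|^2).$$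
   Context: Notation. $\mathbb{D}$ is the open unit disk, $\overline{\mathbb{D}}$ its closure, $\mathbb{T}$ the unit circle, $\mathbb{Z}_+$ the nonnegative integers, $\mathbb{Z}_{>0}$ the positive integers. "Holomorphic on $\overline{\mathbb{D}}^d$" means holomorphic in an open set containing $\overline{\mathbb{D}}^d$. "Almost periodic" is meant in the sense of Besicovitch. $\mathcal{H}_d$ is the set of all holomorphic functions $h:\mathbb{D}^d\to\overline{\mathbb{D}}$, with the topology of uniform convergence on compact sets. $\mathbf{c}_r$ denotes the constant function with value $r$. For $1\le j\le d$ and $r\in\overline{\mathbb{D}}$ define operators on $\mathcal{H}_d$ by $(\mathfrak{m}_jh)(z)=z_jh(z)$; $(\mathfrak{g}_rh)(z)=\frac{h(z)+r}{1+\overline{r}h(z)}$ if $r\in\mathbb{D}$, and $\mathfrak{g}_rh=\mathbf{c}_r$ if $r\in\mathbb{T}$. Schur functions. $\mathcal{S}_d$ is the closure in $\mathcal{H}_d$ of the set of all functions $\mathfrak{g}_{r_0}\mathfrak{m}_{\nu_1}\cdots\mathfrak{g}_{r_{k-1}}\mathfrak{m}_{\nu_k}\mathbf{c}_0$ with $k\ge1$, $r_i\in\mathbb{D}$, $\nu_i\in\{1,\dots,d\}$; its elements are called Schur functions. Every $f\in\mathcal{S}_d$ can be written $f=\mathfrak{g}_r\mathfrak{m}_jh$ with $r=f(0)$, some $1\le j\le d$, some $h\in\mathcal{S}_d$. Starting with $h_0=f$, iterate: set $r_n=h_n(0)$ and choose $\nu_{n+1}\in\{1,\dots,d\}$, $h_{n+1}\in\mathcal{S}_d$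 with $h_n=\mathfrak{g}_{r_n}\mathfrak{m}_{\nu_{n+1}}h_{n+1}$ (if $h_n$ is constant, take $\nu_{n+1}=1$, $h_{n+1}=\mathbf{c}_0$). The $r_n$ $(n\ge0)$ are the Schur parameters of $f$ and $\nu$ is the variable allocation map (not necessarily unique; any choice allowed). $f$ is standard if $f(0)=0$ and $|r_n|<1$ for all $n\ge0$. Scattering polynomials. For $(p,q)\in\mathbb{Z}_+^2$: if $p,q\ge1$, $$\varphi^{(p,q)}(z)=\frac{(-1)^p}{q\,(p+q-1)!}(1-z\bar z)\frac{\partial^{p+q}}{\partial\bar z^p\partial z^q}(1-z\bar z)^{p+q-1}=\sum_{j=1}^{\min\{p,q\}}\binom{p}{j}\binom{q-1}{j-1}z^{p-j}(-\bar z)^{q-j}(1-z\bar z)^j;$$ $\varphi^{(0,q)}=0$ if $q\ge1$; $\varphi^{(p,0)}(z)=z^p$ for $p\ge0$ (with $z^0=1$ even if $z=0$). Scattering weights. $A$ is the set of all finitely supported $\alpha:\mathbb{Z}_{>0}\to\mathbb{Z}_+$. For $\alpha\in A$ put $n=0$ if $\alpha=0$ and $n=\max\operatorname{supp}\alpha$ otherwise, and set $c_\alpha(r)=\varphi^{(1,\alpha_1)}(r_0)\prod_{j=1}^n\varphi^{(\alpha_j,\alpha_{j+1})}(r_j)$. *)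

theory Defs
  imports "HOL-Analysis.Analysis"
begin

text \<open>
  Points of complex \<open>d\<close>-space are vectors of type \<open>complex ^ 'd\<close> with \<open>d = CARD('d)\<close>.  A function
  on the open polydisc is represented by a total function on \<open>complex ^ 'd\<close>; its values off the
  polydisc are irrelevant, and equality of functions is accordingly equality on the polydisc.
\<close>

definition polydisc :: "(complex ^ 'd) set"
  where "polydisc = {z. \<forall>j. norm (z $ j) < 1}"

definition closed_polydisc :: "(complex ^ 'd) set"
  where "closed_polydisc = {z. \<forall>j. norm (z $ j) \<le> 1}"

text \<open>
  Complex differentiability at every point: the derivative is a complex-linear functional, given by
  the vector \<open>a\<close> of complex partial derivatives.  Intended for open \<open>U\<close>.
\<close>

definition mv_holomorphic_on :: "(complex ^ 'd \<Rightarrow> complex) \<Rightarrow> (complex ^ 'd) set \<Rightarrow> bool"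
  where "mv_holomorphic_on f U \<longleftrightarrow>
    (\<forall>z\<in>U. \<exists>a :: complex ^ 'd. (f has_derivative (\<lambda>v. \<Sum>j\<in>UNIV. a $ j * v $ j)) (at z))"

definition H_space :: "(complex ^ 'd \<Rightarrow> complex) set"
  where "H_space = {h. mv_holomorphic_on h polydisc \<and> (\<forall>z\<in>polydisc. norm (h z) \<le> 1)}"

text \<open>The topology of uniform convergence on compact subsets of the polydisc.\<close>

definition H_topology :: "(complex ^ 'd \<Rightarrow> complex) topology"
  where "H_topology = topology (\<lambda>V. V \<subseteq> H_space \<and>
    (\<forall>f\<in>V. \<exists>K \<epsilon>. compact K \<and> K \<subseteq> polydisc \<and> \<epsilon> > 0 \<and>
       {g \<in> H_space. \<forall>z\<in>K. norm (g z - f z) < \<epsilon>} \<subseteq> V))"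

lemma openin_H_topology:
  fixes V :: "(complex ^ 'd \<Rightarrow> complex) set"
  shows "openin H_topology V \<longleftrightarrow> V \<subseteq> H_space \<and>
    (\<forall>f\<in>V. \<exists>K \<epsilon>. compact K \<and> K \<subseteq> polydisc \<and> \<epsilon> > 0 \<and>
       {g \<in> H_space. \<forall>z\<in>K. norm (g z - f z) < \<epsilon>} \<subseteq> V)"
proof -
  have "istopology (\<lambda>V :: (complex ^ 'd \<Rightarrow> complex) set. V \<subseteq> H_space \<and>
    (\<forall>f\<in>V. \<exists>K \<epsilon>. compact K \<and> K \<subseteq> polydisc \<and> \<epsilon> > 0 \<and>
       {g \<in> H_space. \<forall>z\<in>K. norm (g z - f z) < \<epsilon>} \<subseteq> V))" (is "istopology ?P")
    unfolding istopology_def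
  proof (intro conjI allI impI)
    fix S T :: "(complex ^ 'd \<Rightarrow> complex) set"
    assume S: "?P S" and T: "?P T"
    show "S \<inter> T \<subseteq> H_space" using S by blast
    show "\<forall>f\<in>S \<inter> T. \<exists>K \<epsilon>. compact K \<and> K \<subseteq> polydisc \<and> \<epsilon> > 0 \<and>
       {g \<in> H_space. \<forall>z\<in>K. norm (g z - f z) < \<epsilon>} \<subseteq> S \<inter> T"
    proof
      fix f assume f: "f \<in> S \<inter> T"
      obtain K1 e1 where 1: "compact K1" "K1 \<subseteq> polydisc" "e1 > 0"
        "{g \<in> H_space. \<forall>z\<in>K1. norm (g z - f z) < e1} \<subseteq> S"
        using S f by (meson IntD1)
      obtain K2 e2 where 2: "compact K2" "K2 \<subseteq> polydisc" "e2 > 0"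
        "{g \<in> H_space. \<forall>z\<in>K2. norm (g z - f z) < e2} \<subseteq> T"
        using T f by (meson IntD2)
      have "compact (K1 \<union> K2)" "K1 \<union> K2 \<subseteq> polydisc" "min e1 e2 > 0"
        using 1 2 by auto
      moreover have "{g \<in> H_space. \<forall>z\<in>K1 \<union> K2. norm (g z - f z) < min e1 e2} \<subseteq> S \<inter> T"
        using 1(4) 2(4) by auto
      ultimately show "\<exists>K \<epsilon>. compact K \<and> K \<subseteq> polydisc \<and> \<epsilon> > 0 \<and>
         {g \<in> H_space. \<forall>z\<in>K. norm (g z - f z) < \<epsilon>} \<subseteq> S \<inter> T"
        by blast
    qed
  next
    fix \<K> :: "(complex ^ 'd \<Rightarrow> complex) set set"
    assume K: "\<forall>V\<in>\<K>. ?P V"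
    show "\<Union>\<K> \<subseteq> H_space" using K by blast
    show "\<forall>f\<in>\<Union>\<K>. \<exists>K \<epsilon>. compact K \<and> K \<subseteq> polydisc \<and> \<epsilon> > 0 \<and>
       {g \<in> H_space. \<forall>z\<in>K. norm (g z - f z) < \<epsilon>} \<subseteq> \<Union>\<K>"
    proof
      fix f assume "f \<in> \<Union>\<K>"
      then obtain V where V: "V \<in> \<K>" "f \<in> V" by blast
      then obtain K \<epsilon> where "compact K" "K \<subseteq> polydisc" "\<epsilon> > 0"
        "{g \<in> H_space. \<forall>z\<in>K. norm (g z - f z) < \<epsilon>} \<subseteq> V"
        using K by meson
      then show "\<exists>K \<epsilon>. compact K \<and> K \<subseteq> polydisc \<and> \<epsilon> > 0 \<and>
         {g \<in> H_space. \<forall>z\<in>K. norm (g z - f z) < \<epsilon>} \<subseteq> \<Union>\<K>"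
        using V by (meson Union_upper subset_trans)
    qed
  qed
  then show ?thesis
    unfolding H_topology_def by (simp only: topology_inverse')
qed

lemma topspace_H_topology:
  "topspace H_topology = (H_space :: (complex ^ 'd \<Rightarrow> complex) set)"
proof
  show "topspace H_topology \<subseteq> (H_space :: (complex ^ 'd \<Rightarrow> complex) set)"
    using openin_topspace[of H_topology] unfolding openin_H_topology by blast
  have "openin H_topology (H_space :: (complex ^ 'd \<Rightarrow> complex) set)"
    unfolding openin_H_topology
    by (auto intro!: exI[of _ "{}"] exI[of _ "1::real"])
  then show "(H_space :: (complex ^ 'd \<Rightarrow> complex) set) \<subseteq> topspace H_topology"
    by (rule openin_subset)
qed

definition m_op :: "'d \<Rightarrow> (complex ^ 'd \<Rightarrow> complex) \<Rightarrow> (complex ^ 'd \<Rightarrow> complex)"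
  where "m_op j h = (\<lambda>z. z $ j * h z)"

definition g_op :: "complex \<Rightarrow> (complex ^ 'd \<Rightarrow> complex) \<Rightarrow> (complex ^ 'd \<Rightarrow> complex)"
  where "g_op r h = (if norm r < 1 then (\<lambda>z. (h z + r) / (1 + cnj r * h z)) else (\<lambda>z. r))"

text \<open>The list holds the pairs \<open>(r\<^sub>0, \<nu>\<^sub>1), \<dots>, (r\<^bsub>k-1\<^esub>, \<nu>\<^sub>k)\<close>, outermost operators first.\<close>

definition schur_generators :: "(complex ^ 'd \<Rightarrow> complex) set"
  where "schur_generators = {foldr (\<lambda>(r, j) h. g_op r (m_op j h)) ps (\<lambda>z. 0) |ps.
    ps \<noteq> [] \<and> (\<forall>(r, j)\<in>set ps. norm r < 1)}"

definition schur_class :: "(complex ^ 'd \<Rightarrow> complex) set"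
  where "schur_class = H_topology closure_of schur_generators"

text \<open>
  \<open>schur_data f r \<nu>\<close>: the sequence \<open>r\<close> of Schur parameters and the variable allocation map \<open>\<nu>\<close>
  (whose value at 0 is irrelevant) result from one run of the Schur algorithm on \<open>f\<close>.
  The linear order on the index type \<open>'d\<close> identifies it with \<open>{1, \<dots>, d}\<close>, so that \<open>Min UNIV\<close> is the
  index 1, used by convention once the algorithm has reached a constant function.
\<close>

definition schur_data ::
    "(complex ^ 'd::{finite,linorder} \<Rightarrow> complex) \<Rightarrow> (nat \<Rightarrow> complex) \<Rightarrow>
      (nat \<Rightarrow> 'd::{finite,linorder}) \<Rightarrow> bool"
  where "schur_data f r \<nu> \<longleftrightarrow>
    (\<exists>h. h 0 = f \<and>
      (\<forall>n. h n \<in> schur_class \<and> r n = h n 0 \<and>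
        (\<forall>z\<in>polydisc. h n z = g_op (r n) (m_op (\<nu> (Suc n)) (h (Suc n))) z) \<and>
        (h n constant_on polydisc \<longrightarrow>
           \<nu> (Suc n) = Min UNIV \<and> (\<forall>z\<in>polydisc. h (Suc n) z = 0))))"

definition standard_schur :: "(complex ^ 'd \<Rightarrow> complex) \<Rightarrow> (nat \<Rightarrow> complex) \<Rightarrow> bool"
  where "standard_schur f r \<longleftrightarrow> f 0 = 0 \<and> (\<forall>n. norm (r n) < 1)"

definition scattering_poly :: "nat \<Rightarrow> nat \<Rightarrow> complex \<Rightarrow> complex"
  where "scattering_poly p q z =
    (if q = 0 then z ^ p
     else if p = 0 then 0
     else (\<Sum>j=1..min p q. of_nat (p choose j) * of_nat ((q - 1) choose (j - 1)) *
             z ^ (p - j) * (- cnj z) ^ (q - j) * (1 - z * cnj z) ^ j))"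

text \<open>
  Finitely supported maps from the positive integers to the nonnegative integers, encoded as
  functions on \<open>nat\<close> that vanish at 0.
\<close>

definition scattering_index :: "(nat \<Rightarrow> nat) set"
  where "scattering_index = {\<alpha>. \<alpha> 0 = 0 \<and> finite {j. \<alpha> j \<noteq> 0}}"

definition scattering_weight :: "(nat \<Rightarrow> complex) \<Rightarrow> (nat \<Rightarrow> nat) \<Rightarrow> complex"
  where "scattering_weight r \<alpha> =
    (let n = (if \<forall>j. \<alpha> j = 0 then 0 else Max {j. \<alpha> j \<noteq> 0}) in
     scattering_poly 1 (\<alpha> 1) (r 0) * (\<Prod>j=1..n. scattering_poly (\<alpha> j) (\<alpha> (Suc j)) (r j)))"

definition pairing :: "(nat \<Rightarrow> nat) \<Rightarrow> (nat \<Rightarrow> real) \<Rightarrow> real"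
  where "pairing \<alpha> x = (\<Sum>j | \<alpha> j \<noteq> 0. real (\<alpha> j) * x j)"

definition torus_line :: "real ^ 'd \<Rightarrow> real \<Rightarrow> complex ^ 'd"
  where "torus_line \<eta> \<omega> = (\<chi> j. exp (\<i> * complex_of_real (\<eta> $ j * \<omega>)))"

definition mean_over :: "real \<Rightarrow> (real \<Rightarrow> real) \<Rightarrow> real"
  where "mean_over L u = 1 / (2 * L) * (LINT x:{-L..L}|lebesgue. u x)"

definition trig_polynomial :: "(real \<Rightarrow> complex) \<Rightarrow> bool"
  where "trig_polynomial P \<longleftrightarrow> (\<exists>\<Lambda> a. finite (\<Lambda> :: real set) \<and>
    P = (\<lambda>x. \<Sum>\<mu>\<in>\<Lambda>. a \<mu> * exp (\<i> * complex_of_real (\<mu> * x))))"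

text \<open>
  The Besicovitch class \<open>B\<^sup>p\<close>: the closure of the trigonometric polynomials, among the locally
  \<open>p\<close>-integrable functions, for the seminorm given by the upper mean of \<open>\<bar>g\<bar>\<^sup>p\<close>.
\<close>

definition besicovitch_ap :: "real \<Rightarrow> (real \<Rightarrow> complex) \<Rightarrow> bool"
  where "besicovitch_ap p g \<longleftrightarrow>
    g \<in> borel_measurable lebesgue \<and>
    (\<forall>L. set_integrable lebesgue {-L..L} (\<lambda>x. norm (g x) powr p)) \<and>
    (\<forall>\<epsilon>>0. \<exists>P. trig_polynomial P \<and>
       Limsup at_top (\<lambda>L. ereal (mean_over L (\<lambda>x. norm (g x - P x) powr p))) < ereal \<epsilon>)"

end

theory Submission
  imports Defs "HOL-Complex_Analysis.Complex_Analysis"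
begin

text \<open>
  Write \<open>x\<^sub>j\<close> for the coordinate with index \<open>\<nu>\<^sub>j\<close> of a point and \<open>g\<^sub>r(w) = (w + r) / (1 + cnj r * w)\<close>.
  Unrolling the Schur algorithm gives \<open>f = g\<^bsub>r 0\<^esub>(x\<^sub>1 g\<^bsub>r 1\<^esub>(x\<^sub>2 g\<^bsub>r 2\<^esub>(\<dots>)))\<close>.  The scattering polynomial of
  index \<open>(p, q)\<close> is the coefficient of \<open>w\<^sup>q\<close> in \<open>g\<^sub>r(w)\<^sup>p\<close>, so expanding the nested expression from the
  outside produces exactly the monomials in the \<open>x\<^sub>j\<close> with the scattering weights as coefficients.
  Everything rests on one analytic fact: the Schur parameters are absolutely summable.

  Summability is a statement about one variable.  On the diagonal \<open>(\<zeta>, \<dots>, \<zeta>)\<close> the allocation map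
  becomes invisible, and the restricted function has the same Schur parameters, is holomorphic on a
  disc of radius \<open>R > 1\<close> and is bounded there by some \<open>\<rho> < 1\<close>.  Its Wall polynomials solve a finite
  linear system with matrix \<open>I - T\<^sup>* T\<close>, where \<open>T\<close> is the truncated Toeplitz matrix of the function.
  Since \<open>T\<close> has norm at most \<open>\<rho>\<close> even in the norm with weights \<open>R\<^sup>k\<close>, the Wall polynomials have
  exponentially decaying coefficients, and so do the parameters (\<open>wall_polynomials\<close>,
  \<open>analytic_toeplitz_contraction\<close>, \<open>schur_parameter_bound\<close>).

  The series converges absolutely on the closed polydisc for two different reasons.  Far out, where
  the parameters are small, replacing all coefficients by their absolute values enlarges a bound
  \<open>y \<le> 1\<close> by at most \<open>3 * norm (r n)\<close> per step.  In the finitely many remaining steps this crude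
  majorant is useless; there the powers of \<open>g\<^sub>r\<close> are controlled by the Cauchy estimate on a circle
  of radius slightly larger than 1, at the price of a constant (\<open>chain_bound_uniform\<close>).  The sum is
  the right one because the remainders of the Schur algorithm tend to 0 uniformly up to the torus
  (\<open>h_le_tail_bound\<close>, \<open>scattering_series_has_sum\<close>).

  For the mean value, the identity
  \<open>1 - |g\<^sub>r(w)|\<^sup>2 = (1 - |r|\<^sup>2) (1 - |w|\<^sup>2) / |1 + cnj r * w|\<^sup>2\<close> splits \<open>-log(1 - |f|\<^sup>2)\<close> on the torus into
  \<open>-log(1 - |r\<^sub>n|\<^sup>2)\<close>, the same expression for the next remainder, and twice the real part of
  \<open>log(1 + cnj r\<^sub>n * w)\<close>, where \<open>w\<close> is the product of the next coordinate and the next remainder.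
  Along the line, \<open>w\<close> is a uniform limit of exponential sums with
  positive frequencies; hence so is the logarithm, and its mean is 0.  The remainders contribute nothing
  in the limit, since they tend to 0 uniformly (\<open>pos_ap_mean_zero\<close>, \<open>mean_energy\<close>).
\<close>

section \<open>Truncated multiplication by a bounded analytic function\<close>

lemma root_of_unity_orthogonality:
  assumes "k < N" "l < N"
  shows "(\<Sum>m<N. cis (2 * pi * real m / real N) ^ k * cnj (cis (2 * pi * real m / real N) ^ l))
    = (if k = l then of_nat N else 0)"
proof -
  define x where "x = cis (2 * pi * (real k - real l) / real N)"
  have N: "N > 0" using assms by auto
  have eq: "cis (2 * pi * real m / real N) ^ k * cnj (cis (2 * pi * real m / real N) ^ l) = x ^ m" for m
  proof -
    have "real k * (2 * pi * real m / real N) + - (real l * (2 * pi * real m / real N))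
        = real m * (2 * pi * (real k - real l) / real N)"
      by (simp add: divide_inverse algebra_simps)
    moreover have "cnj (cis t ^ l) = cis (- (real l * t))" for t
    proof -
      have "cis t ^ l = cis (real l * t)" by (rule Complex.DeMoivre)
      then show ?thesis by (simp add: complex_eq_iff del: complex_cnj_power)
    qed
    ultimately show ?thesis by (simp only: x_def Complex.DeMoivre cis_mult)
  qed
  show ?thesis
  proof (cases "k = l")
    case True
    then show ?thesis unfolding eq by (simp add: x_def)
  next
    case False
    have "x \<noteq> 1"
    proof
      assume "x = 1"
      then have "cos (2 * pi * (real k - real l) / real N) = 1"
        by (simp add: x_def complex_eq_iff)
      then obtain n :: int where n: "2 * pi * (real k - real l) / real N = n * 2 * pi"
        using cos_one_2pi_int by auto
      then have "2 * pi * (real k - real l) = 2 * pi * (n * real N)"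
        using N by (simp add: divide_eq_eq mult_ac)
      then have "real k - real l = n * real N"
        by (simp only: mult_cancel_left) simp
      then have kl: "int k - int l = n * int N"
        by (metis of_int_eq_iff of_int_diff of_int_mult of_int_of_nat_eq)
      have "n \<noteq> 0" using kl False by auto
      then have "\<bar>n * int N\<bar> \<ge> int N"
        by (simp add: abs_mult mult_le_cancel_right1) linarith
      then show False using kl assms by linarith
    qed
    moreover have "x ^ N = 1"
    proof -
      have "x ^ N = cis (2 * pi * of_int (int k - int l))"
        using N by (simp add: x_def Complex.DeMoivre)
      also have "\<dots> = 1" by (rule cis_multiple_2pi) (rule Ints_of_int)
      finally show ?thesis .
    qed
    ultimately show ?thesis unfolding eq using False by (simp add: geometric_sum)
  qed
qed

lemma parseval_roots_of_unity:
  fixes c :: "nat \<Rightarrow> complex"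
  shows "(\<Sum>m<N. (norm (\<Sum>k<N. c k * cis (2 * pi * real m / real N) ^ k))\<^sup>2)
    = real N * (\<Sum>k<N. (norm (c k))\<^sup>2)"
proof -
  define z where "z = (\<lambda>m. cis (2 * pi * real m / real N))"
  have "complex_of_real (\<Sum>m<N. (norm (\<Sum>k<N. c k * z m ^ k))\<^sup>2)
      = (\<Sum>m<N. \<Sum>k<N. \<Sum>l<N. c k * cnj (c l) * (z m ^ k * cnj (z m ^ l)))"
    by (simp add: complex_norm_square cnj_sum sum_product mult_ac del: of_real_power)
  also have "\<dots> = (\<Sum>k<N. \<Sum>l<N. c k * cnj (c l) * (\<Sum>m<N. z m ^ k * cnj (z m ^ l)))"
  proof -
    have "(\<Sum>m<N. \<Sum>k<N. \<Sum>l<N. t m k l) = (\<Sum>k<N. \<Sum>l<N. \<Sum>m<N. t m k l)" for t :: "nat \<Rightarrow> nat \<Rightarrow> nat \<Rightarrow> complex"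
    proof -
      have "(\<Sum>m<N. \<Sum>k<N. \<Sum>l<N. t m k l) = (\<Sum>k<N. \<Sum>m<N. \<Sum>l<N. t m k l)"
        by (rule sum.swap)
      also have "\<dots> = (\<Sum>k<N. \<Sum>l<N. \<Sum>m<N. t m k l)"
        by (rule sum.cong[OF refl]) (rule sum.swap)
      finally show ?thesis .
    qed
    then show ?thesis by (simp only: sum_distrib_left)
  qed
  also have "\<dots> = (\<Sum>k<N. \<Sum>l<N. if k = l then c k * cnj (c l) * of_nat N else 0)"
    unfolding z_def by (intro sum.cong refl) (auto simp: root_of_unity_orthogonality simp del: complex_cnj_power)
  also have "\<dots> = complex_of_real (real N * (\<Sum>k<N. (norm (c k))\<^sup>2))"
    by (simp add: complex_norm_square sum_distrib_left mult_ac del: of_real_power)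
  finally show ?thesis unfolding z_def using of_real_eq_iff by blast
qed

text \<open>
  Multiplication by a function bounded by \<open>\<rho>\<close> on the unit circle has norm at most \<open>\<rho>\<close> on square-summable
  Taylor coefficients, and truncation does not increase the norm.  To stay with finite sums, \<open>a\<close> is cut off
  at a degree \<open>M\<close>, which costs the tail \<open>\<delta> M\<close> in the sup bound, and Parseval is applied on roots of unity of
  an order exceeding the degree of the product.
\<close>

lemma analytic_toeplitz_contraction:
  fixes a b :: "nat \<Rightarrow> complex"
  assumes summ: "summable (\<lambda>k. norm (a k))"
    and bound: "\<And>w. norm w = 1 \<Longrightarrow> norm (\<Sum>k. a k * w ^ k) \<le> \<rho>"
  shows "(\<Sum>k\<le>n. (norm (\<Sum>i\<le>k. a (k - i) * b i))\<^sup>2) \<le> \<rho>\<^sup>2 * (\<Sum>k\<le>n. (norm (b k))\<^sup>2)"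
proof -
  define \<beta> where "\<beta> = (\<Sum>k\<le>n. (norm (b k))\<^sup>2)"
  define S where "S = (\<Sum>k\<le>n. (norm (\<Sum>i\<le>k. a (k - i) * b i))\<^sup>2)"
  define \<delta> where "\<delta> M = (\<Sum>k. norm (a (k + Suc M)))" for M
  have rho: "\<rho> \<ge> 0" using order_trans[OF norm_ge_zero bound[of 1]] by simp
  have step: "S \<le> (\<rho> + \<delta> M)\<^sup>2 * \<beta>" if M: "M \<ge> n" for M
  proof -
    define a' where "a' k = (if k \<le> M then a k else 0)" for k
    define b' where "b' k = (if k \<le> n then b k else 0)" for k
    define c where "c k = (\<Sum>i\<le>k. a' (k - i) * b' i)" for k
    \<comment> \<open>large enough that the coefficients of the product do not wrap around on the \<open>N\<close>-th roots of unity\<close>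
    define N where "N = Suc (M + n)"
    define z where "z m = cis (2 * pi * real m / real N)" for m
    have prod: "(\<Sum>k<N. c k * w ^ k) = (\<Sum>k\<le>M. a k * w ^ k) * (\<Sum>k\<le>n. b k * w ^ k)" for w
    proof -
      define p where "p = (\<Sum>k\<le>M. monom (a k) k)"
      define q where "q = (\<Sum>k\<le>n. monom (b k) k)"
      have ca: "poly.coeff p k = a' k" for k
        by (auto simp: p_def coeff_sum a'_def)
      have cb: "poly.coeff q k = b' k" for k
        by (auto simp: q_def coeff_sum b'_def)
      have cc: "poly.coeff (p * q) k = c k" for k
        unfolding coeff_mult ca cb c_def
        by (rule sum.reindex_bij_witness[of _ "\<lambda>i. k - i" "\<lambda>i. k - i"]) auto
      have "degree p \<le> M" by (rule degree_le) (auto simp: ca a'_def)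
      moreover have "degree q \<le> n" by (rule degree_le) (auto simp: cb b'_def)
      ultimately have "degree (p * q) \<le> M + n"
        using degree_mult_le[of p q] by linarith
      then have "poly (p * q) w = (\<Sum>k\<le>M + n. c k * w ^ k)"
        unfolding poly_altdef
        by (intro sum.mono_neutral_cong_left) (auto simp: cc coeff_eq_0 simp flip: cc)
      moreover have "poly p w = (\<Sum>k\<le>M. a k * w ^ k)" "poly q w = (\<Sum>k\<le>n. b k * w ^ k)"
        by (simp_all add: p_def q_def poly_sum poly_monom)
      ultimately show ?thesis by (simp add: N_def lessThan_Suc_atMost)
    qed
    have bd: "norm (\<Sum>k\<le>M. a k * w ^ k) \<le> \<rho> + \<delta> M" if w: "norm w = 1" for w
    proof -
      have s: "summable (\<lambda>k. norm (a k * w ^ k))" using summ w by (simp add: norm_mult norm_power)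
      have "(\<Sum>k. a k * w ^ k) = (\<Sum>k. a (k + Suc M) * w ^ (k + Suc M)) + (\<Sum>k\<le>M. a k * w ^ k)"
        using suminf_split_initial_segment[OF summable_norm_cancel[OF s], of "Suc M"]
        by (simp add: lessThan_Suc_atMost)
      moreover have "norm (\<Sum>k. a (k + Suc M) * w ^ (k + Suc M)) \<le> (\<Sum>k. norm (a (k + Suc M) * w ^ (k + Suc M)))"
        by (rule summable_norm) (use summable_ignore_initial_segment[OF s, of "Suc M"] in simp)
      moreover have "(\<Sum>k. norm (a (k + Suc M) * w ^ (k + Suc M))) = \<delta> M"
        using w by (simp add: \<delta>_def norm_mult norm_power)
      ultimately have "norm (\<Sum>k\<le>M. a k * w ^ k) \<le> norm (\<Sum>k. a k * w ^ k) + \<delta> M"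
        using norm_triangle_ineq4[of "\<Sum>k. a k * w ^ k" "\<Sum>k. a (k + Suc M) * w ^ (k + Suc M)"]
        by simp
      then show ?thesis using bound[OF w] by linarith
    qed
    have SN: "S \<le> (\<Sum>k<N. (norm (c k))\<^sup>2)"
    proof -
      have "S = (\<Sum>k\<le>n. (norm (c k))\<^sup>2)"
        unfolding S_def
      proof (intro sum.cong refl)
        fix k assume k: "k \<in> {..n}"
        have "(\<Sum>i\<le>k. a (k - i) * b i) = c k"
          unfolding c_def using k M by (intro sum.cong) (auto simp: a'_def b'_def)
        then show "(norm (\<Sum>i\<le>k. a (k - i) * b i))\<^sup>2 = (norm (c k))\<^sup>2" by simp
      qed
      also have "\<dots> \<le> (\<Sum>k<N. (norm (c k))\<^sup>2)"
        by (rule sum_mono2) (auto simp: N_def)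
      finally show ?thesis .
    qed
    have "real N * S \<le> real N * (\<Sum>k<N. (norm (c k))\<^sup>2)"
      using SN by (intro mult_left_mono) auto
    also have "\<dots> = (\<Sum>m<N. (norm (\<Sum>k<N. c k * z m ^ k))\<^sup>2)"
      unfolding z_def by (rule parseval_roots_of_unity[symmetric])
    also have "\<dots> = (\<Sum>m<N. (norm (\<Sum>k\<le>M. a k * z m ^ k))\<^sup>2 * (norm (\<Sum>k\<le>n. b k * z m ^ k))\<^sup>2)"
      by (simp add: prod norm_mult power_mult_distrib)
    also have "\<dots> \<le> (\<Sum>m<N. (\<rho> + \<delta> M)\<^sup>2 * (norm (\<Sum>k\<le>n. b k * z m ^ k))\<^sup>2)"
      by (intro sum_mono mult_right_mono power_mono bd) (auto simp: z_def)
    also have "\<dots> = (\<rho> + \<delta> M)\<^sup>2 * (\<Sum>m<N. (norm (\<Sum>k<N. b' k * z m ^ k))\<^sup>2)"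
    proof -
      have "(\<Sum>k\<le>n. b k * w ^ k) = (\<Sum>k<N. b' k * w ^ k)" for w
        by (rule sum.mono_neutral_cong_left) (auto simp: N_def b'_def)
      then show ?thesis by (simp add: sum_distrib_left)
    qed
    also have "(\<Sum>m<N. (norm (\<Sum>k<N. b' k * z m ^ k))\<^sup>2) = real N * (\<Sum>k<N. (norm (b' k))\<^sup>2)"
      unfolding z_def by (rule parseval_roots_of_unity)
    also have "(\<Sum>k<N. (norm (b' k))\<^sup>2) = \<beta>"
      unfolding \<beta>_def by (rule sum.mono_neutral_cong_right) (auto simp: N_def b'_def)
    finally have "real N * S \<le> real N * ((\<rho> + \<delta> M)\<^sup>2 * \<beta>)" by (simp add: mult_ac)
    moreover have "real N > 0" by (simp add: N_def)
    ultimately show ?thesis using mult_le_cancel_left_pos by blast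
  qed
  have "(\<lambda>M. \<Sum>k. norm (a (k + M))) \<longlonglongrightarrow> 0"
    by (rule suminf_exist_split2[OF summ])
  then have "\<delta> \<longlonglongrightarrow> 0" unfolding \<delta>_def by (rule LIMSEQ_Suc)
  then have "(\<lambda>M. (\<rho> + \<delta> M)\<^sup>2 * \<beta>) \<longlonglongrightarrow> (\<rho> + 0)\<^sup>2 * \<beta>"
    by (intro tendsto_intros)
  then have "S \<le> (\<rho> + 0)\<^sup>2 * \<beta>"
    by (rule tendsto_lowerbound) (use step in \<open>auto simp: eventually_sequentially\<close>)
  then show ?thesis by (simp add: S_def \<beta>_def)
qed

section \<open>Exponential decay of Schur parameters\<close>

text \<open>
  The Wall polynomials \<open>A\<close>, \<open>B\<close> and their reversals \<open>A'\<close>, \<open>B'\<close> are, up to factors \<open>fps_X\<close>, the entries of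
  the product of the first \<open>n + 1\<close> transfer matrices of the Schur algorithm.  The quotient \<open>A / B\<close> is the approximant obtained by
  stopping after \<open>n + 1\<close> steps.  The last two equations say how well the approximants match the
  power series; together with the symmetry under reversal of coefficients they become a linear system for \<open>A\<close> and \<open>B\<close>.
\<close>

lemma wall_polynomials:
  fixes F :: "nat \<Rightarrow> complex fps"
  assumes step: "\<And>n. F n - fps_const (r n) = fps_X * F (Suc n) * (1 - fps_const (cnj (r n)) * F n)"
  shows "\<exists>A B A' B' \<delta>.
    (\<forall>k>n. A $ k = 0 \<and> B $ k = 0 \<and> A' $ k = 0 \<and> B' $ k = 0) \<and>
    (\<forall>k\<le>n. A' $ k = cnj (A $ (n - k)) \<and> B' $ k = cnj (B $ (n - k))) \<and>
    B $ 0 = 1 \<and> \<delta> $ 0 = of_real (\<Prod>k\<le>n. 1 - (norm (r k))\<^sup>2) \<and>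
    B' - F 0 * A' = fps_X ^ n * \<delta> \<and>
    F 0 * B - A = fps_X * F (Suc n) * (fps_X ^ n * \<delta>)"
proof (induction n)
  have F0: "F n $ 0 = r n" for n
    using arg_cong[OF step[of n], of "\<lambda>f :: complex fps. f $ 0"] by simp
  {
    case 0
    let ?A = "fps_const (r 0)" and ?A' = "fps_const (cnj (r 0))"
    have "(1 - ?A' * F 0) $ 0 = of_real (\<Prod>k\<le>0. 1 - (norm (r k))\<^sup>2)"
      by (simp add: F0 complex_norm_square mult.commute del: of_real_power)
    then show ?case
      using step[of 0]
      by (intro exI[of _ ?A] exI[of _ 1] exI[of _ ?A'] exI[of _ "1 - ?A' * F 0"])
        (auto simp: mult.commute)
  next
    case (Suc n)
    then obtain A B A' B' \<delta> :: "complex fps" where IH: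
      "\<And>k. k > n \<Longrightarrow> A $ k = 0 \<and> B $ k = 0 \<and> A' $ k = 0 \<and> B' $ k = 0"
      "\<And>k. k \<le> n \<Longrightarrow> A' $ k = cnj (A $ (n - k)) \<and> B' $ k = cnj (B $ (n - k))"
      "B $ 0 = 1" "\<delta> $ 0 = of_real (\<Prod>k\<le>n. 1 - (norm (r k))\<^sup>2)"
      "B' - F 0 * A' = fps_X ^ n * \<delta>"
      "F 0 * B - A = fps_X * F (Suc n) * (fps_X ^ n * \<delta>)"
      by blast
    define c where "c = fps_const (r (Suc n))"
    define c' where "c' = fps_const (cnj (r (Suc n)))"
    define A1 where "A1 = A + c * (fps_X * B')"
    define B1 where "B1 = B + c * (fps_X * A')"
    define A1' where "A1' = fps_X * A' + c' * B"
    define B1' where "B1' = fps_X * B' + c' * A"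
    define \<delta>1 where "\<delta>1 = \<delta> * (1 - c' * F (Suc n))"
    note defs = A1_def B1_def A1'_def B1'_def
    have D1: "B1' - F 0 * A1' = fps_X ^ Suc n * \<delta>1"
    proof -
      have "B1' - F 0 * A1' = fps_X * (B' - F 0 * A') - c' * (F 0 * B - A)"
        by (simp add: defs algebra_simps)
      also have "\<dots> = fps_X ^ Suc n * \<delta>1" unfolding IH(5,6) \<delta>1_def by (simp add: algebra_simps)
      finally show ?thesis .
    qed
    have E1: "F 0 * B1 - A1 = fps_X * F (Suc (Suc n)) * (fps_X ^ Suc n * \<delta>1)"
    proof -
      have "F 0 * B1 - A1 = (F 0 * B - A) - c * (fps_X * (B' - F 0 * A'))"
        by (simp add: defs algebra_simps)
      also have "\<dots> = fps_X * (fps_X ^ n * \<delta>) * (F (Suc n) - c)"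
        unfolding IH(5,6) by (simp add: algebra_simps)
      also have "F (Suc n) - c = fps_X * F (Suc (Suc n)) * (1 - c' * F (Suc n))"
        using step[of "Suc n"] by (simp add: c_def c'_def)
      finally show ?thesis by (simp add: \<delta>1_def algebra_simps)
    qed
    have deg: "\<forall>k>Suc n. A1 $ k = 0 \<and> B1 $ k = 0 \<and> A1' $ k = 0 \<and> B1' $ k = 0"
      using IH(1) by (auto simp: defs c_def c'_def)
    have rev: "A1' $ k = cnj (A1 $ (Suc n - k)) \<and> B1' $ k = cnj (B1 $ (Suc n - k))" if "k \<le> Suc n" for k
    proof (cases k)
      case 0
      then show ?thesis using IH(1)[of "Suc n"] IH(2)[of n] by (simp add: defs c_def c'_def)
    next
      case (Suc m)
      show ?thesis
      proof (cases "m = n")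
        case True
        then show ?thesis using Suc IH(1)[of "Suc n"] IH(2)[of n] by (simp add: defs c_def c'_def)
      next
        case False
        then have m: "m < n" using Suc that by simp
        then have "n - m = Suc (n - Suc m)" by simp
        then show ?thesis
          using Suc m IH(2)[of m] IH(2)[of "n - Suc m"] IH(2)[of "Suc m"] by (simp add: defs c_def c'_def Suc_diff_Suc)
      qed
    qed
    have "B1 $ 0 = 1" by (simp add: defs IH(3) c_def)
    moreover have "\<delta>1 $ 0 = of_real (\<Prod>k\<le>Suc n. 1 - (norm (r k))\<^sup>2)"
      by (simp add: \<delta>1_def IH(4) c'_def F0 complex_norm_square mult_ac del: of_real_power)
    ultimately show ?case using D1 E1 deg rev
      by (intro exI[of _ A1] exI[of _ B1] exI[of _ A1'] exI[of _ B1'] exI[of _ \<delta>1]) simp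
  }
qed

text \<open>
  Let \<open>T\<close> be the lower triangular Toeplitz matrix of \<open>F 0\<close>, of size \<open>n + 1\<close>.  The order of contact of the
  Wall polynomials says \<open>A = T B\<close> and \<open>B = \<omega> e\<^sub>0 + T\<^sup>* A\<close>, and the next parameter is read off from
  the coefficient of degree \<open>n + 1\<close> of \<open>F 0 * B\<close>.  In the norm with weights \<open>R\<^sup>k\<close> the matrix \<open>T\<close> becomes
  the Toeplitz matrix of the function on the circle of radius \<open>R\<close>, and \<open>T\<^sup>*\<close> becomes the adjoint of the
  Toeplitz matrix on the circle of radius \<open>1 / R\<close>.  Both have norm at most \<open>\<rho>\<close>, so the weighted norm of \<open>B\<close>
  is bounded independently of \<open>n\<close>, and \<open>\<omega>\<close> is bounded below.
\<close>

lemma schur_parameter_bound: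
  fixes F :: "nat \<Rightarrow> complex fps"
  assumes step: "\<And>n. F n - fps_const (r n) = fps_X * F (Suc n) * (1 - fps_const (cnj (r n)) * F n)"
    and r: "\<And>n. norm (r n) < 1"
    and R: "R > 1" and summ: "summable (\<lambda>k. norm (F 0 $ k) * R ^ k)"
    and bound: "\<And>w. norm w \<le> R \<Longrightarrow> norm (\<Sum>k. F 0 $ k * w ^ k) \<le> \<rho>"
    and \<rho>: "\<rho> < 1"
  shows "norm (r (Suc n)) \<le> real (Suc n) * (1 / (1 - \<rho>\<^sup>2))\<^sup>2 * (1 / R) ^ Suc n"
proof -
  define a where "a k = F 0 $ k" for k
  obtain A B A' B' \<delta> :: "complex fps" where W:
    "\<And>k. k > n \<Longrightarrow> A $ k = 0 \<and> B $ k = 0 \<and> A' $ k = 0 \<and> B' $ k = 0"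
    "\<And>k. k \<le> n \<Longrightarrow> A' $ k = cnj (A $ (n - k)) \<and> B' $ k = cnj (B $ (n - k))"
    "B $ 0 = 1" "\<delta> $ 0 = of_real (\<Prod>k\<le>n. 1 - (norm (r k))\<^sup>2)"
    "B' - F 0 * A' = fps_X ^ n * \<delta>"
    "F 0 * B - A = fps_X * F (Suc n) * (fps_X ^ n * \<delta>)"
    using wall_polynomials[of F r n, OF step] by blast
  define \<omega> where "\<omega> = (\<Prod>k\<le>n. 1 - (norm (r k))\<^sup>2)"
  have \<omega>: "0 \<le> \<omega>" "\<omega> \<le> 1"
    unfolding \<omega>_def using r by (auto intro!: prod_nonneg prod_le_1 simp: abs_square_le_1 less_imp_le)
  have \<rho>0: "\<rho> \<ge> 0" using order_trans[OF norm_ge_zero bound[of 0]] R by simp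
  have F0: "F n $ 0 = r n" for n
    using arg_cong[OF step[of n], of "\<lambda>f :: complex fps. f $ 0"] by simp
  have conv: "(F 0 * G) $ k = (\<Sum>i\<le>k. a (k - i) * G $ i)" for G :: "complex fps" and k
    unfolding fps_mult_nth a_def
    by (rule sum.reindex_bij_witness[of _ "\<lambda>i. k - i" "\<lambda>i. k - i"]) auto
  have E: "F 0 * B - A = fps_X ^ Suc n * (F (Suc n) * \<delta>)" using W(6) by (simp add: mult_ac)
  \<comment> \<open>\<open>A = T B\<close>\<close>
  have A_nth: "A $ k = (\<Sum>i\<le>k. a (k - i) * B $ i)" if "k \<le> n" for k
  proof -
    have "(F 0 * B - A) $ k = 0" unfolding E using that by (simp add: fps_X_power_mult_nth del: power_Suc)
    then show ?thesis by (simp flip: conv)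
  qed
  have r_nth: "r (Suc n) * of_real \<omega> = (\<Sum>i\<le>n. a (Suc n - i) * B $ i)"
  proof -
    have "(F 0 * B - A) $ Suc n = r (Suc n) * of_real \<omega>"
      unfolding E by (simp add: fps_X_power_mult_nth F0 W(4) \<omega>_def del: power_Suc)
    moreover have "(F 0 * B - A) $ Suc n = (\<Sum>i\<le>Suc n. a (Suc n - i) * B $ i)"
      using W(1)[of "Suc n"] conv[of B "Suc n"] by simp
    ultimately show ?thesis using W(1)[of "Suc n"] by simp
  qed
  \<comment> \<open>\<open>B = \<omega> e\<^sub>0 + T\<^sup>* A\<close>, the equation for the reversed polynomials read backwards and conjugated\<close>
  have B_nth: "B $ m = (if m = 0 then of_real \<omega> else 0) + (\<Sum>i=m..n. cnj (a (i - m)) * A $ i)" if m: "m \<le> n" for m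
  proof -
    have "(B' - F 0 * A') $ (n - m) = (if m = 0 then of_real \<omega> else 0)"
      unfolding W(5) using m by (simp add: fps_X_power_mult_nth W(4) \<omega>_def)
    then have "B' $ (n - m) - (\<Sum>j\<le>n - m. a (n - m - j) * A' $ j) = (if m = 0 then of_real \<omega> else 0)"
      by (simp add: conv)
    moreover have "B' $ (n - m) = cnj (B $ m)" using W(2)[of "n - m"] m by simp
    moreover have "(\<Sum>j\<le>n - m. a (n - m - j) * A' $ j) = (\<Sum>i=m..n. a (i - m) * cnj (A $ i))"
      by (rule sum.reindex_bij_witness[of _ "\<lambda>i. n - i" "\<lambda>i. n - i"]) (use m W(2) in \<open>auto simp: diff_diff_left add.commute\<close>)
    ultimately have "cnj (B $ m) = (if m = 0 then of_real \<omega> else 0) + (\<Sum>i=m..n. a (i - m) * cnj (A $ i))"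
      by (simp add: diff_eq_eq)
    then have "cnj (cnj (B $ m)) = cnj ((if m = 0 then of_real \<omega> else 0) + (\<Sum>i=m..n. a (i - m) * cnj (A $ i)))"
      by (rule arg_cong)
    then show ?thesis by (simp add: cnj_sum split: if_splits)
  qed
  define \<beta> where "\<beta> = (\<Sum>k\<le>n. (norm (B $ k * of_real R ^ k))\<^sup>2)"
  have expand: "(\<Sum>i\<le>k. (a (k - i) * of_real S ^ (k - i)) * (b i * of_real S ^ i)) = (\<Sum>i\<le>k. a (k - i) * b i) * of_real S ^ k"
    for b :: "nat \<Rightarrow> complex" and S :: real and k
    unfolding sum_distrib_right
  proof (intro sum.cong refl)
    fix i assume "i \<in> {..k}"
    then have "of_real S ^ k = (of_real S ^ (k - i) * of_real S ^ i :: complex)" by (simp flip: power_add)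
    then show "(a (k - i) * of_real S ^ (k - i)) * (b i * of_real S ^ i) = a (k - i) * b i * of_real S ^ k"
      by (simp add: mult_ac)
  qed
  have contraction: "(\<Sum>k\<le>n. (norm (\<Sum>i\<le>k. (a (k - i) * of_real S ^ (k - i)) * b i))\<^sup>2) \<le> \<rho>\<^sup>2 * (\<Sum>k\<le>n. (norm (b k))\<^sup>2)"
    if S: "0 \<le> S" "S \<le> R" for S b n
  proof (rule analytic_toeplitz_contraction)
    show "summable (\<lambda>k. norm (a k * of_real S ^ k))"
      using S by (intro summable_comparison_test'[OF summ, of 0])
        (auto simp: a_def norm_mult norm_power intro!: mult_left_mono power_mono)
    show "norm (\<Sum>k. a k * of_real S ^ k * w ^ k) \<le> \<rho>" if "norm w = 1" for w
    proof -
      have "a k * of_real S ^ k * w ^ k = F 0 $ k * (of_real S * w) ^ k" for k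
        by (simp add: a_def power_mult_distrib)
      then show ?thesis using bound[of "of_real S * w"] S that by (simp add: norm_mult)
    qed
  qed
  have A_norm: "(\<Sum>k\<le>n. (norm (A $ k * of_real R ^ k))\<^sup>2) \<le> \<rho>\<^sup>2 * \<beta>"
    using contraction[where S = R and n = n and b = "\<lambda>k. B $ k * of_real R ^ k"] R
    by (simp add: \<beta>_def expand A_nth)
  \<comment> \<open>Pairing the second equation with \<open>B\<close> moves \<open>T\<^sup>*\<close> to the other side, where it acts as \<open>T\<close> with
    weights \<open>1 / R\<close> on the weighted coefficients of \<open>B\<close>; the constant coefficient of \<open>B\<close> being 1, the
    first term contributes \<open>\<omega>\<close>.\<close>
  have dual: "\<beta> \<le> \<omega> + \<rho>\<^sup>2 * \<beta>"
  proof -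
    define b where "b m = B $ m * of_real R ^ m" for m
    have sq: "(of_real R :: complex) ^ (2 * m) = of_real R ^ m * of_real R ^ m" for m
      by (simp add: mult_2 power_add)
    define g where "g i = (\<Sum>m\<le>i. (a (i - m) * of_real (1 / R) ^ (i - m)) * b m)" for i
    have entry: "cnj (a (i - m)) * A $ i * cnj (B $ m) * of_real R ^ (2 * m)
        = (A $ i * of_real R ^ i) * cnj ((a (i - m) * of_real (1 / R) ^ (i - m)) * b m)" if "m \<le> i" for i m
    proof -
      have "(of_real R :: complex) ^ i = of_real R ^ (i - m) * of_real R ^ m" using that by (simp flip: power_add)
      then show ?thesis using R unfolding sq by (simp add: b_def power_divide)
    qed
    have "complex_of_real \<beta> = (\<Sum>m\<le>n. B $ m * cnj (B $ m) * of_real R ^ (2 * m))"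
      unfolding \<beta>_def of_real_sum complex_norm_square sq by (simp add: mult_ac)
    also have "\<dots> = (\<Sum>m\<le>n. (if m = 0 then of_real \<omega> else 0) + (\<Sum>i=m..n. cnj (a (i - m)) * A $ i * cnj (B $ m) * of_real R ^ (2 * m)))"
    proof (intro sum.cong refl)
      fix m assume m: "m \<in> {..n}"
      have "B $ m * cnj (B $ m) * of_real R ^ (2 * m)
        = ((if m = 0 then of_real \<omega> else 0) + (\<Sum>i=m..n. cnj (a (i - m)) * A $ i)) * (cnj (B $ m) * of_real R ^ (2 * m))"
        using B_nth[of m] m by (simp add: mult.assoc)
      also have "\<dots> = (if m = 0 then of_real \<omega> else 0) + (\<Sum>i=m..n. cnj (a (i - m)) * A $ i * cnj (B $ m) * of_real R ^ (2 * m))"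
        using W(3) by (simp add: distrib_right sum_distrib_right mult.assoc)
      finally show "B $ m * cnj (B $ m) * of_real R ^ (2 * m) = \<dots>" .
    qed
    also have "\<dots> = of_real \<omega> + (\<Sum>m\<le>n. \<Sum>i=m..n. cnj (a (i - m)) * A $ i * cnj (B $ m) * of_real R ^ (2 * m))"
      by (simp add: sum.distrib)
    also have "(\<Sum>m\<le>n. \<Sum>i=m..n. cnj (a (i - m)) * A $ i * cnj (B $ m) * of_real R ^ (2 * m))
        = (\<Sum>i\<le>n. \<Sum>m\<le>i. cnj (a (i - m)) * A $ i * cnj (B $ m) * of_real R ^ (2 * m))"
    proof -
      have "(\<Sum>(m, i)\<in>Sigma {..n} (\<lambda>m. {m..n}). t m i) = (\<Sum>(i, m)\<in>Sigma {..n} (\<lambda>i. {..i}). t m i)" for t :: "nat \<Rightarrow> nat \<Rightarrow> complex"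
        by (rule sum.reindex_bij_witness[of _ "\<lambda>(i, m). (m, i)" "\<lambda>(m, i). (i, m)"]) auto
      then show ?thesis by (simp add: sum.Sigma)
    qed
    also have "\<dots> = (\<Sum>i\<le>n. (A $ i * of_real R ^ i) * cnj (g i))"
      unfolding g_def cnj_sum sum_distrib_left by (intro sum.cong refl entry) auto
    finally have "complex_of_real (\<beta> - \<omega>) = (\<Sum>i\<le>n. (A $ i * of_real R ^ i) * cnj (g i))"
      by simp
    then have "\<beta> - \<omega> \<le> norm (\<Sum>i\<le>n. (A $ i * of_real R ^ i) * cnj (g i))"
      by (metis abs_ge_self norm_of_real)
    also have "\<dots> \<le> (\<Sum>i\<le>n. norm (A $ i * of_real R ^ i) * norm (g i))"
      by (rule order_trans[OF norm_sum]) (simp add: norm_mult)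
    also have "\<dots> \<le> (\<Sum>i\<le>n. ((norm (A $ i * of_real R ^ i))\<^sup>2 + (norm (g i))\<^sup>2) / 2)"
    proof (intro sum_mono)
      fix i
      show "norm (A $ i * of_real R ^ i) * norm (g i) \<le> ((norm (A $ i * of_real R ^ i))\<^sup>2 + (norm (g i))\<^sup>2) / 2"
        using sum_squares_bound[of "norm (A $ i * of_real R ^ i)" "norm (g i)"] by simp
    qed
    also have "\<dots> = ((\<Sum>i\<le>n. (norm (A $ i * of_real R ^ i))\<^sup>2) + (\<Sum>i\<le>n. (norm (g i))\<^sup>2)) / 2"
      by (simp add: sum.distrib flip: sum_divide_distrib)
    also have "\<dots> \<le> (\<rho>\<^sup>2 * \<beta> + \<rho>\<^sup>2 * \<beta>) / 2"
    proof -
      have "1 / R \<le> R" using R using mult_mono[of 1 R 1 R] by (simp add: divide_le_eq)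
      then have "(\<Sum>i\<le>n. (norm (g i))\<^sup>2) \<le> \<rho>\<^sup>2 * \<beta>"
        unfolding g_def \<beta>_def b_def using contraction[where S = "1 / R" and n = n and b = "\<lambda>m. B $ m * of_real R ^ m"] R by simp
      with A_norm show ?thesis by (intro divide_right_mono add_mono) simp_all
    qed
    finally show ?thesis by (simp add: algebra_simps)
  qed
  have \<rho>1: "0 < 1 - \<rho>\<^sup>2" "1 - \<rho>\<^sup>2 \<le> 1" using \<rho> \<rho>0 by (auto simp: abs_square_less_1)
  have \<beta>1: "\<beta> \<ge> 1"
  proof -
    have "(norm (B $ 0 * of_real R ^ 0))\<^sup>2 \<le> \<beta>" unfolding \<beta>_def by (rule member_le_sum) auto
    then show ?thesis using W(3) by simp
  qed
  have \<beta>_le: "\<beta> * (1 - \<rho>\<^sup>2) \<le> \<omega>" using dual by (simp add: algebra_simps)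
  have \<omega>_ge: "1 - \<rho>\<^sup>2 \<le> \<omega>"
  proof -
    have "1 * (1 - \<rho>\<^sup>2) \<le> \<beta> * (1 - \<rho>\<^sup>2)" using \<beta>1 \<rho>1(1) by (intro mult_right_mono) auto
    from order_trans[OF this \<beta>_le] show ?thesis by simp
  qed
  have \<beta>_le': "\<beta> \<le> 1 / (1 - \<rho>\<^sup>2)"
    using \<beta>_le \<omega>(2) \<rho>1 by (simp add: pos_le_divide_eq)
  have B_bound: "norm (B $ k) * R ^ k \<le> 1 / (1 - \<rho>\<^sup>2)" if "k \<le> n" for k
  proof -
    have "(norm (B $ k * of_real R ^ k))\<^sup>2 \<le> \<beta>" unfolding \<beta>_def using that by (intro member_le_sum) auto
    also have "\<beta> \<le> \<beta>\<^sup>2" using \<beta>1 by (simp add: self_le_power)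
    finally have "norm (B $ k * of_real R ^ k) \<le> \<beta>" using \<beta>1 by (simp add: power2_le_iff_abs_le)
    then show ?thesis using \<beta>_le' R by (simp add: norm_mult norm_power)
  qed
  have a_bound: "norm (a k) * R ^ k \<le> 1" for k
  proof -
    define b :: "nat \<Rightarrow> complex" where "b i = (if i = 0 then 1 else 0)" for i
    have "(\<Sum>i\<le>m. (a (m - i) * of_real R ^ (m - i)) * b i) = a m * of_real R ^ m" for m
    proof -
      have "(\<Sum>i\<le>m. (a (m - i) * of_real R ^ (m - i)) * b i) = (\<Sum>i\<in>{0}. (a (m - i) * of_real R ^ (m - i)) * b i)"
        by (rule sum.mono_neutral_right) (auto simp: b_def)
      then show ?thesis by (simp add: b_def)
    qed
    moreover have "(\<Sum>i\<le>k. (norm (b i))\<^sup>2) = 1"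
    proof -
      have "(\<Sum>i\<le>k. (norm (b i))\<^sup>2) = (\<Sum>i\<in>{0}. (norm (b i))\<^sup>2)"
        by (rule sum.mono_neutral_right) (auto simp: b_def)
      then show ?thesis by (simp add: b_def)
    qed
    ultimately have "(\<Sum>m\<le>k. (norm (a m * of_real R ^ m))\<^sup>2) \<le> \<rho>\<^sup>2"
      using contraction[where S = R and n = k and b = b] R by simp
    moreover have "(norm (a k * of_real R ^ k))\<^sup>2 \<le> (\<Sum>m\<le>k. (norm (a m * of_real R ^ m))\<^sup>2)"
      by (rule member_le_sum) auto
    ultimately have "(norm (a k * of_real R ^ k))\<^sup>2 \<le> 1" using \<rho>1 by linarith
    then have "norm (a k * of_real R ^ k) \<le> 1" by (simp add: abs_square_le_1)
    then show ?thesis using R by (simp add: norm_mult norm_power)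
  qed
  have "norm (r (Suc n)) * \<omega> * R ^ Suc n = norm (\<Sum>i\<le>n. a (Suc n - i) * B $ i) * R ^ Suc n"
    using arg_cong[OF r_nth, of norm] \<omega>(1) by (simp add: norm_mult)
  also have "\<dots> \<le> (\<Sum>i\<le>n. norm (a (Suc n - i) * B $ i)) * R ^ Suc n"
    using R by (intro mult_right_mono norm_sum) auto
  also have "\<dots> = (\<Sum>i\<le>n. (norm (a (Suc n - i)) * R ^ (Suc n - i)) * (norm (B $ i) * R ^ i))"
    unfolding sum_distrib_right
  proof (intro sum.cong refl)
    fix i assume "i \<in> {..n}"
    then have "R ^ Suc n = R ^ (Suc n - i) * R ^ i" by (simp flip: power_add)
    then show "norm (a (Suc n - i) * B $ i) * R ^ Suc n = (norm (a (Suc n - i)) * R ^ (Suc n - i)) * (norm (B $ i) * R ^ i)"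
      by (simp add: norm_mult mult_ac)
  qed
  also have "\<dots> \<le> (\<Sum>i\<le>n. 1 * (1 / (1 - \<rho>\<^sup>2)))"
    using R by (intro sum_mono mult_mono a_bound B_bound) auto
  finally have main: "norm (r (Suc n)) * \<omega> * R ^ Suc n \<le> real (Suc n) * (1 / (1 - \<rho>\<^sup>2))" by simp
  have "norm (r (Suc n)) * R ^ Suc n * (1 - \<rho>\<^sup>2) \<le> norm (r (Suc n)) * R ^ Suc n * \<omega>"
    using R \<omega>_ge by (intro mult_left_mono) auto
  also have "\<dots> \<le> real (Suc n) * (1 / (1 - \<rho>\<^sup>2))" using main by (simp add: mult_ac)
  finally have "norm (r (Suc n)) * R ^ Suc n \<le> real (Suc n) * (1 / (1 - \<rho>\<^sup>2))\<^sup>2"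
    using \<rho>1 by (simp add: pos_le_divide_eq[symmetric] power2_eq_square)
  then have "norm (r (Suc n)) \<le> real (Suc n) * (1 / (1 - \<rho>\<^sup>2))\<^sup>2 / R ^ Suc n"
    using R by (subst pos_le_divide_eq) auto
  then show ?thesis by (simp only: power_inverse divide_inverse mult_1_left)
qed

lemma schur_parameters_summable:
  fixes F :: "nat \<Rightarrow> complex fps"
  assumes step: "\<And>n. F n - fps_const (r n) = fps_X * F (Suc n) * (1 - fps_const (cnj (r n)) * F n)"
    and r: "\<And>n. norm (r n) < 1"
    and R: "R > 1" and summ: "summable (\<lambda>k. norm (F 0 $ k) * R ^ k)"
    and bound: "\<And>w. norm w \<le> R \<Longrightarrow> norm (\<Sum>k. F 0 $ k * w ^ k) \<le> \<rho>"
    and \<rho>: "\<rho> < 1"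
  shows "summable (\<lambda>n. norm (r n))"
proof -
  have "summable (\<lambda>n. of_nat n * (1 / R) ^ n)"
  proof -
    have "summable (\<lambda>n. diffs (\<lambda>_. 1) n * (1 / R) ^ n)"
      using R by (intro termdiff_converges[of _ 1]) (auto intro: summable_geometric)
    then have "summable (\<lambda>n. of_nat (Suc n) * (1 / R) ^ n)" by (simp add: diffs_def)
    then have "summable (\<lambda>n. (1 / R) * (of_nat (Suc n) * (1 / R) ^ n))" by (rule summable_mult)
    then have "summable (\<lambda>n. of_nat (Suc n) * (1 / R) ^ Suc n)" by (simp add: mult_ac)
    then show ?thesis by (subst (asm) summable_Suc_iff)
  qed
  then have "summable (\<lambda>n. (1 / (1 - \<rho>\<^sup>2))\<^sup>2 * (of_nat (Suc n) * (1 / R) ^ Suc n))"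
    by (intro summable_mult) (subst summable_Suc_iff)
  then have "summable (\<lambda>n. norm (r (Suc n)))"
    by (rule summable_comparison_test'[of _ 0])
      (use schur_parameter_bound[of F r, OF step r R summ bound \<rho>] in \<open>simp add: mult_ac del: power_Suc of_nat_Suc\<close>)
  then show ?thesis by (subst (asm) summable_Suc_iff)
qed

section \<open>Moebius maps of the disc\<close>

definition mobius :: "complex \<Rightarrow> complex \<Rightarrow> complex"
  where "mobius r w = (w + r) / (1 + cnj r * w)"

lemma one_plus_cnj_mult_nonzero:
  assumes "norm (r * w) < 1"
  shows "1 + cnj r * w \<noteq> 0"
proof
  assume "1 + cnj r * w = 0"
  then have "cnj r * w = -1" by (simp add: add_eq_0_iff)
  then have "norm (r * w) = 1"
    by (metis complex_mod_cnj norm_minus_cancel norm_mult norm_one)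
  then show False using assms by simp
qed

lemma one_minus_norm_mobius_sq:
  assumes "1 + cnj r * w \<noteq> 0"
  shows "1 - (norm (mobius r w))\<^sup>2 = (1 - (norm r)\<^sup>2) * (1 - (norm w)\<^sup>2) / (norm (1 + cnj r * w))\<^sup>2"
proof -
  have "(norm (1 + cnj r * w))\<^sup>2 - (norm (w + r))\<^sup>2 = (1 - (norm r)\<^sup>2) * (1 - (norm w)\<^sup>2)"
  proof -
    have "complex_of_real ((norm (1 + cnj r * w))\<^sup>2 - (norm (w + r))\<^sup>2)
        = complex_of_real ((1 - (norm r)\<^sup>2) * (1 - (norm w)\<^sup>2))"
      unfolding of_real_diff of_real_mult complex_norm_square of_real_1 by (simp add: algebra_simps)
    then show ?thesis using of_real_eq_iff by blast
  qed
  then show ?thesis using assms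
    by (simp add: mobius_def norm_divide power_divide divide_simps)
qed

lemma norm_mult_lt_one:
  fixes r w :: complex
  assumes "norm r < 1" "norm w \<le> 1"
  shows "norm (r * w) < 1"
  using assms mult_left_le[of "norm w" "norm r"] by (simp add: norm_mult)

lemma norm_mobius_le:
  assumes "norm r < 1" "norm w \<le> 1"
  shows "norm (mobius r w) \<le> 1"
proof -
  have "1 - (norm (mobius r w))\<^sup>2 \<ge> 0"
    unfolding one_minus_norm_mobius_sq[OF one_plus_cnj_mult_nonzero[OF norm_mult_lt_one[OF assms]]]
    using assms by (simp add: abs_square_le_1)
  then show ?thesis by (simp add: abs_square_le_1)
qed

lemma norm_mobius_less:
  assumes "norm r < 1" "norm w < 1"
  shows "norm (mobius r w) < 1"
proof -
  have nz: "1 + cnj r * w \<noteq> 0"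
    using assms by (intro one_plus_cnj_mult_nonzero norm_mult_lt_one) auto
  have "1 - (norm (mobius r w))\<^sup>2 > 0"
    unfolding one_minus_norm_mobius_sq[OF nz]
    using assms nz by (simp add: abs_square_less_1)
  then show ?thesis by (simp add: abs_square_less_1)
qed

lemma norm_one_minus_mult_cnj:
  assumes "norm r < 1"
  shows "norm (1 - r * cnj r) = 1 - (norm r)\<^sup>2"
proof -
  have "1 - r * cnj r = of_real (1 - (norm r)\<^sup>2)"
    by (simp add: complex_norm_square del: of_real_power)
  moreover have "(norm r)\<^sup>2 \<le> 1" using assms by (simp add: abs_square_le_1)
  ultimately show ?thesis by (metis abs_of_nonneg diff_ge_0_iff_ge norm_of_real)
qed

lemma mobius_cross_multiplied:
  assumes "norm r < 1" "norm u \<le> 1"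
  shows "mobius r u - r = u * (1 - cnj r * mobius r u)"
  using one_plus_cnj_mult_nonzero[OF norm_mult_lt_one[OF assms]]
  by (simp add: mobius_def divide_simps) (simp add: algebra_simps)

lemma mobius_inverse:
  assumes r: "norm r < 1" and m: "norm m \<le> 1"
  shows "mobius r (mobius (- r) m) = m"
proof -
  have nz: "1 - cnj r * m \<noteq> 0"
    using one_plus_cnj_mult_nonzero[of "- r" m] norm_mult_lt_one[of "- r" m] assms by simp
  have "norm (r * mobius (- r) m) < 1"
    using norm_mobius_le[of "- r" m] assms by (intro norm_mult_lt_one) auto
  then have nz2: "1 + cnj r * mobius (- r) m \<noteq> 0" by (rule one_plus_cnj_mult_nonzero)
  have nz3: "1 - cnj r * r \<noteq> 0"
    using one_plus_cnj_mult_nonzero[of "- r" r] norm_mult_lt_one[of "- r" r] r by simp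
  have e1: "mobius (- r) m + r = m * (1 - cnj r * r) / (1 - cnj r * m)"
    using nz by (simp add: mobius_def divide_simps) (simp add: algebra_simps)
  have e2: "1 + cnj r * mobius (- r) m = (1 - cnj r * r) / (1 - cnj r * m)"
    using nz by (simp add: mobius_def divide_simps) (simp add: algebra_simps)
  show ?thesis unfolding mobius_def[of r] e1 e2 using nz nz3 by simp
qed

lemma norm_one_plus_cnj_mult_ge:
  assumes "norm w \<le> 1"
  shows "1 - norm r \<le> norm (1 + cnj r * w)"
proof -
  have "norm (cnj r * w) \<le> norm r" using assms by (simp add: norm_mult mult_left_le)
  moreover have "1 - norm (cnj r * w) \<le> norm (1 + cnj r * w)"
    using norm_diff_ineq[of 1 "cnj r * w"] by simp
  ultimately show ?thesis by linarith
qed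

text \<open>
  Bounds the distance of \<open>mobius r\<close> from the identity on the closed disc.  One more than this number is
  \<open>(1 + norm r) / (1 - norm r)\<close>, a Lipschitz constant of \<open>mobius r\<close> there.
\<close>

definition mobius_distortion :: "complex \<Rightarrow> real"
  where "mobius_distortion r = 2 * norm r / (1 - norm r)"

lemma mobius_lipschitz:
  assumes r: "norm r < 1" and u: "norm u \<le> 1" and v: "norm v \<le> 1"
  shows "norm (mobius r u - mobius r v) \<le> (1 + mobius_distortion r) * norm (u - v)"
proof -
  let ?s = "norm r"
  let ?a = "1 + cnj r * u" let ?b = "1 + cnj r * v"
  have nz: "?a \<noteq> 0" "?b \<noteq> 0"
    using one_plus_cnj_mult_nonzero norm_mult_lt_one r u v by auto
  have "mobius r u - mobius r v = (1 - r * cnj r) * (u - v) / (?a * ?b)"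
    using nz by (simp add: mobius_def divide_simps) (simp add: algebra_simps)
  moreover have "norm (1 - r * cnj r) = 1 - ?s\<^sup>2" by (rule norm_one_minus_mult_cnj[OF r])
  ultimately have eq: "norm (mobius r u - mobius r v) = (1 - ?s\<^sup>2) * norm (u - v) / (norm ?a * norm ?b)"
    by (simp add: norm_mult norm_divide)
  have "(1 - ?s) * (1 - ?s) \<le> norm ?a * norm ?b"
    using norm_one_plus_cnj_mult_ge[OF u] norm_one_plus_cnj_mult_ge[OF v] r by (intro mult_mono) auto
  then have "norm (mobius r u - mobius r v) \<le> (1 - ?s\<^sup>2) * norm (u - v) / ((1 - ?s) * (1 - ?s))"
    unfolding eq using r by (intro divide_left_mono mult_nonneg_nonneg mult_pos_pos)
      (auto simp: abs_square_le_1 nz)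
  also have "\<dots> = (1 + ?s) / (1 - ?s) * norm (u - v)"
  proof -
    have "1 - ?s\<^sup>2 = (1 - ?s) * (1 + ?s)" by (simp add: power2_eq_square algebra_simps)
    then show ?thesis using r by simp
  qed
  also have "(1 + ?s) / (1 - ?s) = 1 + mobius_distortion r"
    using r by (simp add: mobius_distortion_def field_simps)
  finally show ?thesis .
qed

lemma mobius_near_identity:
  assumes r: "norm r < 1" and u: "norm u \<le> 1"
  shows "norm (mobius r u - u) \<le> mobius_distortion r"
proof -
  let ?a = "1 + cnj r * u"
  have nz: "?a \<noteq> 0" using one_plus_cnj_mult_nonzero norm_mult_lt_one r u by auto
  have "mobius r u - u = (r - cnj r * u\<^sup>2) / ?a"
    using nz by (simp add: mobius_def divide_simps power2_eq_square) (simp add: algebra_simps)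
  moreover have "norm (r - cnj r * u\<^sup>2) \<le> 2 * norm r"
  proof -
    have "norm (cnj r * u\<^sup>2) \<le> norm r"
      using u by (simp add: norm_mult norm_power mult_left_le power_le_one)
    then show ?thesis using norm_triangle_ineq4[of r "cnj r * u\<^sup>2"] by linarith
  qed
  ultimately show ?thesis
    unfolding mobius_distortion_def using norm_one_plus_cnj_mult_ge[OF u, of r] r
    by (simp add: norm_divide frac_le)
qed

lemma summable_mobius_distortion:
  assumes r: "\<And>n. norm (r n) < 1" and summ: "summable (\<lambda>n. norm (r n))"
  shows "summable (\<lambda>n. mobius_distortion (r n))"
proof (rule summable_comparison_test_ev)
  have "(\<lambda>n. norm (r n)) \<longlonglongrightarrow> 0" by (rule summable_LIMSEQ_zero[OF summ])
  then have "\<forall>\<^sub>F n in sequentially. norm (r n) < 1/2" by (rule order_tendstoD) simp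
  then show "\<forall>\<^sub>F n in sequentially. norm (mobius_distortion (r n)) \<le> 4 * norm (r n)"
  proof eventually_elim
    case (elim n)
    then have "mobius_distortion (r n) \<le> 2 * norm (r n) / (1/2)"
      unfolding mobius_distortion_def by (intro divide_left_mono) auto
    moreover have "mobius_distortion (r n) \<ge> 0"
      unfolding mobius_distortion_def using elim by auto
    ultimately show ?case by simp
  qed
  show "summable (\<lambda>n. 4 * norm (r n))" using summ by (rule summable_mult)
qed

section \<open>Scattering polynomials as Taylor coefficients\<close>

text \<open>
  The Taylor series at 0 of \<open>mobius r\<close>, written as \<open>r + (1 - |r|\<^sup>2) w / (1 + cnj r * w)\<close>.
\<close>

definition mobius_fps :: "complex \<Rightarrow> complex fps"
  where "mobius_fps r = fps_const r + fps_const (1 - r * cnj r) * Abs_fps (\<lambda>q. if q = 0 then 0 else (- cnj r) ^ (q - 1))"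

lemma fps_geometric_power_nth:
  fixes c :: complex
  assumes "j \<ge> 1"
  shows "(Abs_fps (\<lambda>q. if q = 0 then 0 else c ^ (q - 1))) ^ j $ q =
    (if q < j then 0 else of_nat ((q - 1) choose (j - 1)) * c ^ (q - j))"
proof -
  have 1: "Abs_fps (\<lambda>q. if q = 0 then 0 else c ^ (q - 1)) = fps_X * inverse (1 - fps_const c * fps_X)"
    using one_minus_const_fps_X_neg_power'[of 1 c]
    by (auto simp: fps_eq_iff)
  have "(Abs_fps (\<lambda>q. if q = 0 then 0 else c ^ (q - 1))) ^ j
      = fps_X ^ j * Abs_fps (\<lambda>k. of_nat ((j + k - 1) choose k) * c ^ k)"
    unfolding 1 using one_minus_const_fps_X_neg_power'[of j c] assms
    by (simp add: power_mult_distrib fps_inverse_power)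
  moreover have "(j + (q - j) - 1) choose (q - j) = (q - 1) choose (j - 1)" if "j \<le> q"
    using that assms binomial_symmetric[of "j - 1" "q - 1"] by simp
  ultimately show ?thesis by (simp add: fps_X_power_mult_nth)
qed

text \<open>
  The closed formula for the scattering polynomials is the binomial expansion of the power of
  \<open>r + (1 - |r|\<^sup>2) w / (1 + cnj r * w)\<close>; the second binomial coefficient comes from the powers of the
  geometric series.
\<close>

lemma scattering_poly_eq_fps_nth: "scattering_poly p q r = (mobius_fps r ^ p) $ q"
proof -
  define G where "G = Abs_fps (\<lambda>q. if q = 0 then 0 else (- cnj r) ^ (q - 1))"
  define s where "s = 1 - r * cnj r"
  have "mobius_fps r ^ p = (\<Sum>j\<le>p. of_nat (p choose j) * (fps_const s * G) ^ j * fps_const r ^ (p - j))"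
    unfolding mobius_fps_def G_def s_def by (subst add.commute) (rule binomial_ring)
  then have expand: "(mobius_fps r ^ p) $ q = (\<Sum>j\<le>p. of_nat (p choose j) * s ^ j * r ^ (p - j) * (G ^ j $ q))"
  proof -
    have "(of_nat (p choose j) * (fps_const s * G) ^ j * fps_const r ^ (p - j)) $ q
        = of_nat (p choose j) * s ^ j * r ^ (p - j) * (G ^ j $ q)" for j
    proof -
      have "of_nat (p choose j) * (fps_const s * G) ^ j * fps_const r ^ (p - j)
          = fps_const (of_nat (p choose j) * s ^ j * r ^ (p - j)) * G ^ j"
        by (simp add: power_mult_distrib fps_const_power fps_of_nat[symmetric] mult_ac fps_const_mult[symmetric] del: fps_const_mult)
      then show ?thesis by simp
    qed
    then show ?thesis using \<open>mobius_fps r ^ p = _\<close> by (simp only: fps_sum_nth)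
  qed
  have G0: "G ^ 0 $ q = (if q = 0 then 1 else 0)" by simp
  have Gj: "G ^ j $ q = (if q < j then 0 else of_nat ((q - 1) choose (j - 1)) * (- cnj r) ^ (q - j))" if "j \<ge> 1" for j
    unfolding G_def by (rule fps_geometric_power_nth[OF that])
  show ?thesis
  proof (cases "q = 0")
    case True
    have "(mobius_fps r ^ p) $ 0 = r ^ p" by (simp add: mobius_fps_def fps_nth_power_0)
    then show ?thesis using True by (simp add: scattering_poly_def)
  next
    case q: False
    show ?thesis
    proof (cases "p = 0")
      case True
      then show ?thesis using q by (simp add: scattering_poly_def)
    next
      case p: False
      have "(mobius_fps r ^ p) $ q = (\<Sum>j=1..min p q. of_nat (p choose j) * s ^ j * r ^ (p - j) * (G ^ j $ q))"
        unfolding expand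
      proof (rule sum.mono_neutral_right)
        show "\<forall>i\<in>{..p} - {1..min p q}. of_nat (p choose i) * s ^ i * r ^ (p - i) * G ^ i $ q = 0"
        proof
          fix i assume "i \<in> {..p} - {1..min p q}"
          then have "i = 0 \<or> q < i" by auto
          then show "of_nat (p choose i) * s ^ i * r ^ (p - i) * G ^ i $ q = 0"
            using G0 Gj[of i] q by (cases "i = 0") auto
        qed
      qed auto
      also have "\<dots> = scattering_poly p q r"
        using p q by (simp add: scattering_poly_def Gj s_def mult_ac)
      finally show ?thesis by simp
    qed
  qed
qed

text \<open>
  The function obtained from \<open>mobius r\<close>, with \<open>s = norm r\<close>, by making all Taylor coefficients nonnegative.
  Unlike \<open>mobius r\<close> it does not preserve the unit disc: its value at 1 is \<open>1 + 2 * s\<close>.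
\<close>

definition mobius_majorant :: "real \<Rightarrow> real \<Rightarrow> real"
  where "mobius_majorant s y = s + (1 - s\<^sup>2) * y / (1 - s * y)"

lemma mobius_fps_abs_sums:
  assumes "norm r < 1" "0 \<le> y" "norm r * y < 1"
  shows "(\<lambda>q. norm (mobius_fps r $ q) * y ^ q) sums mobius_majorant (norm r) y"
proof -
  have "norm (1 - r * cnj r) = 1 - (norm r)\<^sup>2" by (rule norm_one_minus_mult_cnj[OF assms(1)])
  then have nth: "norm (mobius_fps r $ Suc q) * y ^ Suc q = (1 - (norm r)\<^sup>2) * y * (norm r * y) ^ q" for q
    by (simp add: mobius_fps_def norm_mult norm_power power_mult_distrib)
  have "(\<lambda>q. (1 - (norm r)\<^sup>2) * y * (norm r * y) ^ q) sums ((1 - (norm r)\<^sup>2) * y * (1 / (1 - norm r * y)))"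
    using assms by (intro sums_mult geometric_sums) (simp add: abs_mult)
  then have "(\<lambda>q. norm (mobius_fps r $ Suc q) * y ^ Suc q) sums ((1 - (norm r)\<^sup>2) * y / (1 - norm r * y))"
    unfolding nth by simp
  from sums_Suc[OF this] show ?thesis
    by (simp add: mobius_majorant_def mobius_fps_def add.commute)
qed

lemma mobius_fps_sums:
  assumes "norm r < 1" "norm (r * w) < 1"
  shows "(\<lambda>q. mobius_fps r $ q * w ^ q) sums mobius r w"
proof -
  have nz: "1 + cnj r * w \<noteq> 0" by (rule one_plus_cnj_mult_nonzero[OF assms(2)])
  have nth: "mobius_fps r $ Suc q * w ^ Suc q = (1 - r * cnj r) * w * (- cnj r * w) ^ q" for q
    by (simp add: mobius_fps_def flip: power_mult_distrib)
  have "(\<lambda>q. (1 - r * cnj r) * w * (- cnj r * w) ^ q) sums ((1 - r * cnj r) * w * (1 / (1 - (- cnj r * w))))"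
    using assms by (intro sums_mult geometric_sums) (simp add: norm_mult)
  then have "(\<lambda>q. mobius_fps r $ Suc q * w ^ Suc q) sums ((1 - r * cnj r) * w / (1 + cnj r * w))"
    unfolding nth by simp
  from sums_Suc[OF this] show ?thesis
    using nz by (simp add: mobius_def mobius_fps_def field_simps)
qed

text \<open>
  The Cauchy product with the series of \<open>mobius r\<close> is submultiplicative for sums of absolute values, so
  the bound by powers of the majorant follows by induction on \<open>p\<close>.
\<close>

lemma scattering_poly_sums:
  assumes "norm r < 1" "norm (r * w) < 1"
  shows "summable (\<lambda>q. norm (scattering_poly p q r * w ^ q))"
    and "(\<lambda>q. scattering_poly p q r * w ^ q) sums (mobius r w ^ p)"
    and "(\<Sum>q. norm (scattering_poly p q r * w ^ q)) \<le> mobius_majorant (norm r) (norm w) ^ p"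
proof -
  let ?f = "\<lambda>p q. (mobius_fps r ^ p) $ q * w ^ q"
  let ?G = "mobius_majorant (norm r) (norm w)"
  have base: "(\<lambda>q. norm (mobius_fps r $ q * w ^ q)) sums ?G"
    using mobius_fps_abs_sums[of r "norm w"] assms by (simp add: norm_mult norm_power)
  have G0: "?G \<ge> 0"
    using sums_unique[OF base] suminf_nonneg[OF sums_summable[OF base]] by simp
  have "summable (\<lambda>q. norm (?f p q)) \<and> ?f p sums (mobius r w ^ p) \<and> (\<Sum>q. norm (?f p q)) \<le> ?G ^ p"
  proof (induction p)
    case 0
    have e: "?f 0 q = (if q = 0 then 1 else 0)" for q by simp
    show ?case unfolding e
      using sums_single[of 0 "\<lambda>_. 1::complex"] sums_single[of 0 "\<lambda>_. 1::real"]
      by (auto simp: sums_iff if_distrib[of norm] cong: if_cong)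
  next
    case (Suc p)
    let ?a = "\<lambda>q. mobius_fps r $ q * w ^ q"
    have cauchy: "?f (Suc p) q = (\<Sum>i\<le>q. ?a i * ?f p (q - i))" for q
    proof -
      have "(mobius_fps r ^ Suc p) $ q = (\<Sum>i\<le>q. mobius_fps r $ i * (mobius_fps r ^ p) $ (q - i))"
        by (simp add: fps_mult_nth atLeast0AtMost)
      then have "?f (Suc p) q = (\<Sum>i\<le>q. mobius_fps r $ i * (mobius_fps r ^ p) $ (q - i) * w ^ q)"
        by (simp only: sum_distrib_right)
      also have "\<dots> = (\<Sum>i\<le>q. ?a i * ?f p (q - i))"
      proof (intro sum.cong refl)
        fix i assume "i \<in> {..q}"
        then have "w ^ q = w ^ i * w ^ (q - i)" by (simp flip: power_add)
        then show "mobius_fps r $ i * (mobius_fps r ^ p) $ (q - i) * w ^ q = ?a i * ?f p (q - i)"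
          by (simp add: mult_ac)
      qed
      finally show ?thesis .
    qed
    have sa: "summable (\<lambda>q. norm (?a q))" using base by (simp add: sums_iff)
    have sp: "summable (\<lambda>q. norm (?f p q))" using Suc by simp
    have csum: "(\<lambda>q. \<Sum>i\<le>q. norm (?a i) * norm (?f p (q - i))) sums ((\<Sum>q. norm (?a q)) * (\<Sum>q. norm (?f p q)))"
      by (rule Cauchy_product_sums) (use sa sp in auto)
    have le: "norm (?f (Suc p) q) \<le> (\<Sum>i\<le>q. norm (?a i) * norm (?f p (q - i)))" for q
      unfolding cauchy by (rule order_trans[OF norm_sum]) (simp add: norm_mult)
    have s: "summable (\<lambda>q. norm (?f (Suc p) q))"
      by (rule summable_comparison_test'[OF sums_summable[OF csum], of 0]) (use le in simp)
    have "?f (Suc p) sums ((\<Sum>q. ?a q) * (\<Sum>q. ?f p q))"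
      unfolding cauchy by (rule Cauchy_product_sums[OF sa sp])
    moreover have "(\<Sum>q. ?a q) = mobius r w" using mobius_fps_sums[OF assms] by (simp add: sums_iff)
    moreover have "(\<Sum>q. ?f p q) = mobius r w ^ p" using Suc by (simp add: sums_iff)
    moreover have "(\<Sum>q. norm (?f (Suc p) q)) \<le> ?G ^ Suc p"
    proof -
      have "(\<Sum>q. norm (?f (Suc p) q)) \<le> (\<Sum>q. norm (?a q)) * (\<Sum>q. norm (?f p q))"
        using suminf_le[OF le s sums_summable[OF csum]] sums_unique[OF csum] by simp
      also have "\<dots> \<le> ?G * ?G ^ p"
        using Suc base G0 by (intro mult_mono) (auto simp: sums_iff suminf_nonneg)
      finally show ?thesis by simp
    qed
    ultimately show ?case using s by simp
  qed
  then show "summable (\<lambda>q. norm (scattering_poly p q r * w ^ q))"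
    and "(\<lambda>q. scattering_poly p q r * w ^ q) sums (mobius r w ^ p)"
    and "(\<Sum>q. norm (scattering_poly p q r * w ^ q)) \<le> ?G ^ p"
    by (simp_all only: scattering_poly_eq_fps_nth)
qed
lemma cball_enlarge:
  assumes "open V" "cball 0 1 \<subseteq> (V :: complex set)"
  shows "\<exists>R>1. cball 0 R \<subseteq> V"
proof -
  obtain e where e: "e > 0" "(\<Union>x\<in>cball 0 1. ball x e) \<subseteq> V"
    using compact_subset_open_imp_ball_epsilon_subset[OF compact_cball assms(1,2)] by blast
  have "cball 0 (1 + e / 2) \<subseteq> V"
  proof
    fix w :: complex assume w: "w \<in> cball 0 (1 + e / 2)"
    show "w \<in> V"
    proof (cases "norm w \<le> 1")
      case True
      then show ?thesis using assms(2) by auto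
    next
      case False
      define x where "x = w / of_real (norm w)"
      have "norm w \<noteq> 0" using False by linarith
      then have "of_real (norm w) * x = w" by (simp add: x_def)
      then have "w - x = of_real (norm w - 1) * x" by (simp add: algebra_simps)
      then have "norm (w - x) = \<bar>norm w - 1\<bar> * norm x"
        by (simp only: norm_mult norm_of_real)
      moreover have "norm x = 1" using \<open>norm w \<noteq> 0\<close> by (simp add: x_def norm_divide)
      ultimately have "norm (w - x) = norm w - 1" using False by simp
      then have "dist x w < e" using w e by (simp add: dist_norm norm_minus_commute)
      moreover have "x \<in> cball 0 1" using False by (auto simp: x_def norm_divide)
      ultimately have "w \<in> (\<Union>x\<in>cball 0 1. ball x e)" by (intro UN_I[of x]) auto
      then show ?thesis using e(2) by blast
    qed
  qed
  then show ?thesis using e(1) by (intro exI[of _ "1 + e / 2"]) auto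
qed

text \<open>
  On a circle of radius \<open>\<rho> > 1\<close> close enough to 1, \<open>mobius r\<close> is still bounded by \<open>Y\<close>.  Bounding each
  Taylor coefficient of its \<open>p\<close>-th power there loses only a geometric series when the radius is decreased to \<open>Y'\<close>.
  The essential gain over the majorant is that the base \<open>Y\<close> is as close to 1 as desired.
\<close>

lemma scattering_poly_weighted_sum_bound:
  assumes r: "norm r < 1" and Y: "Y > 1"
  shows "\<exists>Y' C. Y' > 1 \<and> C \<ge> 0 \<and> (\<forall>p Q. (\<Sum>q\<le>Q. norm (scattering_poly p q r) * Y' ^ q) \<le> C * Y ^ p)"
proof -
  define D where "D = {w. norm (r * w) < 1}"
  define V where "V = {w \<in> D. norm (mobius r w) < Y}"
  have D: "open D" unfolding D_def by (intro open_Collect_less continuous_intros)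
  have "continuous_on D (\<lambda>w. norm (mobius r w))"
    unfolding mobius_def by (intro continuous_intros) (auto simp: D_def one_plus_cnj_mult_nonzero)
  then have "open (D \<inter> (\<lambda>w. norm (mobius r w)) -` {..<Y})"
    by (intro continuous_open_preimage D) auto
  then have V: "open V" by (auto simp: V_def vimage_def Int_def)
  have "cball 0 1 \<subseteq> V"
    using Y norm_mult_lt_one[OF r] norm_mobius_le[OF r] by (force simp: V_def D_def)
  then obtain \<rho> where \<rho>: "\<rho> > 1" "cball 0 \<rho> \<subseteq> V" using cball_enlarge[OF V] by blast
  have bound: "norm (scattering_poly p q r) * \<rho> ^ q \<le> Y ^ p" for p q
  proof -
    define a where "a k = scattering_poly p k r * of_real \<rho> ^ k" for k
    define b :: "nat \<Rightarrow> complex" where "b k = (if k = 0 then 1 else 0)" for k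
    have in_D: "norm (r * (of_real \<rho> * w)) < 1" and le_Y: "norm (mobius r (of_real \<rho> * w)) < Y"
      if "norm w = 1" for w
    proof -
      have "of_real \<rho> * w \<in> cball 0 \<rho>" using that \<rho> by (simp add: norm_mult)
      then have "of_real \<rho> * w \<in> V" using \<rho>(2) by blast
      then show "norm (r * (of_real \<rho> * w)) < 1" and "norm (mobius r (of_real \<rho> * w)) < Y"
        by (auto simp: V_def D_def)
    qed
    have eq: "a k * w ^ k = scattering_poly p k r * (of_real \<rho> * w) ^ k" for k w
      by (simp add: a_def power_mult_distrib)
    have "summable (\<lambda>k. norm (a k))"
      using scattering_poly_sums(1)[OF r in_D[of 1], of p] by (simp add: a_def)
    moreover have "norm (\<Sum>k. a k * w ^ k) \<le> Y ^ p" if "norm w = 1" for w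
    proof -
      have "(\<Sum>k. a k * w ^ k) = mobius r (of_real \<rho> * w) ^ p"
        unfolding eq using scattering_poly_sums(2)[OF r in_D[OF that], of p] by (simp add: sums_iff)
      then show ?thesis using le_Y[OF that] by (simp add: norm_power power_mono)
    qed
    ultimately have "(\<Sum>k\<le>q. (norm (\<Sum>i\<le>k. a (k - i) * b i))\<^sup>2) \<le> (Y ^ p)\<^sup>2 * (\<Sum>k\<le>q. (norm (b k))\<^sup>2)"
      by (rule analytic_toeplitz_contraction)
    moreover have "(\<Sum>i\<le>k. a (k - i) * b i) = a k" for k
    proof -
      have "(\<Sum>i\<le>k. a (k - i) * b i) = (\<Sum>i\<in>{0}. a (k - i) * b i)"
        by (rule sum.mono_neutral_right) (auto simp: b_def)
      then show ?thesis by (simp add: b_def)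
    qed
    moreover have "(\<Sum>k\<le>q. (norm (b k))\<^sup>2) = 1"
    proof -
      have "(\<Sum>k\<le>q. (norm (b k))\<^sup>2) = (\<Sum>k\<in>{0}. (norm (b k))\<^sup>2)"
        by (rule sum.mono_neutral_right) (auto simp: b_def)
      then show ?thesis by (simp add: b_def)
    qed
    ultimately have "(\<Sum>k\<le>q. (norm (a k))\<^sup>2) \<le> (Y ^ p)\<^sup>2" by simp
    moreover have "(norm (a q))\<^sup>2 \<le> (\<Sum>k\<le>q. (norm (a k))\<^sup>2)"
      by (rule member_le_sum) auto
    ultimately have "(norm (a q))\<^sup>2 \<le> (Y ^ p)\<^sup>2" by linarith
    then have "norm (a q) \<le> Y ^ p" using Y by (simp add: power2_le_iff_abs_le)
    then show ?thesis using \<rho>(1) by (simp add: a_def norm_mult norm_power)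
  qed
  define Y' where "Y' = (1 + \<rho>) / 2"
  define t where "t = Y' / \<rho>"
  have Y': "Y' > 1" "0 < t" "t < 1" using \<rho>(1) by (auto simp: Y'_def t_def field_simps)
  have "(\<Sum>q\<le>Q. norm (scattering_poly p q r) * Y' ^ q) \<le> (1 / (1 - t)) * Y ^ p" for p Q
  proof -
    have "(\<Sum>q\<le>Q. norm (scattering_poly p q r) * Y' ^ q) \<le> (\<Sum>q\<le>Q. t ^ q * Y ^ p)"
    proof (intro sum_mono)
      fix q
      have "norm (scattering_poly p q r) * Y' ^ q = t ^ q * (norm (scattering_poly p q r) * \<rho> ^ q)"
        using \<rho>(1) by (simp add: t_def power_divide)
      also have "\<dots> \<le> t ^ q * Y ^ p" using bound Y' by (intro mult_left_mono) auto
      finally show "norm (scattering_poly p q r) * Y' ^ q \<le> t ^ q * Y ^ p" .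
    qed
    also have "\<dots> = (\<Sum>q\<le>Q. t ^ q) * Y ^ p" by (simp add: sum_distrib_right)
    also have "\<dots> \<le> (1 / (1 - t)) * Y ^ p"
    proof -
      have "(\<Sum>q\<in>{..Q}. t ^ q) \<le> (\<Sum>q. t ^ q)" using Y' by (intro sum_le_suminf) auto
      then show ?thesis using Y' Y by (intro mult_right_mono) (auto simp: suminf_geometric)
    qed
    finally show ?thesis .
  qed
  then show ?thesis using Y' by (intro exI[of _ Y'] exI[of _ "1 / (1 - t)"]) auto
qed

text \<open>
  For small parameters the crude majorant is good enough: it pushes \<open>y\<close> up by an amount that is summable
  over the steps of the Schur algorithm.
\<close>

lemma mobius_majorant_le:
  assumes "0 \<le> s" "s \<le> 1/2" "0 \<le> y" "y \<le> 1"
  shows "mobius_majorant s y \<le> y + 3 * s"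
proof -
  have sy: "s * y \<le> 1/2" using assms mult_mono[of s "1/2" y 1] by auto
  have "mobius_majorant s y \<le> s + y / (1 - s * y)"
  proof -
    have "s\<^sup>2 \<le> 1" using assms by (simp add: power_le_one)
    then have "(1 - s\<^sup>2) * y \<le> y" using assms by (intro mult_left_le_one_le) auto
    then show ?thesis
      unfolding mobius_majorant_def using sy by (intro add_left_mono divide_right_mono) auto
  qed
  also have "y / (1 - s * y) = y + s * y\<^sup>2 / (1 - s * y)"
    using sy by (simp add: field_simps power2_eq_square)
  also have "s * y\<^sup>2 / (1 - s * y) \<le> s / (1/2)"
    using assms sy by (intro frac_le) (auto simp: mult_left_le power_le_one)
  finally show ?thesis by simp
qed

lemma scattering_poly_sum_bound_near_one:
  assumes "norm r \<le> 1/2" "0 \<le> y" "y \<le> 1" "y + 3 * norm r \<le> Y"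
  shows "(\<Sum>q\<le>Q. norm (scattering_poly p q r) * y ^ q) \<le> Y ^ p"
proof -
  have r: "norm r < 1" using assms by linarith
  have "norm (r * of_real y) < 1" using norm_mult_lt_one[OF r, of "of_real y"] assms by simp
  note S = scattering_poly_sums[OF r this, of p]
  have "(\<Sum>q\<le>Q. norm (scattering_poly p q r) * y ^ q)
      = (\<Sum>q\<in>{..Q}. norm (scattering_poly p q r * of_real y ^ q))"
    using assms by (simp add: norm_mult norm_power)
  also have "\<dots> \<le> (\<Sum>q. norm (scattering_poly p q r * of_real y ^ q))"
    by (intro sum_le_suminf S) auto
  also have "\<dots> \<le> mobius_majorant (norm r) y ^ p" using S(3) assms by simp
  also have "\<dots> \<le> Y ^ p"
  proof (rule power_mono)
    show "mobius_majorant (norm r) y \<le> Y" using mobius_majorant_le[of "norm r" y] assms by auto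
    have "(\<lambda>q. norm (mobius_fps r $ q) * y ^ q) sums mobius_majorant (norm r) y"
      using mobius_fps_abs_sums[OF r, of y] mult_left_le[of y "norm r"] assms r by auto
    then show "mobius_majorant (norm r) y \<ge> 0"
      by (rule sums_le[OF _ sums_zero, rotated]) (use assms in auto)
  qed
  finally show ?thesis .
qed

section \<open>Absolute summability of the scattering weights\<close>

definition indices_upto :: "nat \<Rightarrow> (nat \<Rightarrow> nat) set"
  where "indices_upto N = {\<alpha>. \<alpha> 0 = 0 \<and> (\<forall>j>N. \<alpha> j = 0)}"

text \<open>
  Weights are products over consecutive pairs of exponents starting with the pair \<open>(1, \<alpha>\<^sub>1)\<close>.  Reading
  the exponent at position 0 as 1 makes the first factor look like all others.
\<close>

definition link :: "(nat \<Rightarrow> nat) \<Rightarrow> nat \<Rightarrow> nat"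
  where "link \<alpha> j = (if j = 0 then 1 else \<alpha> j)"

text \<open>
  The part of the scattering weight that involves only the first \<open>N\<close> parameters; the exponent at position
  \<open>N\<close> is left open, to be coupled to whatever follows.
\<close>

definition chain_weight :: "(nat \<Rightarrow> complex) \<Rightarrow> nat \<Rightarrow> (nat \<Rightarrow> nat) \<Rightarrow> complex"
  where "chain_weight r N \<alpha> = (\<Prod>j<N. scattering_poly (link \<alpha> j) (\<alpha> (Suc j)) (r j))"

lemma indices_upto_Suc_bij:
  "bij_betw (\<lambda>(\<alpha>, q). \<alpha>(Suc N := q)) (indices_upto N \<times> UNIV) (indices_upto (Suc N))"
proof (rule bij_betwI[where g = "\<lambda>\<alpha>. (\<alpha>(Suc N := 0), \<alpha> (Suc N))"])
  show "(\<lambda>\<alpha>. (\<alpha>(Suc N := 0), \<alpha> (Suc N))) \<in> indices_upto (Suc N) \<rightarrow> indices_upto N \<times> UNIV"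
    by (auto simp: indices_upto_def not_less_eq less_Suc_eq)
qed (auto simp: indices_upto_def fun_eq_iff)

lemma chain_weight_Suc:
  "chain_weight r (Suc N) (\<alpha>(Suc N := q)) = chain_weight r N \<alpha> * scattering_poly (link \<alpha> N) q (r N)"
  by (auto simp: chain_weight_def link_def intro!: prod.cong)

text \<open>
  The number \<open>Y\<close> bounds what may be substituted for the remainder after \<open>N\<close> steps.  Finite partial sums keep
  the recursion in \<open>N\<close> free of summability conditions.
\<close>

definition chain_bound :: "(nat \<Rightarrow> complex) \<Rightarrow> nat \<Rightarrow> real \<Rightarrow> real \<Rightarrow> bool"
  where "chain_bound r N Y K \<longleftrightarrow> (\<forall>F. finite F \<and> F \<subseteq> indices_upto N \<longrightarrow>
    (\<Sum>\<alpha>\<in>F. norm (chain_weight r N \<alpha>) * Y ^ link \<alpha> N) \<le> K)"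

lemma chain_bound_0:
  assumes "Y \<ge> 0"
  shows "chain_bound r 0 Y Y"
  unfolding chain_bound_def
proof (intro allI impI)
  fix F assume "finite F \<and> F \<subseteq> indices_upto 0"
  moreover have "indices_upto 0 = {\<lambda>_. 0}"
    by (auto simp: indices_upto_def fun_eq_iff) (metis gr0I)
  ultimately have "F = {} \<or> F = {\<lambda>_. 0}" by auto
  then show "(\<Sum>\<alpha>\<in>F. norm (chain_weight r 0 \<alpha>) * Y ^ link \<alpha> 0) \<le> Y"
    using assms by (auto simp: chain_weight_def link_def)
qed

lemma chain_bound_mono:
  assumes "chain_bound r N Y K" "0 \<le> y" "y \<le> Y"
  shows "chain_bound r N y K"
  unfolding chain_bound_def
proof (intro allI impI)
  fix F assume F: "finite F \<and> F \<subseteq> indices_upto N"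
  have "(\<Sum>\<alpha>\<in>F. norm (chain_weight r N \<alpha>) * y ^ link \<alpha> N)
      \<le> (\<Sum>\<alpha>\<in>F. norm (chain_weight r N \<alpha>) * Y ^ link \<alpha> N)"
    using assms by (intro sum_mono mult_left_mono power_mono) auto
  also have "\<dots> \<le> K" using assms(1) F by (simp add: chain_bound_def)
  finally show "(\<Sum>\<alpha>\<in>F. norm (chain_weight r N \<alpha>) * y ^ link \<alpha> N) \<le> K" .
qed

lemma chain_bound_Suc:
  assumes N: "chain_bound r N Y K" and "C \<ge> 0" "Y' \<ge> 0"
    and step: "\<And>p Q. (\<Sum>q\<le>Q. norm (scattering_poly p q (r N)) * Y' ^ q) \<le> C * Y ^ p"
  shows "chain_bound r (Suc N) Y' (C * K)"
  unfolding chain_bound_def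
proof (intro allI impI)
  fix F assume F: "finite F \<and> F \<subseteq> indices_upto (Suc N)"
  define F1 where "F1 = (\<lambda>\<alpha>. \<alpha>(Suc N := 0)) ` F"
  let ?ext = "\<lambda>(\<alpha>, q). \<alpha>(Suc N := q)"
  have F1: "finite F1" "F1 \<subseteq> indices_upto N"
    using F by (auto simp: F1_def indices_upto_def not_less_eq less_Suc_eq subset_iff)
  have "finite ((\<lambda>\<alpha>. \<alpha> (Suc N)) ` F)" using F by simp
  then obtain Q where Q: "\<And>\<alpha>. \<alpha> \<in> F \<Longrightarrow> \<alpha> (Suc N) \<le> Q"
    unfolding finite_nat_set_iff_bounded_le by blast
  have sub: "F \<subseteq> ?ext ` (F1 \<times> {..Q})"
  proof
    fix \<alpha> assume "\<alpha> \<in> F"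
    then show "\<alpha> \<in> ?ext ` (F1 \<times> {..Q})"
      using Q by (intro image_eqI[of _ _ "(\<alpha>(Suc N := 0), \<alpha> (Suc N))"]) (auto simp: F1_def)
  qed
  have inj: "inj_on ?ext (F1 \<times> {..Q})"
    by (rule inj_on_subset[OF bij_betw_imp_inj_on[OF indices_upto_Suc_bij[of N]]]) (use F1 in auto)
  have "(\<Sum>\<alpha>\<in>F. norm (chain_weight r (Suc N) \<alpha>) * Y' ^ link \<alpha> (Suc N))
      \<le> (\<Sum>\<alpha>\<in>?ext ` (F1 \<times> {..Q}). norm (chain_weight r (Suc N) \<alpha>) * Y' ^ link \<alpha> (Suc N))"
    using F1 sub assms(3) by (intro sum_mono2) auto
  also have "\<dots> = (\<Sum>(\<alpha>, q)\<in>F1 \<times> {..Q}. norm (chain_weight r N \<alpha>) * (norm (scattering_poly (link \<alpha> N) q (r N)) * Y' ^ q))"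
    by (subst sum.reindex[OF inj])
      (auto intro!: sum.cong simp: chain_weight_Suc norm_mult link_def[of _ "Suc N"] mult_ac)
  also have "\<dots> = (\<Sum>\<alpha>\<in>F1. norm (chain_weight r N \<alpha>) * (\<Sum>q\<le>Q. norm (scattering_poly (link \<alpha> N) q (r N)) * Y' ^ q))"
    by (simp add: sum.cartesian_product[symmetric] sum_distrib_left)
  also have "\<dots> \<le> (\<Sum>\<alpha>\<in>F1. norm (chain_weight r N \<alpha>) * (C * Y ^ link \<alpha> N))"
    by (intro sum_mono mult_left_mono step) auto
  also have "\<dots> = C * (\<Sum>\<alpha>\<in>F1. norm (chain_weight r N \<alpha>) * Y ^ link \<alpha> N)"
    by (simp add: sum_distrib_left mult_ac)
  also have "\<dots> \<le> C * K"
    using N F1 \<open>C \<ge> 0\<close> by (intro mult_left_mono) (auto simp: chain_bound_def)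
  finally show "(\<Sum>\<alpha>\<in>F. norm (chain_weight r (Suc N) \<alpha>) * Y' ^ link \<alpha> (Suc N)) \<le> C * K" .
qed

lemma chain_bound_exists:
  assumes r: "\<And>n. norm (r n) < 1"
  shows "\<exists>Y K. Y > 1 \<and> chain_bound r N Y K"
proof (induction N)
  case 0
  show ?case using chain_bound_0[of 2] by (intro exI[of _ "2::real"]) auto
next
  case (Suc N)
  then obtain Y K where "Y > 1" and YK: "chain_bound r N Y K" by blast
  then obtain Y' C where Y': "Y' > 1" "C \<ge> 0"
    "\<And>p Q. (\<Sum>q\<le>Q. norm (scattering_poly p q (r N)) * Y' ^ q) \<le> C * Y ^ p"
    using scattering_poly_weighted_sum_bound[OF r] by blast
  then show ?case using chain_bound_Suc[OF YK, of C Y'] by (intro exI[of _ Y'] exI[of _ "C * K"]) auto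
qed

text \<open>
  Up to some \<open>n0\<close> the bound comes from the Cauchy estimates and holds even for remainders of size
  greater than 1.  From \<open>n0\<close> on, the admissible size is reduced at each step by three times the modulus of the parameter.
  If \<open>n0\<close> is so large that the moduli of the remaining parameters sum to at most \<open>1/6\<close>, it never drops below \<open>1/2\<close>, and
  the constant \<open>K\<close> does not change any more.
\<close>

lemma chain_bound_uniform:
  assumes r: "\<And>n. norm (r n) < 1" and summ: "summable (\<lambda>n. norm (r n))"
  shows "\<exists>n0 K. \<forall>N\<ge>n0. chain_bound r N (norm (r N)) K"
proof -
  define T where "T n = (\<Sum>j. norm (r (j + n)))" for n
  have "T \<longlonglongrightarrow> 0" unfolding T_def by (rule suminf_exist_split2) (use summ in simp)
  then have "\<forall>\<^sub>F n in sequentially. T n < 1/6" by (rule order_tendstoD) simp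
  then obtain n0 where T: "T n0 < 1/6" by (auto simp: eventually_sequentially)
  have part: "(\<Sum>j<m. norm (r (j + n0))) \<le> 1/6" for m
  proof -
    have "(\<Sum>j<m. norm (r (j + n0))) \<le> T n0"
      unfolding T_def using summable_ignore_initial_segment[OF summ, of n0] by (intro sum_le_suminf) auto
    then show ?thesis using T by linarith
  qed
  have small: "norm (r N) \<le> 1/6" if "N \<ge> n0" for N
  proof -
    have "norm (r N) = norm (r ((N - n0) + n0))" using that by simp
    also have "\<dots> \<le> (\<Sum>j<Suc (N - n0). norm (r (j + n0)))"
      by (rule member_le_sum) auto
    finally show ?thesis using part[of "Suc (N - n0)"] by linarith
  qed
  obtain Y K where "Y > 1" "chain_bound r n0 Y K" using chain_bound_exists[of r, OF r] by blast
  then have base: "chain_bound r n0 1 K" by (intro chain_bound_mono[of r n0 Y K 1]) auto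
  \<comment> \<open>the admissible size of the remainder after \<open>m + n0\<close> steps\<close>
  define y where "y m = 1 - 3 * (\<Sum>j<m. norm (r (j + n0)))" for m
  have y: "1/2 \<le> y m" "y m \<le> 1" for m
    using part[of m] by (auto simp: y_def intro!: sum_nonneg)
  have bnd: "chain_bound r (m + n0) (y m) K" for m
  proof (induction m)
    case 0
    then show ?case using base by (simp add: y_def)
  next
    case (Suc m)
    have "chain_bound r (Suc (m + n0)) (y (Suc m)) (1 * K)"
    proof (rule chain_bound_Suc[OF Suc])
      fix p Q
      have "y (Suc m) + 3 * norm (r (m + n0)) = y m" by (simp add: y_def)
      then show "(\<Sum>q\<le>Q. norm (scattering_poly p q (r (m + n0))) * y (Suc m) ^ q) \<le> 1 * y m ^ p"
        using scattering_poly_sum_bound_near_one[of "r (m + n0)" "y (Suc m)" "y m"]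
          small[of "m + n0"] y[of "Suc m"] by simp
    qed (use y[of "Suc m"] in auto)
    then show ?case by simp
  qed
  have "chain_bound r N (norm (r N)) K" if "N \<ge> n0" for N
    using chain_bound_mono[OF bnd[of "N - n0"], of "norm (r N)"] small[OF that] y(1)[of "N - n0"] that
    by simp
  then show ?thesis by blast
qed

lemma scattering_weight_eq_chain_weight:
  assumes \<alpha>: "\<alpha> \<in> indices_upto N"
  shows "scattering_weight r \<alpha> = chain_weight r N \<alpha> * r N ^ link \<alpha> N"
proof -
  define n where "n = (if \<forall>j. \<alpha> j = 0 then 0 else Max {j. \<alpha> j \<noteq> 0})"
  have fin: "finite {j. \<alpha> j \<noteq> 0}"
    by (rule finite_subset[of _ "{..N}"]) (use \<alpha> in \<open>auto simp: indices_upto_def not_less[symmetric]\<close>)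
  have nN: "n \<le> N"
  proof (cases "\<forall>j. \<alpha> j = 0")
    case False
    then have "n \<in> {j. \<alpha> j \<noteq> 0}" using Max_in[OF fin] by (auto simp: n_def)
    then show ?thesis using \<alpha> by (auto simp: indices_upto_def not_less[symmetric])
  qed (simp add: n_def)
  have beyond: "\<alpha> j = 0" if "j > n" for j
    using Max_ge[OF fin, of j] that by (auto simp: n_def split: if_splits)
  have "scattering_weight r \<alpha> = scattering_poly 1 (\<alpha> 1) (r 0) * (\<Prod>j=1..n. scattering_poly (\<alpha> j) (\<alpha> (Suc j)) (r j))"
    by (simp add: scattering_weight_def n_def Let_def)
  also have "(\<Prod>j=1..n. scattering_poly (\<alpha> j) (\<alpha> (Suc j)) (r j)) = (\<Prod>j=1..N. scattering_poly (\<alpha> j) (\<alpha> (Suc j)) (r j))"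
    using nN beyond by (intro prod.mono_neutral_left) (auto simp: scattering_poly_def)
  also have "\<dots> = (\<Prod>j=1..N. scattering_poly (link \<alpha> j) (\<alpha> (Suc j)) (r j))"
    by (intro prod.cong) (auto simp: link_def)
  also have "scattering_poly 1 (\<alpha> 1) (r 0) * \<dots> = (\<Prod>j\<in>insert 0 {1..N}. scattering_poly (link \<alpha> j) (\<alpha> (Suc j)) (r j))"
    by (simp add: link_def)
  also have "insert 0 {1..N} = {..<Suc N}" by auto
  also have "(\<Prod>j<Suc N. scattering_poly (link \<alpha> j) (\<alpha> (Suc j)) (r j)) = chain_weight r N \<alpha> * scattering_poly (link \<alpha> N) (\<alpha> (Suc N)) (r N)"
    by (simp add: chain_weight_def)
  also have "\<alpha> (Suc N) = 0" using \<alpha> by (simp add: indices_upto_def)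
  finally show ?thesis by (simp add: scattering_poly_def)
qed

lemma indices_upto_subset: "indices_upto N \<subseteq> scattering_index"
proof
  fix \<alpha> assume \<alpha>: "\<alpha> \<in> indices_upto N"
  have "finite {j. \<alpha> j \<noteq> 0}"
    by (rule finite_subset[of _ "{..N}"]) (use \<alpha> in \<open>auto simp: indices_upto_def not_less[symmetric]\<close>)
  then show "\<alpha> \<in> scattering_index" using \<alpha> by (simp add: scattering_index_def indices_upto_def)
qed

lemma finite_indices_exhausted:
  assumes "finite F" "F \<subseteq> scattering_index"
  shows "\<exists>N\<ge>n0. F \<subseteq> indices_upto N"
proof -
  have "finite (\<Union>\<alpha>\<in>F. {j. \<alpha> j \<noteq> 0})" using assms by (auto simp: scattering_index_def)
  then obtain m where m: "\<And>\<alpha> j. \<alpha> \<in> F \<Longrightarrow> \<alpha> j \<noteq> 0 \<Longrightarrow> j \<le> m"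
    unfolding finite_nat_set_iff_bounded_le by blast
  have "F \<subseteq> indices_upto (max m n0)"
  proof
    fix \<alpha> assume "\<alpha> \<in> F"
    then show "\<alpha> \<in> indices_upto (max m n0)"
      using m[of \<alpha>] assms(2) by (force simp: indices_upto_def scattering_index_def)
  qed
  then show ?thesis by (intro exI[of _ "max m n0"]) auto
qed

lemma scattering_weight_abs_summable:
  assumes r: "\<And>n. norm (r n) < 1" and summ: "summable (\<lambda>n. norm (r n))"
  shows "(\<lambda>\<alpha>. norm (scattering_weight r \<alpha>)) summable_on scattering_index"
proof -
  obtain n0 K where K: "\<And>N. N \<ge> n0 \<Longrightarrow> chain_bound r N (norm (r N)) K"
    using chain_bound_uniform[OF assms] by blast
  have "(\<Sum>\<alpha>\<in>F. norm (scattering_weight r \<alpha>)) \<le> K" if F: "finite F" "F \<subseteq> scattering_index" for F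
  proof -
    obtain N where N: "N \<ge> n0" "F \<subseteq> indices_upto N" using finite_indices_exhausted[OF F] by blast
    have "(\<Sum>\<alpha>\<in>F. norm (scattering_weight r \<alpha>)) = (\<Sum>\<alpha>\<in>F. norm (chain_weight r N \<alpha>) * norm (r N) ^ link \<alpha> N)"
      using N by (intro sum.cong) (auto simp: scattering_weight_eq_chain_weight subset_iff norm_mult norm_power)
    also have "\<dots> \<le> K" using K[OF N(1)] F N by (simp add: chain_bound_def)
    finally show ?thesis .
  qed
  then show ?thesis by (intro nonneg_bdd_above_summable_on) (auto intro!: bdd_aboveI[of _ K])
qed

section \<open>The scattering series\<close>

primrec nested_mobius :: "(nat \<Rightarrow> complex) \<Rightarrow> (nat \<Rightarrow> complex) \<Rightarrow> nat \<Rightarrow> complex \<Rightarrow> complex" where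
  "nested_mobius r x 0 y = y"
| "nested_mobius r x (Suc N) y = nested_mobius r x N (mobius (r N) (x (Suc N) * y))"

text \<open>
  Summing over the last exponent replaces \<open>y\<close> by \<open>mobius (r N) (x (Suc N) * y)\<close>, which is one more layer of
  the nested expression.
\<close>

lemma chain_weight_has_sum:
  assumes r: "\<And>n. norm (r n) < 1" and x: "\<And>n. norm (x n) \<le> 1"
  shows "norm y \<le> 1 \<Longrightarrow>
    ((\<lambda>\<alpha>. chain_weight r N \<alpha> * (\<Prod>j<N. x (Suc j) ^ \<alpha> (Suc j)) * y ^ link \<alpha> N)
      has_sum nested_mobius r x N y) (indices_upto N)"
proof (induction N arbitrary: y)
  case 0
  have "indices_upto 0 = {\<lambda>_. 0}"
    by (auto simp: indices_upto_def fun_eq_iff) (metis gr0I)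
  then show ?case using has_sum_finite[of "{\<lambda>_. 0 :: nat}" "\<lambda>\<alpha>. chain_weight r 0 \<alpha> * (\<Prod>j<0. x (Suc j) ^ \<alpha> (Suc j)) * y ^ link \<alpha> 0"]
    by (simp add: chain_weight_def link_def)
next
  case (Suc N)
  let ?t = "\<lambda>N y \<alpha>. chain_weight r N \<alpha> * (\<Prod>j<N. x (Suc j) ^ \<alpha> (Suc j)) * y ^ link \<alpha> N"
  let ?ext = "\<lambda>(\<alpha>, q). \<alpha>(Suc N := q)"
  define y' where "y' = x (Suc N) * y"
  have y': "norm y' \<le> 1"
    using x[of "Suc N"] Suc.prems by (simp add: y'_def norm_mult mult_le_one)
  have ry': "norm (r N * y') < 1" by (rule norm_mult_lt_one[OF r y'])
  obtain Y K where Y: "Y > 1" "chain_bound r (Suc N) Y K" using chain_bound_exists[of r, OF r] by blast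
  have "(\<lambda>\<alpha>. norm (?t (Suc N) y \<alpha>)) summable_on indices_upto (Suc N)"
  proof (rule nonneg_bdd_above_summable_on)
    have "(\<Sum>\<alpha>\<in>F. norm (?t (Suc N) y \<alpha>)) \<le> K" if F: "finite F" "F \<subseteq> indices_upto (Suc N)" for F
    proof -
      have "(\<Sum>\<alpha>\<in>F. norm (?t (Suc N) y \<alpha>)) \<le> (\<Sum>\<alpha>\<in>F. norm (chain_weight r (Suc N) \<alpha>) * 1 ^ link \<alpha> (Suc N))"
        using x Suc.prems
        by (intro sum_mono) (auto simp: norm_mult norm_power prod_norm[symmetric] mult.assoc
            intro!: mult_left_le mult_le_one prod_le_1 power_le_one)
      also have "\<dots> \<le> K"
        using chain_bound_mono[OF Y(2), of 1] Y(1) F by (simp add: chain_bound_def)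
      finally show ?thesis .
    qed
    then show "bdd_above (sum (\<lambda>\<alpha>. norm (?t (Suc N) y \<alpha>)) ` {F. F \<subseteq> indices_upto (Suc N) \<and> finite F})"
      by (auto intro!: bdd_aboveI[of _ K])
  qed auto
  then have "?t (Suc N) y summable_on indices_upto (Suc N)" by (rule abs_summable_summable)
  then obtain S where S: "(?t (Suc N) y has_sum S) (indices_upto (Suc N))"
    by (auto simp: summable_on_def)
  then have reindexed: "((\<lambda>p. ?t (Suc N) y (?ext p)) has_sum S) (indices_upto N \<times> UNIV)"
    using has_sum_reindex_bij_betw[OF indices_upto_Suc_bij[of N], of "?t (Suc N) y" S] by simp
  have split: "?t (Suc N) y (\<alpha>(Suc N := q)) = chain_weight r N \<alpha> * (\<Prod>j<N. x (Suc j) ^ \<alpha> (Suc j))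
      * (scattering_poly (link \<alpha> N) q (r N) * y' ^ q)" for \<alpha> q
  proof -
    have "(\<Prod>j<N. x (Suc j) ^ (\<alpha>(Suc N := q)) (Suc j)) = (\<Prod>j<N. x (Suc j) ^ \<alpha> (Suc j))"
      by (intro prod.cong) auto
    then show ?thesis
      by (simp add: chain_weight_Suc link_def[of _ "Suc N"] y'_def power_mult_distrib mult_ac)
  qed
  have "((\<lambda>(\<alpha>, q). chain_weight r N \<alpha> * (\<Prod>j<N. x (Suc j) ^ \<alpha> (Suc j))
      * (scattering_poly (link \<alpha> N) q (r N) * y' ^ q)) has_sum S) (Sigma (indices_upto N) (\<lambda>_. UNIV))"
    using reindexed unfolding case_prod_unfold split .
  moreover have "((\<lambda>q. chain_weight r N \<alpha> * (\<Prod>j<N. x (Suc j) ^ \<alpha> (Suc j))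
      * (scattering_poly (link \<alpha> N) q (r N) * y' ^ q)) has_sum ?t N (mobius (r N) y') \<alpha>) UNIV" for \<alpha>
  proof (rule has_sum_cmult_right)
    show "((\<lambda>q. scattering_poly (link \<alpha> N) q (r N) * y' ^ q) has_sum mobius (r N) y' ^ link \<alpha> N) UNIV"
      using scattering_poly_sums(1,2)[OF r ry'] by (rule norm_summable_imp_has_sum)
  qed
  ultimately have "(?t N (mobius (r N) y') has_sum S) (indices_upto N)"
    using has_sum_SigmaD[where f = "\<lambda>(\<alpha>, q). chain_weight r N \<alpha> * (\<Prod>j<N. x (Suc j) ^ \<alpha> (Suc j))
      * (scattering_poly (link \<alpha> N) q (r N) * y' ^ q)"] by simp
  moreover have "(?t N (mobius (r N) y') has_sum nested_mobius r x N (mobius (r N) y')) (indices_upto N)"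
    by (rule Suc.IH) (rule norm_mobius_le[OF r y'])
  ultimately have "S = nested_mobius r x (Suc N) y"
    using has_sum_unique by (auto simp: y'_def)
  then show ?case using S by simp
qed
lemma nested_mobius_lipschitz:
  assumes r: "\<And>n. norm (r n) < 1" and x: "\<And>n. norm (x n) \<le> 1"
  shows "norm u \<le> 1 \<Longrightarrow> norm v \<le> 1 \<Longrightarrow>
    norm (nested_mobius r x N u - nested_mobius r x N v)
      \<le> (\<Prod>j<N. 1 + mobius_distortion (r j)) * norm (u - v)"
proof (induction N arbitrary: u v)
  case (Suc N)
  let ?u = "x (Suc N) * u" and ?v = "x (Suc N) * v"
  have b: "norm ?u \<le> 1" "norm ?v \<le> 1" using x Suc.prems by (simp_all add: norm_mult mult_le_one)
  have d0: "mobius_distortion (r n) \<ge> 0" for n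
    unfolding mobius_distortion_def using r[of n] by auto
  have "norm (nested_mobius r x (Suc N) u - nested_mobius r x (Suc N) v)
      \<le> (\<Prod>j<N. 1 + mobius_distortion (r j)) * norm (mobius (r N) ?u - mobius (r N) ?v)"
    using Suc.IH[OF norm_mobius_le[OF r b(1)] norm_mobius_le[OF r b(2)]] by simp
  also have "\<dots> \<le> (\<Prod>j<N. 1 + mobius_distortion (r j)) * ((1 + mobius_distortion (r N)) * norm (u - v))"
  proof (rule mult_left_mono)
    have "norm (?u - ?v) \<le> norm (u - v)"
      using x[of "Suc N"] by (simp add: norm_mult flip: right_diff_distrib) (simp add: mult_left_le_one_le)
    then have "(1 + mobius_distortion (r N)) * norm (?u - ?v) \<le> (1 + mobius_distortion (r N)) * norm (u - v)"
      using d0 by (intro mult_left_mono) (auto simp: add_nonneg_nonneg)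
    then show "norm (mobius (r N) ?u - mobius (r N) ?v) \<le> (1 + mobius_distortion (r N)) * norm (u - v)"
      using mobius_lipschitz[OF r b] by (rule order_trans[rotated])
    show "0 \<le> (\<Prod>j<N. 1 + mobius_distortion (r j))" using d0 by (intro prod_nonneg) (auto simp: add_nonneg_nonneg)
  qed
  finally show ?case by (simp add: mult.assoc)
qed simp

lemma nested_mobius_eq:
  assumes "\<And>n. y n = mobius (r n) (x (Suc n) * y (Suc n))"
  shows "nested_mobius r x N (y N) = y 0"
  by (induction N) (simp_all flip: assms)

lemma abs_summable_exhaustion:
  fixes f :: "'a \<Rightarrow> complex"
  assumes summ: "(\<lambda>a. norm (f a)) summable_on A"
    and sub: "\<And>N. E N \<subseteq> A"
    and exhaust: "\<And>F. finite F \<Longrightarrow> F \<subseteq> A \<Longrightarrow> \<exists>n. \<forall>N\<ge>n. F \<subseteq> E N"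
  shows "(\<lambda>N. infsum f (E N)) \<longlonglongrightarrow> infsum f A"
proof (rule LIMSEQ_I)
  fix \<epsilon> :: real assume "\<epsilon> > 0"
  let ?g = "\<lambda>a. norm (f a)"
  obtain F where F: "finite F" "F \<subseteq> A" "dist (sum ?g F) (infsum ?g A) \<le> \<epsilon> / 2"
    using infsum_finite_approximation[OF summ, of "\<epsilon> / 2"] \<open>\<epsilon> > 0\<close> by auto
  obtain n where n: "\<And>N. N \<ge> n \<Longrightarrow> F \<subseteq> E N" using exhaust[OF F(1,2)] by blast
  have "norm (infsum f (E N) - infsum f A) < \<epsilon>" if N: "N \<ge> n" for N
  proof -
    have sf: "f summable_on A" using summ by (rule abs_summable_summable)
    have sg: "?g summable_on B" if "B \<subseteq> A" for B using summable_on_subset_banach[OF summ that] .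
    have "infsum f (E N) + infsum f (A - E N) = infsum f (E N \<union> (A - E N))"
      using sub[of N] by (intro infsum_Un_disjoint[symmetric] summable_on_subset_banach[OF sf]) auto
    also have "E N \<union> (A - E N) = A" using sub[of N] by auto
    finally have "norm (infsum f (E N) - infsum f A) = norm (infsum f (A - E N))"
      by (metis add_diff_cancel_left' norm_minus_commute)
    also have "\<dots> \<le> infsum ?g (A - E N)" by (intro norm_infsum_bound sg) auto
    also have "\<dots> \<le> infsum ?g (A - F)"
      using n[OF N] by (intro infsum_mono2 sg) auto
    also have "\<dots> = infsum ?g A - sum ?g F"
    proof -
      have "infsum ?g A = infsum ?g (F \<union> (A - F))" using F(2) by (simp add: Un_absorb1)
      also have "\<dots> = infsum ?g F + infsum ?g (A - F)"
        using F(2) by (intro infsum_Un_disjoint sg) auto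
      finally show ?thesis using F(1) by simp
    qed
    also have "\<dots> < \<epsilon>" using F(3) \<open>\<epsilon> > 0\<close> unfolding dist_real_def by linarith
    finally show ?thesis .
  qed
  then show "\<exists>n. \<forall>N\<ge>n. norm (infsum f (E N) - infsum f A) < \<epsilon>" by blast
qed

text \<open>
  The partial sum over indices up to \<open>N\<close> is the nested expression with the remainder replaced by \<open>r N\<close>, which
  is what \<open>mobius\<close> makes of \<open>x (Suc N) = 0\<close>, whereas \<open>y 0\<close> is the same expression with the true remainder \<open>y N\<close>.  Both tend to 0, and
  the Lipschitz constants of the nested expressions stay bounded because the distortions are summable.
\<close>

lemma scattering_series_has_sum:
  assumes r: "\<And>n. norm (r n) < 1" and summ: "summable (\<lambda>n. norm (r n))"
    and x: "\<And>n. norm (x n) \<le> 1"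
    and step: "\<And>n. y n = mobius (r n) (x (Suc n) * y (Suc n))"
    and y: "\<And>n. norm (y n) \<le> 1" "y \<longlonglongrightarrow> 0"
  shows "((\<lambda>\<alpha>. scattering_weight r \<alpha> * (\<Prod>j | \<alpha> j \<noteq> 0. x j ^ \<alpha> j)) has_sum y 0) scattering_index"
proof -
  let ?m = "\<lambda>\<alpha>. \<Prod>j | \<alpha> j \<noteq> 0. x j ^ \<alpha> j"
  let ?f = "\<lambda>\<alpha>. scattering_weight r \<alpha> * ?m \<alpha>"
  have m: "norm (?m \<alpha>) \<le> 1" for \<alpha>
    unfolding prod_norm[symmetric] using x by (intro prod_le_1) (auto simp: norm_power power_le_one)
  have abs: "(\<lambda>\<alpha>. norm (?f \<alpha>)) summable_on scattering_index"
    by (rule summable_on_comparison_test[OF scattering_weight_abs_summable[of r, OF r summ]])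
      (use m in \<open>simp_all only: norm_mult mult_left_le norm_ge_zero mult_nonneg_nonneg\<close>)
  have mono: "?m \<alpha> = (\<Prod>j<N. x (Suc j) ^ \<alpha> (Suc j))" if "\<alpha> \<in> indices_upto N" for \<alpha> N
  proof -
    have "?m \<alpha> = (\<Prod>j=1..N. x j ^ \<alpha> j)"
    proof (rule prod.mono_neutral_left)
      show "{j. \<alpha> j \<noteq> 0} \<subseteq> {1..N}"
      proof
        fix j assume "j \<in> {j. \<alpha> j \<noteq> 0}"
        then show "j \<in> {1..N}" using that by (cases j) (auto simp: indices_upto_def not_less[symmetric])
      qed
    qed auto
    also have "\<dots> = (\<Prod>j<N. x (Suc j) ^ \<alpha> (Suc j))"
      by (rule prod.reindex_bij_witness[of _ Suc "\<lambda>j. j - 1"]) auto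
    finally show ?thesis .
  qed
  have part: "infsum ?f (indices_upto N) = nested_mobius r x N (r N)" for N
  proof -
    have "infsum ?f (indices_upto N) = infsum (\<lambda>\<alpha>. chain_weight r N \<alpha> * (\<Prod>j<N. x (Suc j) ^ \<alpha> (Suc j)) * r N ^ link \<alpha> N) (indices_upto N)"
    proof (rule infsum_cong)
      fix \<alpha> assume "\<alpha> \<in> indices_upto N"
      then show "?f \<alpha> = chain_weight r N \<alpha> * (\<Prod>j<N. x (Suc j) ^ \<alpha> (Suc j)) * r N ^ link \<alpha> N"
        by (simp only: mono scattering_weight_eq_chain_weight mult_ac)
    qed
    also have "\<dots> = nested_mobius r x N (r N)"
      using chain_weight_has_sum[of r x "r N" N, OF r x] r by (intro infsumI) (auto intro: less_imp_le)
    finally show ?thesis .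
  qed
  define P where "P = exp (\<Sum>j. mobius_distortion (r j))"
  have sd: "summable (\<lambda>j. mobius_distortion (r j))" by (rule summable_mobius_distortion[of r, OF r summ])
  have d0: "mobius_distortion (r n) \<ge> 0" for n
    unfolding mobius_distortion_def using r[of n] by auto
  have P: "(\<Prod>j<N. 1 + mobius_distortion (r j)) \<le> P" for N
  proof -
    have "(\<Prod>j<N. 1 + mobius_distortion (r j)) \<le> (\<Prod>j<N. exp (mobius_distortion (r j)))"
      using d0 by (intro prod_mono) (auto simp: add_nonneg_nonneg)
    also have "\<dots> = exp (\<Sum>j<N. mobius_distortion (r j))" by (simp add: exp_sum)
    also have "\<dots> \<le> P" unfolding P_def using sum_le_suminf[OF sd, of "{..<N}"] d0 by simp
    finally show ?thesis .
  qed
  have rlim: "r \<longlonglongrightarrow> 0" using summable_LIMSEQ_zero[OF summ] by (rule tendsto_norm_zero_cancel)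
  have "(\<lambda>N. nested_mobius r x N (r N) - y 0) \<longlonglongrightarrow> 0"
  proof (rule Lim_null_comparison)
    show "\<forall>\<^sub>F N in sequentially. norm (nested_mobius r x N (r N) - y 0) \<le> P * norm (r N - y N)"
    proof (intro always_eventually allI)
      fix N
      have "norm (nested_mobius r x N (r N) - nested_mobius r x N (y N))
          \<le> (\<Prod>j<N. 1 + mobius_distortion (r j)) * norm (r N - y N)"
        using r y(1) by (intro nested_mobius_lipschitz x) (auto intro: less_imp_le)
      also have "\<dots> \<le> P * norm (r N - y N)" by (intro mult_right_mono P) auto
      finally show "norm (nested_mobius r x N (r N) - y 0) \<le> P * norm (r N - y N)"
        by (simp add: nested_mobius_eq[of y r x, OF step])
    qed
    show "(\<lambda>N. P * norm (r N - y N)) \<longlonglongrightarrow> 0"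
    proof -
      have "(\<lambda>N. r N - y N) \<longlonglongrightarrow> 0" using tendsto_diff[OF rlim y(2)] by simp
      then show ?thesis by (intro tendsto_mult_right_zero tendsto_norm_zero)
    qed
  qed
  then have "(\<lambda>N. infsum ?f (indices_upto N)) \<longlonglongrightarrow> y 0" unfolding part by (rule LIM_zero_cancel)
  moreover have "(\<lambda>N. infsum ?f (indices_upto N)) \<longlonglongrightarrow> infsum ?f scattering_index"
  proof (rule abs_summable_exhaustion[OF abs indices_upto_subset])
    fix F :: "(nat \<Rightarrow> nat) set" assume "finite F" "F \<subseteq> scattering_index"
    then obtain n where "F \<subseteq> indices_upto n" using finite_indices_exhausted[of F 0] by blast
    moreover have "indices_upto n \<subseteq> indices_upto N" if "N \<ge> n" for N
      using that by (auto simp: indices_upto_def)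
    ultimately show "\<exists>n. \<forall>N\<ge>n. F \<subseteq> indices_upto N" by blast
  qed
  ultimately have "infsum ?f scattering_index = y 0" using LIMSEQ_unique by blast
  then show ?thesis using has_sum_infsum[OF abs_summable_summable[OF abs]] by simp
qed

section \<open>Means and positive frequencies\<close>

lemma set_integrable_continuous:
  fixes u :: "real \<Rightarrow> real"
  assumes "continuous_on UNIV u"
  shows "set_integrable lebesgue {a..b} u"
  by (rule absolutely_integrable_continuous_real) (rule continuous_on_subset[OF assms], simp)

lemma mean_over_eq_integral:
  assumes "continuous_on UNIV u"
  shows "mean_over L u = 1 / (2 * L) * integral {-L..L} u"
  unfolding mean_over_def using set_lebesgue_integral_eq_integral(2)[OF set_integrable_continuous[OF assms]] by simp

lemma integrable_of_continuous:
  fixes u :: "real \<Rightarrow> real"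
  assumes "continuous_on UNIV u"
  shows "u integrable_on {a..b}"
  by (rule integrable_continuous_interval) (rule continuous_on_subset[OF assms], simp)

lemma mean_over_add:
  assumes "continuous_on UNIV u" "continuous_on UNIV v"
  shows "mean_over L (\<lambda>x. u x + v x) = mean_over L u + mean_over L v"
  using assms by (simp add: mean_over_eq_integral continuous_on_add integral_add integrable_of_continuous distrib_left)

lemma mean_over_abs_le:
  assumes u: "continuous_on UNIV u" and B: "\<And>x. \<bar>u x\<bar> \<le> B" and L: "L > 0"
  shows "\<bar>mean_over L u\<bar> \<le> B"
proof -
  have "norm (integral {-L..L} u) \<le> B * (L - (-L))"
    by (rule integral_bound) (use B L u in \<open>auto intro: continuous_on_subset\<close>)
  then have "\<bar>integral {-L..L} u\<bar> \<le> B * (2 * L)" by simp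
  moreover have "\<bar>mean_over L u\<bar> = \<bar>integral {-L..L} u\<bar> / (2 * L)"
    using L by (simp add: mean_over_eq_integral[OF u] abs_mult)
  ultimately show ?thesis using L by (simp add: divide_le_eq)
qed

lemma mean_over_const:
  assumes "L > 0"
  shows "mean_over L (\<lambda>_. c) = c"
  using assms by (simp add: mean_over_eq_integral)

text \<open>
  The uniform closure of the exponential sums with positive frequencies.  Closure under products comes
  from adding frequencies, and vanishing of the mean from the frequencies being nonzero.  The rule for
  limits asks for uniform approximation within every \<open>\<epsilon>\<close>, so proofs by induction need not choose
  approximating sequences.
\<close>

inductive_set pos_ap :: "(real \<Rightarrow> complex) set" where
  zero: "(\<lambda>_. 0) \<in> pos_ap"
| add_exp: "g \<in> pos_ap \<Longrightarrow> 0 < \<mu> \<Longrightarrow>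
    (\<lambda>x. g x + c * exp (\<i> * complex_of_real (\<mu> * x))) \<in> pos_ap"
| lim: "(\<And>\<epsilon>. 0 < \<epsilon> \<Longrightarrow> \<exists>g. g \<in> pos_ap \<and> (\<forall>x. norm (f x - g x) \<le> \<epsilon>)) \<Longrightarrow> f \<in> pos_ap"

lemma pos_ap_bounded:
  assumes "f \<in> pos_ap"
  shows "\<exists>B. \<forall>x. norm (f x) \<le> B"
  using assms
proof induction
  case (add_exp g \<mu> c)
  then obtain B where "\<forall>x. norm (g x) \<le> B" by blast
  then have "norm (g x + c * exp (\<i> * complex_of_real (\<mu> * x))) \<le> B + norm c" for x
    by (intro order_trans[OF norm_triangle_ineq] add_mono) (auto simp: norm_mult)
  then show ?case by blast
next
  case (lim f)
  obtain g B where g: "\<And>x. norm (f x - g x) \<le> 1" and B: "\<And>x. norm (g x) \<le> B"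
    using lim[of 1] by auto
  have "norm (f x) \<le> 1 + B" for x
    using norm_triangle_ineq[of "f x - g x" "g x"] g[of x] B[of x] by simp
  then show ?case by blast
qed auto

lemma continuous_on_approx:
  fixes f :: "real \<Rightarrow> complex"
  assumes "\<And>\<epsilon>. 0 < \<epsilon> \<Longrightarrow> \<exists>g. continuous_on UNIV g \<and> (\<forall>x. norm (f x - g x) \<le> \<epsilon>)"
  shows "continuous_on UNIV f"
proof -
  have "\<forall>n. \<exists>g. continuous_on UNIV g \<and> (\<forall>x. norm (f x - g x) \<le> inverse (real (Suc n)))"
    using assms by simp
  then obtain g where g: "\<And>n. continuous_on UNIV (g n)" "\<And>n x. norm (f x - g n x) \<le> inverse (real (Suc n))"
    by metis
  have "uniform_limit UNIV g f sequentially"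
  proof (rule uniform_limitI)
    fix e :: real assume "e > 0"
    then obtain N where N: "inverse (real (Suc N)) < e" using reals_Archimedean by blast
    have "\<forall>x\<in>UNIV. dist (g n x) (f x) < e" if "n \<ge> N" for n
    proof
      fix x
      have "inverse (real (Suc n)) \<le> inverse (real (Suc N))" using that by (simp add: divide_simps)
      then show "dist (g n x) (f x) < e" using g(2)[of x n] N unfolding dist_norm norm_minus_commute[of "g n x"] by linarith
    qed
    then show "\<forall>\<^sub>F n in sequentially. \<forall>x\<in>UNIV. dist (g n x) (f x) < e"
      by (auto simp: eventually_sequentially)
  qed
  then show ?thesis using g(1) by (intro uniform_limit_theorem[of UNIV g sequentially f]) auto
qed

lemma pos_ap_continuous:
  assumes "f \<in> pos_ap"
  shows "continuous_on UNIV f"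
  using assms
proof induction
  case (lim f)
  then show ?case by (intro continuous_on_approx) blast
qed (auto intro!: continuous_intros)

lemma pos_ap_add:
  assumes "f \<in> pos_ap" "g \<in> pos_ap"
  shows "(\<lambda>x. f x + g x) \<in> pos_ap"
  using assms(2)
proof induction
  case (add_exp g \<mu> c)
  then show ?case using pos_ap.add_exp[of "\<lambda>x. f x + g x" \<mu> c] by (simp add: add.assoc)
next
  case (lim g)
  show ?case
  proof (rule pos_ap.lim)
    fix \<epsilon> :: real assume "\<epsilon> > 0"
    then obtain h where "(\<lambda>x. f x + h x) \<in> pos_ap" "\<forall>x. norm (g x - h x) \<le> \<epsilon>" using lim by blast
    then show "\<exists>h. h \<in> pos_ap \<and> (\<forall>x. norm (f x + g x - h x) \<le> \<epsilon>)"
      by (intro exI[of _ "\<lambda>x. f x + h x"]) simp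
  qed
qed (use assms(1) in simp)

text \<open>
  It is enough to multiply by single exponentials: the factor \<open>k\<close> is arbitrary so that the lemma can be
  used first for an exponential and then for an element of \<open>pos_ap\<close>.
\<close>

lemma pos_ap_mult_bounded:
  assumes g: "g \<in> pos_ap"
    and B: "\<And>x. norm (k x) \<le> B"
    and exp: "\<And>\<mu> c. 0 < \<mu> \<Longrightarrow> (\<lambda>x. k x * (c * exp (\<i> * complex_of_real (\<mu> * x)))) \<in> pos_ap"
  shows "(\<lambda>x. k x * g x) \<in> pos_ap"
  using g
proof induction
  case zero
  show ?case by (simp add: pos_ap.zero)
next
  case (add_exp g \<mu> c)
  then show ?case using pos_ap_add[OF _ exp[of \<mu> c]] by (simp add: distrib_left)
next
  case (lim g)
  have B1: "norm (k x) \<le> \<bar>B\<bar> + 1" for x using B[of x] by linarith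
  show ?case
  proof (rule pos_ap.lim)
    fix \<epsilon> :: real assume "\<epsilon> > 0"
    then have "\<epsilon> / (\<bar>B\<bar> + 1) > 0" by simp
    then obtain h where h: "(\<lambda>x. k x * h x) \<in> pos_ap" "\<And>x. norm (g x - h x) \<le> \<epsilon> / (\<bar>B\<bar> + 1)" using lim by blast
    have "norm (k x * g x - k x * h x) \<le> \<epsilon>" for x
    proof -
      have "norm (k x) * norm (g x - h x) \<le> (\<bar>B\<bar> + 1) * (\<epsilon> / (\<bar>B\<bar> + 1))"
        by (intro mult_mono B1 h) auto
      also have "\<dots> = \<epsilon>"
      proof -
        have "\<bar>B\<bar> + 1 \<noteq> 0" by linarith
        then show ?thesis by simp
      qed
      finally show ?thesis by (simp add: norm_mult flip: right_diff_distrib)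
    qed
    then show "\<exists>h. h \<in> pos_ap \<and> (\<forall>x. norm (k x * g x - h x) \<le> \<epsilon>)"
      using h(1) by (intro exI[of _ "\<lambda>x. k x * h x"]) simp
  qed
qed

lemma pos_ap_exp: "0 < \<mu> \<Longrightarrow> (\<lambda>x. c * exp (\<i> * complex_of_real (\<mu> * x))) \<in> pos_ap"
  using pos_ap.add_exp[OF pos_ap.zero] by simp

lemma pos_ap_mult_exp:
  assumes "g \<in> pos_ap" "0 \<le> \<mu>"
  shows "(\<lambda>x. c * exp (\<i> * complex_of_real (\<mu> * x)) * g x) \<in> pos_ap"
proof (rule pos_ap_mult_bounded[OF assms(1), of _ "norm c"])
  fix \<mu>' :: real and c' assume "0 < \<mu>'"
  then have "(\<lambda>x. c * c' * exp (\<i> * complex_of_real ((\<mu> + \<mu>') * x))) \<in> pos_ap"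
    using assms(2) by (intro pos_ap_exp) simp
  then show "(\<lambda>x. c * exp (\<i> * complex_of_real (\<mu> * x)) * (c' * exp (\<i> * complex_of_real (\<mu>' * x)))) \<in> pos_ap"
    by (simp add: exp_add algebra_simps)
qed (simp add: norm_mult)

lemma pos_ap_cmult: "g \<in> pos_ap \<Longrightarrow> (\<lambda>x. c * g x) \<in> pos_ap"
  using pos_ap_mult_exp[of g 0 c] by simp

lemma pos_ap_mult:
  assumes f: "f \<in> pos_ap" and g: "g \<in> pos_ap"
  shows "(\<lambda>x. f x * g x) \<in> pos_ap"
proof -
  obtain B where "\<And>x. norm (f x) \<le> B" using pos_ap_bounded[OF f] by blast
  then show ?thesis
  proof (rule pos_ap_mult_bounded[OF g])
    fix \<mu> :: real and c assume "0 < \<mu>"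
    then show "(\<lambda>x. f x * (c * exp (\<i> * complex_of_real (\<mu> * x)))) \<in> pos_ap"
      using pos_ap_mult_exp[OF f, of \<mu> c] by (simp add: mult_ac)
  qed
qed

lemma pos_ap_power: "u \<in> pos_ap \<Longrightarrow> (\<lambda>x. u x ^ Suc n) \<in> pos_ap"
  by (induction n) (auto dest: pos_ap_mult)

lemma pos_ap_sum:
  assumes "\<And>i. i \<in> I \<Longrightarrow> f i \<in> pos_ap"
  shows "(\<lambda>x. \<Sum>i\<in>I. f i x) \<in> pos_ap"
  using assms by (induction I rule: infinite_finite_induct) (auto intro: pos_ap.zero pos_ap_add)

lemma pos_ap_Ln_one_plus:
  assumes u: "u \<in> pos_ap" and s: "\<And>x. norm (u x) \<le> s" "s < 1"
  shows "(\<lambda>x. Ln (1 + u x)) \<in> pos_ap"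
proof (rule pos_ap.lim)
  fix \<epsilon> :: real assume \<epsilon>: "\<epsilon> > 0"
  have s0: "s \<ge> 0" using order_trans[OF norm_ge_zero s(1)] by blast
  let ?t = "\<lambda>n z. (-1) ^ Suc n / of_nat n * z ^ n :: complex"
  have "uniform_limit UNIV (\<lambda>N x. \<Sum>n<N. ?t n (u x)) (\<lambda>x. \<Sum>n. ?t n (u x)) sequentially"
  proof (rule Weierstrass_m_test)
    show "summable (\<lambda>n. s ^ n)" using s s0 by (intro summable_geometric) auto
    fix n x
    have "norm (?t n (u x)) \<le> 1 * s ^ n"
      unfolding norm_mult norm_power using s(1)[of x]
      by (intro mult_mono power_mono) (cases "n = 0", auto simp: norm_divide norm_power divide_le_eq)
    then show "norm (?t n (u x)) \<le> s ^ n" by simp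
  qed
  moreover have "(\<Sum>n. ?t n (u x)) = Ln (1 + u x)" for x
    using Ln_series[of "u x"] s(1)[of x] s(2) by (simp add: sums_iff)
  ultimately have "uniform_limit UNIV (\<lambda>N x. \<Sum>n<N. ?t n (u x)) (\<lambda>x. Ln (1 + u x)) sequentially"
    by simp
  from uniform_limitD[OF this \<epsilon>] obtain N where
    N: "\<And>x. dist (\<Sum>n<N. ?t n (u x)) (Ln (1 + u x)) < \<epsilon>"
    by (auto simp: eventually_sequentially)
  have "(\<lambda>x. ?t n (u x)) \<in> pos_ap" for n
  proof (cases n)
    case (Suc m)
    then show ?thesis using pos_ap_cmult[OF pos_ap_power[OF u, of m], of "(-1) ^ Suc n / of_nat n"] by simp
  qed (simp add: pos_ap.zero)
  then have "(\<lambda>x. \<Sum>n<N. ?t n (u x)) \<in> pos_ap" by (rule pos_ap_sum)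
  moreover have "norm (Ln (1 + u x) - (\<Sum>n<N. ?t n (u x))) \<le> \<epsilon>" for x
    using N[of x] by (simp add: dist_norm norm_minus_commute)
  ultimately show "\<exists>g. g \<in> pos_ap \<and> (\<forall>x. norm (Ln (1 + u x) - g x) \<le> \<epsilon>)" by blast
qed

lemma mean_over_cos_sin:
  fixes a b \<mu> :: real
  assumes "\<mu> > 0"
  shows "((\<lambda>L. mean_over L (\<lambda>x. a * cos (\<mu> * x) + b * sin (\<mu> * x))) \<longlongrightarrow> 0) at_top"
proof (rule Lim_null_comparison)
  let ?u = "\<lambda>x. a * cos (\<mu> * x) + b * sin (\<mu> * x)"
  let ?G = "\<lambda>x. (a * sin (\<mu> * x) - b * cos (\<mu> * x)) / \<mu>"
  let ?C = "(\<bar>a\<bar> + \<bar>b\<bar>) / \<mu>"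
  have G: "\<bar>?G x\<bar> \<le> ?C" for x
  proof -
    have "\<bar>a * sin (\<mu> * x)\<bar> \<le> \<bar>a\<bar>" "\<bar>b * cos (\<mu> * x)\<bar> \<le> \<bar>b\<bar>"
      by (simp_all add: abs_mult mult_left_le)
    then have "\<bar>a * sin (\<mu> * x) - b * cos (\<mu> * x)\<bar> \<le> \<bar>a\<bar> + \<bar>b\<bar>" by linarith
    then show ?thesis using assms by (simp add: abs_divide divide_right_mono)
  qed
  show "\<forall>\<^sub>F L in at_top. norm (mean_over L ?u) \<le> ?C * inverse L"
  proof (rule eventually_mono[OF eventually_gt_at_top[of 0]])
    fix L :: real assume L: "L > 0"
    have "(?u has_integral (?G L - ?G (-L))) {-L..L}"
      using L assms
      by (intro fundamental_theorem_of_calculus)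
        (auto intro!: derivative_eq_intros simp: field_simps has_real_derivative_iff_has_vector_derivative[symmetric])
    then have "integral {-L..L} ?u = ?G L - ?G (-L)" by (rule integral_unique)
    then have "\<bar>integral {-L..L} ?u\<bar> \<le> 2 * ?C" using G[of L] G[of "-L"] by linarith
    moreover have "\<bar>mean_over L ?u\<bar> = \<bar>integral {-L..L} ?u\<bar> / (2 * L)"
      using L by (subst mean_over_eq_integral) (auto intro!: continuous_intros simp: abs_mult)
    ultimately have "\<bar>mean_over L ?u\<bar> \<le> 2 * ?C / (2 * L)" using L by (simp only: divide_right_mono)
    moreover have "2 * ?C / (2 * L) = ?C * inverse L"
      by (simp only: divide_inverse inverse_mult_distrib) simp
    ultimately show "norm (mean_over L ?u) \<le> ?C * inverse L"
      by (simp only: real_norm_def)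
  qed
  show "((\<lambda>L. ?C * inverse L) \<longlongrightarrow> 0) at_top"
    by (rule tendsto_mult_right_zero[OF tendsto_inverse_0_at_top[OF filterlim_ident]])
qed

lemma pos_ap_mean_zero:
  assumes "f \<in> pos_ap"
  shows "((\<lambda>L. mean_over L (\<lambda>x. Re (f x))) \<longlongrightarrow> 0) at_top"
  using assms
proof induction
  case zero
  show ?case by (simp add: mean_over_eq_integral)
next
  case (add_exp g \<mu> c)
  have eq: "Re (g x + c * exp (\<i> * complex_of_real (\<mu> * x))) = Re (g x) + (Re c * cos (\<mu> * x) + (- Im c) * sin (\<mu> * x))" for x
    by (simp add: cis_conv_exp[symmetric] del: of_real_mult)
  have "mean_over L (\<lambda>x. Re (g x + c * exp (\<i> * complex_of_real (\<mu> * x))))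
      = mean_over L (\<lambda>x. Re (g x)) + mean_over L (\<lambda>x. Re c * cos (\<mu> * x) + (- Im c) * sin (\<mu> * x))" for L
    unfolding eq using pos_ap_continuous[OF add_exp.hyps(1)]
    by (intro mean_over_add) (auto intro!: continuous_intros)
  then show ?case
    using tendsto_add[OF add_exp.IH mean_over_cos_sin[OF add_exp.hyps(2), of "Re c" "- Im c"]] by simp
next
  case (lim f)
  have cf: "continuous_on UNIV f"
    by (rule pos_ap_continuous, rule pos_ap.lim) (use lim in blast)
  show ?case
  proof (rule tendstoI)
    fix e :: real assume "e > 0"
    then obtain g where g: "g \<in> pos_ap" "\<And>x. norm (f x - g x) \<le> e / 2"
      and lim_g: "((\<lambda>L. mean_over L (\<lambda>x. Re (g x))) \<longlongrightarrow> 0) at_top"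
      using lim[of "e / 2"] by auto
    have cg: "continuous_on UNIV g" by (rule pos_ap_continuous[OF g(1)])
    from tendstoD[OF lim_g, of "e / 2"] \<open>e > 0\<close>
    have "\<forall>\<^sub>F L in at_top. \<bar>mean_over L (\<lambda>x. Re (g x))\<bar> < e / 2" by simp
    with eventually_gt_at_top[of 0]
    show "\<forall>\<^sub>F L in at_top. dist (mean_over L (\<lambda>x. Re (f x))) 0 < e"
    proof eventually_elim
      case (elim L)
      have "mean_over L (\<lambda>x. Re (f x)) = mean_over L (\<lambda>x. Re (g x) + (Re (f x) - Re (g x)))" by simp
      also have "\<dots> = mean_over L (\<lambda>x. Re (g x)) + mean_over L (\<lambda>x. Re (f x) - Re (g x))"
        using cf cg by (intro mean_over_add continuous_intros)
      finally have "mean_over L (\<lambda>x. Re (f x)) = mean_over L (\<lambda>x. Re (g x)) + mean_over L (\<lambda>x. Re (f x) - Re (g x))" .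
      moreover have "\<bar>mean_over L (\<lambda>x. Re (f x) - Re (g x))\<bar> \<le> e / 2"
      proof (rule mean_over_abs_le)
        show "\<bar>Re (f x) - Re (g x)\<bar> \<le> e / 2" for x
          using abs_Re_le_cmod[of "f x - g x"] g(2)[of x] by simp
      qed (use cf cg elim in \<open>auto intro!: continuous_intros\<close>)
      ultimately show ?case using elim by simp
    qed
  qed
qed

section \<open>Schur recursions along a line\<close>

lemma monomial_on_line:
  "(\<Prod>j | \<alpha> j \<noteq> 0. exp (\<i> * complex_of_real (\<mu> j * \<omega>)) ^ \<alpha> j)
    = exp (\<i> * complex_of_real (pairing \<alpha> \<mu> * \<omega>))"
proof (cases "finite {j. \<alpha> j \<noteq> 0}")
  case True
  have "(\<Prod>j | \<alpha> j \<noteq> 0. exp (\<i> * complex_of_real (\<mu> j * \<omega>)) ^ \<alpha> j)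
      = (\<Prod>j | \<alpha> j \<noteq> 0. exp (\<i> * complex_of_real (real (\<alpha> j) * \<mu> j * \<omega>)))"
    by (intro prod.cong refl) (simp add: exp_of_nat_mult[symmetric] mult_ac)
  also have "\<dots> = exp (\<Sum>j | \<alpha> j \<noteq> 0. \<i> * complex_of_real (real (\<alpha> j) * \<mu> j * \<omega>))"
    using True by (simp add: exp_sum)
  also have "(\<Sum>j | \<alpha> j \<noteq> 0. \<i> * complex_of_real (real (\<alpha> j) * \<mu> j * \<omega>)) = \<i> * complex_of_real (pairing \<alpha> \<mu> * \<omega>)"
    by (simp add: pairing_def sum_distrib_left sum_distrib_right)
  finally show ?thesis .
qed (simp add: pairing_def)

lemma trig_polynomial_sum:
  assumes "finite F"
  shows "trig_polynomial (\<lambda>\<omega>. \<Sum>\<alpha>\<in>F. c \<alpha> * exp (\<i> * complex_of_real (freq \<alpha> * \<omega>)))"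
  unfolding trig_polynomial_def
proof (intro exI conjI)
  show "finite (freq ` F)" using assms by simp
  show "(\<lambda>\<omega>. \<Sum>\<alpha>\<in>F. c \<alpha> * exp (\<i> * complex_of_real (freq \<alpha> * \<omega>)))
    = (\<lambda>\<omega>. \<Sum>\<mu>\<in>freq ` F. (\<Sum>\<alpha> | \<alpha> \<in> F \<and> freq \<alpha> = \<mu>. c \<alpha>) * exp (\<i> * complex_of_real (\<mu> * \<omega>)))"
  proof
    fix \<omega>
    show "(\<Sum>\<alpha>\<in>F. c \<alpha> * exp (\<i> * complex_of_real (freq \<alpha> * \<omega>)))
      = (\<Sum>\<mu>\<in>freq ` F. (\<Sum>\<alpha> | \<alpha> \<in> F \<and> freq \<alpha> = \<mu>. c \<alpha>) * exp (\<i> * complex_of_real (\<mu> * \<omega>)))"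
      by (subst sum.image_gen[OF assms, of _ freq]) (auto intro!: sum.cong simp: sum_distrib_right)
  qed
qed

lemma besicovitch_ap_uniform:
  assumes g: "continuous_on UNIV g" and p: "p \<ge> 1"
    and approx: "\<And>\<epsilon>. \<epsilon> > 0 \<Longrightarrow> \<exists>P. trig_polynomial P \<and> (\<forall>x. norm (g x - P x) \<le> \<epsilon>)"
  shows "besicovitch_ap p g"
  unfolding besicovitch_ap_def
proof (intro conjI allI impI)
  have cont_powr: "continuous_on UNIV (\<lambda>x. norm (k x) powr p)" if "continuous_on UNIV k" for k :: "real \<Rightarrow> complex"
    using that p by (intro continuous_on_powr' continuous_intros) auto
  have "g \<in> borel_measurable borel" using g by (simp add: borel_measurable_continuous_onI)
  then show "g \<in> borel_measurable lebesgue"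
    by (intro measurable_completion) simp
  show "set_integrable lebesgue {-L..L} (\<lambda>x. norm (g x) powr p)" for L
    by (intro set_integrable_continuous cont_powr g)
  fix \<epsilon> :: real assume \<epsilon>: "\<epsilon> > 0"
  define \<delta> where "\<delta> = (\<epsilon> / 2) powr (1 / p)"
  have \<delta>: "\<delta> > 0" "\<delta> powr p = \<epsilon> / 2" using \<epsilon> p by (auto simp: \<delta>_def powr_powr)
  obtain P where P: "trig_polynomial P" "\<And>x. norm (g x - P x) \<le> \<delta>" using approx[OF \<delta>(1)] by blast
  have cP: "continuous_on UNIV P"
    using P(1) unfolding trig_polynomial_def by (auto intro!: continuous_intros)
  have "\<forall>\<^sub>F L in at_top. ereal (mean_over L (\<lambda>x. norm (g x - P x) powr p)) \<le> ereal (\<epsilon> / 2)"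
  proof (rule eventually_mono[OF eventually_gt_at_top[of 0]])
    fix L :: real assume L: "L > 0"
    have "\<bar>mean_over L (\<lambda>x. norm (g x - P x) powr p)\<bar> \<le> \<epsilon> / 2"
    proof (rule mean_over_abs_le[OF _ _ L])
      show "continuous_on UNIV (\<lambda>x. norm (g x - P x) powr p)"
        using g cP by (intro cont_powr continuous_intros)
      show "\<bar>norm (g x - P x) powr p\<bar> \<le> \<epsilon> / 2" for x
        using powr_mono2[of p "norm (g x - P x)" \<delta>] P(2)[of x] p \<delta>(2) by simp
    qed
    then show "ereal (mean_over L (\<lambda>x. norm (g x - P x) powr p)) \<le> ereal (\<epsilon> / 2)" by simp
  qed
  then have "Limsup at_top (\<lambda>L. ereal (mean_over L (\<lambda>x. norm (g x - P x) powr p))) \<le> ereal (\<epsilon> / 2)"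
    by (rule Limsup_bounded)
  also have "\<dots> < ereal \<epsilon>" using \<epsilon> by simp
  finally show "\<exists>P. trig_polynomial P \<and> Limsup at_top (\<lambda>L. ereal (mean_over L (\<lambda>x. norm (g x - P x) powr p))) < ereal \<epsilon>"
    using P(1) by blast
qed

lemma neg_ln_one_minus_square_le:
  fixes s :: real
  assumes "0 \<le> s" "s \<le> 1/2"
  shows "- ln (1 - s\<^sup>2) \<le> 2 * s"
proof -
  have s2: "s\<^sup>2 \<le> s / 2" using mult_left_mono[of s "1/2" s] assms by (simp add: power2_eq_square)
  then have "s\<^sup>2 \<le> 1/4" using assms by linarith
  then have "- s\<^sup>2 - 2 * (s\<^sup>2)\<^sup>2 \<le> ln (1 - s\<^sup>2)"
    by (intro ln_one_minus_pos_lower_bound) auto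
  moreover have "(s\<^sup>2)\<^sup>2 \<le> s\<^sup>2 * 1"
    unfolding power2_eq_square[of "s\<^sup>2"] using \<open>s\<^sup>2 \<le> 1/4\<close> by (intro mult_left_mono) auto
  ultimately show ?thesis using s2 assms by linarith
qed

text \<open>
  A Schur recursion for functions of \<open>\<omega>\<close> in which the coordinates are the pure oscillations
  with frequencies \<open>\<mu> n\<close>.  Here \<open>k n\<close> is the \<open>n\<close>-th remainder, and the uniform decay of the remainders
  is expressed by \<open>\<tau>\<close>.
\<close>

locale schur_recursion_on_line =
  fixes r :: "nat \<Rightarrow> complex" and \<mu> :: "nat \<Rightarrow> real" and k :: "nat \<Rightarrow> real \<Rightarrow> complex" and \<tau> :: "nat \<Rightarrow> real"
  assumes r: "norm (r n) < 1" and r_summable: "summable (\<lambda>n. norm (r n))"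
    and \<mu>: "\<mu> n > 0"
    and k_continuous: "continuous_on UNIV (k n)"
    and k_less: "norm (k n \<omega>) < 1"
    and k_step: "k n \<omega> = mobius (r n) (exp (\<i> * complex_of_real (\<mu> (Suc n) * \<omega>)) * k (Suc n) \<omega>)"
    and k_le: "norm (k n \<omega>) \<le> \<tau> n" and \<tau>: "\<tau> \<longlonglongrightarrow> 0"
begin

lemma shifted_weights_summable:
  "(\<lambda>\<alpha>. norm (scattering_weight (\<lambda>j. r (j + n)) \<alpha>)) summable_on scattering_index"
  using r summable_ignore_initial_segment[OF r_summable, of n]
  by (intro scattering_weight_abs_summable) auto

text \<open>
  The remainder after \<open>n\<close> steps is itself the start of a Schur recursion, with all sequences shifted by \<open>n\<close>.
\<close>

lemma k_has_sum:
  "((\<lambda>\<alpha>. scattering_weight (\<lambda>j. r (j + n)) \<alpha> * exp (\<i> * complex_of_real (pairing \<alpha> (\<lambda>j. \<mu> (j + n)) * \<omega>)))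
    has_sum k n \<omega>) scattering_index"
proof -
  have lim: "(\<lambda>j. k (j + n) \<omega>) \<longlonglongrightarrow> 0"
    by (rule LIMSEQ_ignore_initial_segment, rule Lim_null_comparison[OF _ \<tau>]) (use k_le in auto)
  have "((\<lambda>\<alpha>. scattering_weight (\<lambda>j. r (j + n)) \<alpha> *
      (\<Prod>j | \<alpha> j \<noteq> 0. exp (\<i> * complex_of_real (\<mu> (j + n) * \<omega>)) ^ \<alpha> j)) has_sum k (0 + n) \<omega>) scattering_index"
  proof (rule scattering_series_has_sum[where y = "\<lambda>j. k (j + n) \<omega>"])
    show "summable (\<lambda>j. norm (r (j + n)))" by (rule summable_ignore_initial_segment[OF r_summable])
    show "k (j + n) \<omega> = mobius (r (j + n)) (exp (\<i> * complex_of_real (\<mu> (Suc j + n) * \<omega>)) * k (Suc j + n) \<omega>)" for j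
      using k_step[of "j + n" \<omega>] by (simp only: add_Suc)
    show "norm (r (j + n)) < 1" for j by (rule r)
    show "norm (exp (\<i> * complex_of_real (\<mu> (j + n) * \<omega>))) \<le> 1" for j by simp
    show "norm (k (j + n) \<omega>) \<le> 1" for j by (rule less_imp_le[OF k_less])
  qed (rule lim)
  then show ?thesis by (simp only: monomial_on_line add_0_left)
qed

lemma k_uniform_approx:
  assumes "\<epsilon> > 0"
  shows "\<exists>F. finite F \<and> (\<forall>\<omega>. norm (k n \<omega> -
    (\<Sum>\<alpha>\<in>F. scattering_weight (\<lambda>j. r (j + n)) \<alpha> * exp (\<i> * complex_of_real (pairing \<alpha> (\<lambda>j. \<mu> (j + n)) * \<omega>)))) \<le> \<epsilon>)"
proof -
  let ?c = "scattering_weight (\<lambda>j. r (j + n))"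
  let ?A = "scattering_index"
  obtain F where F: "finite F" "F \<subseteq> ?A" "dist (\<Sum>\<alpha>\<in>F. norm (?c \<alpha>)) (infsum (\<lambda>\<alpha>. norm (?c \<alpha>)) ?A) \<le> \<epsilon>"
    using infsum_finite_approximation[OF shifted_weights_summable \<open>\<epsilon> > 0\<close>] by blast
  have "norm (k n \<omega> - (\<Sum>\<alpha>\<in>F. ?c \<alpha> * exp (\<i> * complex_of_real (pairing \<alpha> (\<lambda>j. \<mu> (j + n)) * \<omega>)))) \<le> \<epsilon>" for \<omega>
  proof -
    let ?f = "\<lambda>\<alpha>. ?c \<alpha> * exp (\<i> * complex_of_real (pairing \<alpha> (\<lambda>j. \<mu> (j + n)) * \<omega>))"
    have nf: "norm (?f \<alpha>) = norm (?c \<alpha>)" for \<alpha> by (simp add: norm_mult)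
    have "(?f has_sum (k n \<omega> - sum ?f F)) (?A - F)"
      by (rule has_sum_Diff[OF k_has_sum has_sum_finite[OF F(1)] F(2)])
    then have eq: "k n \<omega> - sum ?f F = infsum ?f (?A - F)" by (rule infsumI[symmetric])
    have s: "(\<lambda>\<alpha>. norm (?c \<alpha>)) summable_on (?A - F)"
      by (rule summable_on_subset_banach[OF shifted_weights_summable]) auto
    have "norm (infsum ?f (?A - F)) \<le> infsum (\<lambda>\<alpha>. norm (?f \<alpha>)) (?A - F)"
      by (rule norm_infsum_bound) (simp only: nf s)
    also have "\<dots> = infsum (\<lambda>\<alpha>. norm (?c \<alpha>)) ?A - (\<Sum>\<alpha>\<in>F. norm (?c \<alpha>))"
      unfolding nf
      by (rule infsumI, rule has_sum_Diff[OF has_sum_infsum[OF shifted_weights_summable] has_sum_finite[OF F(1)] F(2)])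
    also have "\<dots> \<le> \<epsilon>" using F(3) unfolding dist_real_def by linarith
    finally show ?thesis unfolding eq .
  qed
  then show ?thesis using F(1) by blast
qed

lemma k_besicovitch: "p \<ge> 1 \<Longrightarrow> besicovitch_ap p (k n)"
proof (rule besicovitch_ap_uniform[OF k_continuous])
  fix \<epsilon> :: real assume "\<epsilon> > 0"
  let ?P = "\<lambda>F \<omega>. \<Sum>\<alpha>\<in>F. scattering_weight (\<lambda>j. r (j + n)) \<alpha> *
    exp (\<i> * complex_of_real (pairing \<alpha> (\<lambda>j. \<mu> (j + n)) * \<omega>))"
  obtain F where "finite F" "\<forall>\<omega>. norm (k n \<omega> - ?P F \<omega>) \<le> \<epsilon>"
    using k_uniform_approx[OF \<open>\<epsilon> > 0\<close>, of n] by blast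
  then show "\<exists>P. trig_polynomial P \<and> (\<forall>x. norm (k n x - P x) \<le> \<epsilon>)"
    by (intro exI[of _ "?P F"] conjI trig_polynomial_sum)
qed

text \<open>
  The quantity in the denominator \<open>1 + u\<close> of the \<open>n\<close>-th Moebius step.  The oscillating factor in front of the
  remainder makes all its frequencies positive.
\<close>

definition u :: "nat \<Rightarrow> real \<Rightarrow> complex"
  where "u n \<omega> = cnj (r n) * (exp (\<i> * complex_of_real (\<mu> (Suc n) * \<omega>)) * k (Suc n) \<omega>)"

lemma u_pos_ap: "u n \<in> pos_ap"
proof -
  have "(\<lambda>\<omega>. exp (\<i> * complex_of_real (\<mu> (Suc n) * \<omega>)) * k (Suc n) \<omega>) \<in> pos_ap"
  proof (rule pos_ap.lim)
    fix \<epsilon> :: real assume "\<epsilon> > 0"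
    let ?c = "scattering_weight (\<lambda>j. r (j + Suc n))" and ?freq = "\<lambda>\<alpha>. pairing \<alpha> (\<lambda>j. \<mu> (j + Suc n))"
    let ?e = "\<lambda>\<omega>. exp (\<i> * complex_of_real (\<mu> (Suc n) * \<omega>))"
    obtain F where F: "\<And>\<omega>. norm (k (Suc n) \<omega> - (\<Sum>\<alpha>\<in>F. ?c \<alpha> * exp (\<i> * complex_of_real (?freq \<alpha> * \<omega>)))) \<le> \<epsilon>"
      using k_uniform_approx[OF \<open>\<epsilon> > 0\<close>, of "Suc n"] by blast
    define g where "g \<omega> = (\<Sum>\<alpha>\<in>F. ?c \<alpha> * exp (\<i> * complex_of_real ((\<mu> (Suc n) + ?freq \<alpha>) * \<omega>)))" for \<omega>
    have "?freq \<alpha> \<ge> 0" for \<alpha>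
      unfolding pairing_def using \<mu> by (intro sum_nonneg mult_nonneg_nonneg) (auto intro: less_imp_le)
    then have "g \<in> pos_ap"
      unfolding g_def using \<mu>[of "Suc n"] by (intro pos_ap_sum pos_ap_exp add_pos_nonneg)
    moreover have "norm (?e \<omega> * k (Suc n) \<omega> - g \<omega>) \<le> \<epsilon>" for \<omega>
    proof -
      have "g \<omega> = ?e \<omega> * (\<Sum>\<alpha>\<in>F. ?c \<alpha> * exp (\<i> * complex_of_real (?freq \<alpha> * \<omega>)))"
        unfolding g_def sum_distrib_left by (intro sum.cong refl) (simp add: distrib_right distrib_left exp_add mult_ac)
      then have "norm (?e \<omega> * k (Suc n) \<omega> - g \<omega>)
          = norm (?e \<omega>) * norm (k (Suc n) \<omega> - (\<Sum>\<alpha>\<in>F. ?c \<alpha> * exp (\<i> * complex_of_real (?freq \<alpha> * \<omega>))))"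
        by (simp only: right_diff_distrib[symmetric] norm_mult)
      also have "norm (?e \<omega>) = 1" by simp
      finally show ?thesis using F[of \<omega>] by simp
    qed
    ultimately show "\<exists>g. g \<in> pos_ap \<and> (\<forall>\<omega>. norm (?e \<omega> * k (Suc n) \<omega> - g \<omega>) \<le> \<epsilon>)" by blast
  qed
  then show ?thesis unfolding u_def by (rule pos_ap_cmult)
qed

lemma u_le: "norm (u n \<omega>) \<le> norm (r n)"
  using k_less[of "Suc n" \<omega>] by (simp add: u_def norm_mult mult_left_le less_imp_le)

lemma Ln_u_pos_ap: "(\<lambda>\<omega>. 2 * Ln (1 + u n \<omega>)) \<in> pos_ap"
  by (rule pos_ap_cmult, rule pos_ap_Ln_one_plus[OF u_pos_ap u_le r])

definition energy :: "nat \<Rightarrow> real \<Rightarrow> real"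
  where "energy n \<omega> = - ln (1 - (norm (k n \<omega>))\<^sup>2)"

lemma energy_continuous: "continuous_on UNIV (energy n)"
proof -
  have "1 - (norm (k n \<omega>))\<^sup>2 > 0" for \<omega> using k_less[of n \<omega>] by (simp add: abs_square_less_1)
  then show ?thesis
    unfolding energy_def using k_continuous[of n]
    by (intro continuous_intros continuous_on_ln) (auto simp: less_le)
qed

text \<open>
  The factor \<open>|1 + u|\<^sup>2\<close> is the only part of the identity for \<open>1 - |mobius r w|\<^sup>2\<close> that depends on
  more than the sizes of parameter and remainder.
\<close>

lemma energy_step: "energy n \<omega> = - ln (1 - (norm (r n))\<^sup>2) + energy (Suc n) \<omega> + Re (2 * Ln (1 + u n \<omega>))"
proof -
  let ?w = "exp (\<i> * complex_of_real (\<mu> (Suc n) * \<omega>)) * k (Suc n) \<omega>"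
  have w: "norm ?w = norm (k (Suc n) \<omega>)" by (simp add: norm_mult)
  have nz: "1 + cnj (r n) * ?w \<noteq> 0"
    using k_less[of "Suc n" \<omega>] w by (intro one_plus_cnj_mult_nonzero norm_mult_lt_one r) simp
  have pos: "1 - (norm (r n))\<^sup>2 > 0" "1 - (norm (k (Suc n) \<omega>))\<^sup>2 > 0"
    using r[of n] k_less[of "Suc n" \<omega>] by (auto simp: abs_square_less_1)
  have "1 - (norm (k n \<omega>))\<^sup>2 = (1 - (norm (r n))\<^sup>2) * (1 - (norm (k (Suc n) \<omega>))\<^sup>2) / (norm (1 + u n \<omega>))\<^sup>2"
    using one_minus_norm_mobius_sq[OF nz] k_step[of n \<omega>] w by (simp add: u_def)
  moreover have "1 + u n \<omega> \<noteq> 0" using nz by (simp add: u_def)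
  ultimately show ?thesis
    using pos by (simp add: energy_def ln_div ln_mult ln_realpow)
qed

lemma mean_energy_decomposition:
  assumes L: "L > 0"
  shows "mean_over L (energy 0) = (\<Sum>n<N. - ln (1 - (norm (r n))\<^sup>2)) +
    (\<Sum>n<N. mean_over L (\<lambda>\<omega>. Re (2 * Ln (1 + u n \<omega>)))) + mean_over L (energy N)"
proof (induction N)
  case (Suc N)
  let ?v = "\<lambda>\<omega>. Re (2 * Ln (1 + u N \<omega>))" and ?c = "- ln (1 - (norm (r N))\<^sup>2)"
  have cv: "continuous_on UNIV ?v" by (intro continuous_intros pos_ap_continuous[OF Ln_u_pos_ap])
  have "mean_over L (energy N) = mean_over L (\<lambda>\<omega>. (?c + energy (Suc N) \<omega>) + ?v \<omega>)"
    using energy_step[of N] by (intro arg_cong[where f = "mean_over L"] ext)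
  also have "\<dots> = mean_over L (\<lambda>\<omega>. ?c + energy (Suc N) \<omega>) + mean_over L ?v"
    by (intro mean_over_add continuous_on_add continuous_on_const energy_continuous cv)
  also have "mean_over L (\<lambda>\<omega>. ?c + energy (Suc N) \<omega>) = ?c + mean_over L (energy (Suc N))"
    using mean_over_add[OF continuous_on_const energy_continuous, of L ?c "Suc N"]
    by (simp only: mean_over_const[OF L])
  finally show ?case using Suc by simp
qed simp

lemma log_parameters_summable: "summable (\<lambda>n. - ln (1 - (norm (r n))\<^sup>2))"
proof (rule summable_comparison_test_ev)
  have "(\<lambda>n. norm (r n)) \<longlonglongrightarrow> 0" by (rule summable_LIMSEQ_zero[OF r_summable])
  then have "\<forall>\<^sub>F n in sequentially. norm (r n) < 1/2" by (rule order_tendstoD) simp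
  then show "\<forall>\<^sub>F n in sequentially. norm (- ln (1 - (norm (r n))\<^sup>2)) \<le> 2 * norm (r n)"
  proof eventually_elim
    case (elim n)
    have "0 < 1 - (norm (r n))\<^sup>2" using r[of n] by (simp add: abs_square_less_1)
    then have "ln (1 - (norm (r n))\<^sup>2) \<le> 0" by simp
    then show ?case using neg_ln_one_minus_square_le[of "norm (r n)"] elim by simp
  qed
  show "summable (\<lambda>n. 2 * norm (r n))" by (rule summable_mult[OF r_summable])
qed

lemma energy_bound:
  assumes "\<tau> n \<le> 1/2"
  shows "\<bar>energy n \<omega>\<bar> \<le> 2 * \<tau> n"
proof -
  have "0 < 1 - (norm (k n \<omega>))\<^sup>2" using k_less[of n \<omega>] by (simp add: abs_square_less_1)
  then have "energy n \<omega> \<ge> 0" by (simp add: energy_def)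
  moreover have "energy n \<omega> \<le> 2 * norm (k n \<omega>)"
    unfolding energy_def using k_le[of n \<omega>] assms by (intro neg_ln_one_minus_square_le) auto
  ultimately show ?thesis using k_le[of n \<omega>] by simp
qed

text \<open>
  The mean of the \<open>N\<close>-th energy is small for large \<open>N\<close> uniformly in \<open>L\<close>, so \<open>N\<close> is fixed first and \<open>L\<close> sent
  to infinity afterwards.
\<close>

lemma mean_energy:
  "((\<lambda>L. mean_over L (energy 0)) \<longlongrightarrow> (\<Sum>n. - ln (1 - (norm (r n))\<^sup>2))) at_top"
proof (rule tendstoI)
  fix e :: real assume "e > 0"
  let ?S = "\<Sum>n. - ln (1 - (norm (r n))\<^sup>2)"
  let ?s = "\<lambda>N. \<Sum>n<N. - ln (1 - (norm (r n))\<^sup>2)"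
  have "\<forall>\<^sub>F N in sequentially. dist (?s N) ?S < e / 3"
    using \<open>e > 0\<close> by (intro tendstoD summable_LIMSEQ log_parameters_summable) simp
  moreover have "\<forall>\<^sub>F N in sequentially. \<tau> N < min (1/2) (e / 6)"
    using \<open>e > 0\<close> by (intro order_tendstoD(2)[OF \<tau>]) simp
  ultimately have "\<forall>\<^sub>F N in sequentially. dist (?s N) ?S < e / 3 \<and> \<tau> N < min (1/2) (e / 6)"
    by (rule eventually_conj)
  then obtain N where N: "dist (?s N) ?S < e / 3" "\<tau> N < 1/2" "\<tau> N < e / 6"
    by (auto simp: eventually_sequentially)
  let ?m = "\<lambda>L. \<Sum>n<N. mean_over L (\<lambda>\<omega>. Re (2 * Ln (1 + u n \<omega>)))"
  have "(?m \<longlongrightarrow> (\<Sum>n<N. 0)) at_top"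
    by (intro tendsto_sum pos_ap_mean_zero Ln_u_pos_ap)
  from tendstoD[OF this, of "e / 3"] \<open>e > 0\<close>
  have "\<forall>\<^sub>F L in at_top. \<bar>?m L\<bar> < e / 3" by (simp add: dist_real_def)
  with eventually_gt_at_top[of 0]
  show "\<forall>\<^sub>F L in at_top. dist (mean_over L (energy 0)) ?S < e"
  proof eventually_elim
    case (elim L)
    have "\<bar>mean_over L (energy N)\<bar> \<le> 2 * \<tau> N"
      using N(2) by (intro mean_over_abs_le energy_continuous energy_bound elim) simp
    then show ?case
      using N(1,3) elim(2) unfolding mean_energy_decomposition[OF elim(1), of N] dist_real_def by linarith
  qed
qed

end

section \<open>From the polydisc to a line on the torus\<close>

lemma schur_class_subset_H_space:
  assumes "h \<in> schur_class"
  shows "mv_holomorphic_on h polydisc" "z \<in> polydisc \<Longrightarrow> norm (h z) \<le> 1"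
proof -
  have "h \<in> H_space"
    using assms closure_of_subset_topspace[of H_topology schur_generators]
    by (auto simp: schur_class_def topspace_H_topology)
  then show "mv_holomorphic_on h polydisc" "z \<in> polydisc \<Longrightarrow> norm (h z) \<le> 1"
    by (auto simp: H_space_def)
qed

definition diag :: "complex \<Rightarrow> complex ^ 'd"
  where "diag \<zeta> = (\<chi> j. \<zeta>)"

lemma bounded_linear_diag: "bounded_linear (diag :: complex \<Rightarrow> complex ^ 'd)"
proof -
  have "linear (diag :: complex \<Rightarrow> complex ^ 'd)"
    by (rule linearI) (simp_all add: diag_def vec_eq_iff)
  then show ?thesis by (simp add: linear_conv_bounded_linear)
qed

lemma holomorphic_on_diag:
  assumes g: "mv_holomorphic_on g W" and V: "\<And>\<zeta>. \<zeta> \<in> V \<Longrightarrow> diag \<zeta> \<in> W"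
  shows "(\<lambda>\<zeta>. g (diag \<zeta>)) holomorphic_on V"
  unfolding holomorphic_on_def
proof
  fix \<zeta> assume "\<zeta> \<in> V"
  then obtain a where a: "(g has_derivative (\<lambda>v. \<Sum>j\<in>UNIV. a $ j * v $ j)) (at (diag \<zeta>))"
    using g V by (auto simp: mv_holomorphic_on_def)
  have "(diag has_derivative (\<lambda>v. diag v :: complex ^ 'a)) (at \<zeta>)"
    using bounded_linear.has_derivative[OF bounded_linear_diag has_derivative_ident] .
  from diff_chain_at[OF this a]
  have "((\<lambda>\<zeta>. g (diag \<zeta>)) has_derivative (\<lambda>v. \<Sum>j\<in>UNIV. a $ j * v)) (at \<zeta>)"
    by (simp add: o_def diag_def)
  moreover have "(\<lambda>v. \<Sum>j\<in>UNIV. a $ j * v) = (*) (\<Sum>j\<in>UNIV. a $ j)"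
    by (simp add: fun_eq_iff sum_distrib_right)
  ultimately have "((\<lambda>\<zeta>. g (diag \<zeta>)) has_field_derivative (\<Sum>j\<in>UNIV. a $ j)) (at \<zeta>)"
    by (simp only: has_field_derivative_def)
  then show "(\<lambda>\<zeta>. g (diag \<zeta>)) field_differentiable at \<zeta> within V"
    using field_differentiable_at_within field_differentiable_def by blast
qed

text \<open>
  A run of the Schur algorithm with strictly contractive parameters, started at a function that extends
  across the closed polydisc with values in the open disc.
\<close>

locale schur_algorithm =
  fixes h :: "nat \<Rightarrow> complex ^ 'd::finite \<Rightarrow> complex" and r :: "nat \<Rightarrow> complex" and \<nu> :: "nat \<Rightarrow> 'd"
    and ft :: "complex ^ 'd \<Rightarrow> complex" and U :: "(complex ^ 'd) set"
  assumes h_holo: "mv_holomorphic_on (h n) polydisc"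
    and h_le: "z \<in> polydisc \<Longrightarrow> norm (h n z) \<le> 1"
    and r_less: "norm (r n) < 1"
    and h_step: "z \<in> polydisc \<Longrightarrow> h n z = mobius (r n) (z $ \<nu> (Suc n) * h (Suc n) z)"
    and U: "open U" "closed_polydisc \<subseteq> U" and ft_holo: "mv_holomorphic_on ft U"
    and ft_less: "z \<in> closed_polydisc \<Longrightarrow> norm (ft z) < 1"
    and ft_eq: "z \<in> polydisc \<Longrightarrow> ft z = h 0 z"
begin

lemma step_le: "z \<in> polydisc \<Longrightarrow> norm (z $ j * h n z) \<le> 1"
  using h_le[of z n] by (simp add: polydisc_def norm_mult mult_le_one less_imp_le)

lemma ft_continuous: "continuous_on U ft"
  using ft_holo by (auto simp: mv_holomorphic_on_def intro!: continuous_at_imp_continuous_on dest: has_derivative_continuous)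

text \<open>
  Restricted to the diagonal, all coordinates coincide and the recursion becomes the Schur algorithm in one
  variable, with the same parameters.  By compactness the restriction of \<open>ft\<close> is holomorphic and
  bounded by some number below 1 on a disc of radius greater than 1.
\<close>

lemma r_summable: "summable (\<lambda>n. norm (r n))"
proof -
  let ?D = "diag :: complex \<Rightarrow> complex ^ 'd"
  define W where "W = {z \<in> U. norm (ft z) < 1}"
  have "open (U \<inter> (\<lambda>z. norm (ft z)) -` {..<1})"
    by (intro continuous_open_preimage U continuous_on_norm ft_continuous) auto
  then have "open W" by (simp add: W_def vimage_def Int_def)
  then have V: "open (?D -` W)"
    using bounded_linear_diag linear_continuous_on by (intro open_vimage) auto
  have "cball 0 1 \<subseteq> ?D -` W"
    using U(2) ft_less by (auto simp: W_def diag_def closed_polydisc_def subset_iff)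
  then obtain R0 where R0: "R0 > 1" "cball 0 R0 \<subseteq> ?D -` W" using cball_enlarge[OF V] by blast
  \<comment> \<open>compactness below needs a closed disc inside the disc on which \<open>ft\<close> is known to be holomorphic\<close>
  define R where "R = (1 + R0) / 2"
  have R: "1 < R" "R < R0" using R0(1) by (auto simp: R_def field_simps)
  let ?g = "\<lambda>\<zeta>. ft (?D \<zeta>)"
  have g_holo: "?g holomorphic_on ball 0 R0"
  proof (rule holomorphic_on_diag[OF ft_holo])
    fix \<zeta> :: complex assume "\<zeta> \<in> ball 0 R0"
    then have "\<zeta> \<in> cball 0 R0" by auto
    then show "?D \<zeta> \<in> U" using R0(2) by (auto simp: W_def)
  qed
  have "continuous_on (cball 0 R) (\<lambda>\<zeta>. norm (?g \<zeta>))"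
    using R by (intro continuous_on_norm continuous_on_subset[OF holomorphic_on_imp_continuous_on[OF g_holo]]) auto
  then obtain \<zeta>0 where \<zeta>0: "\<zeta>0 \<in> cball 0 R" "\<And>\<zeta>. \<zeta> \<in> cball 0 R \<Longrightarrow> norm (?g \<zeta>) \<le> norm (?g \<zeta>0)"
    using continuous_attains_sup[OF compact_cball, of 0 R "\<lambda>\<zeta>. norm (?g \<zeta>)"] R by auto
  have "\<zeta>0 \<in> cball 0 R0" using \<zeta>0(1) R by auto
  then have "?D \<zeta>0 \<in> W" using R0(2) by auto
  then have \<rho>: "norm (?g \<zeta>0) < 1" by (simp add: W_def)
  have D_polydisc: "\<zeta> \<in> ball 0 1 \<Longrightarrow> ?D \<zeta> \<in> polydisc" for \<zeta> by (simp add: diag_def polydisc_def)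
  define F where "F n = fps_expansion (\<lambda>\<zeta>. h n (?D \<zeta>)) 0" for n
  have F: "(\<lambda>\<zeta>. h n (?D \<zeta>)) has_fps_expansion F n" for n
    unfolding F_def
    by (rule has_fps_expansion_fps_expansion[of "ball 0 1"]) (auto intro!: holomorphic_on_diag[OF h_holo] D_polydisc)
  have near: "\<forall>\<^sub>F \<zeta> in nhds 0. \<zeta> \<in> ball (0::complex) 1" by (intro eventually_nhds_in_open) auto
  have step: "F n - fps_const (r n) = fps_X * F (Suc n) * (1 - fps_const (cnj (r n)) * F n)" for n
  proof (rule fps_expansion_unique_complex)
    show "(\<lambda>\<zeta>. h n (?D \<zeta>) - r n) has_fps_expansion F n - fps_const (r n)"
      by (intro fps_expansion_intros F)
    have "(\<lambda>\<zeta>. \<zeta> * h (Suc n) (?D \<zeta>) * (1 - cnj (r n) * h n (?D \<zeta>))) has_fps_expansion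
      fps_X * F (Suc n) * (1 - fps_const (cnj (r n)) * F n)"
      by (intro fps_expansion_intros F)
    moreover have "\<forall>\<^sub>F \<zeta> in nhds 0. h n (?D \<zeta>) - r n = \<zeta> * h (Suc n) (?D \<zeta>) * (1 - cnj (r n) * h n (?D \<zeta>))"
      using near
    proof eventually_elim
      case (elim \<zeta>)
      from D_polydisc[OF elim] have z: "?D \<zeta> \<in> polydisc" .
      show ?case
        using mobius_cross_multiplied[OF r_less[of n] step_le[OF z, of "\<nu> (Suc n)" "Suc n"]] h_step[OF z, of n]
        by (simp add: diag_def)
    qed
    ultimately show "(\<lambda>\<zeta>. h n (?D \<zeta>) - r n) has_fps_expansion
      fps_X * F (Suc n) * (1 - fps_const (cnj (r n)) * F n)"
      by (subst has_fps_expansion_cong[OF _ refl])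
  qed
  have "?g has_fps_expansion F 0"
  proof (subst has_fps_expansion_cong[OF _ refl])
    show "\<forall>\<^sub>F \<zeta> in nhds 0. ?g \<zeta> = h 0 (?D \<zeta>)"
      using near by eventually_elim (rule ft_eq[OF D_polydisc])
  qed (rule F)
  then have sums: "(\<lambda>k. fps_nth (F 0) k * \<zeta> ^ k) sums ?g \<zeta>" if "norm \<zeta> < R0" for \<zeta>
    using g_holo that by (intro has_fps_expansion_imp_sums_complex[where r = "ereal R0"]) auto
  show ?thesis
  proof (rule schur_parameters_summable[where F = F and r = r, OF step r_less])
    show "R > 1" by (rule R(1))
    show "norm (?g \<zeta>0) < 1" by (rule \<rho>)
    define R1 where "R1 = (R + R0) / 2"
    have R1: "R < R1" "R1 < R0" using R by (auto simp: R1_def field_simps)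
    have "summable (\<lambda>k. norm (fps_nth (F 0) k * of_real R ^ k))"
      by (rule powser_insidea[OF sums_summable[OF sums[of "of_real R1"]]]) (use R R1 in auto)
    then show "summable (\<lambda>k. norm (fps_nth (F 0) k) * R ^ k)"
      using R by (simp add: norm_mult norm_power)
    show "norm (\<Sum>k. fps_nth (F 0) k * w ^ k) \<le> norm (?g \<zeta>0)" if "norm w \<le> R" for w
      using sums_unique[OF sums[of w]] \<zeta>0(2)[of w] that R by simp
  qed
qed

definition tail_bound :: "nat \<Rightarrow> real"
  where "tail_bound n = (\<Sum>j. mobius_distortion (r (j + n)))"

lemma distortion_summable: "summable (\<lambda>j. mobius_distortion (r (j + n)))"
  by (rule summable_ignore_initial_segment) (rule summable_mobius_distortion[of r, OF r_less r_summable])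

lemma tail_bound_tendsto: "tail_bound \<longlonglongrightarrow> 0"
  unfolding tail_bound_def
  by (rule suminf_exist_split2) (rule summable_mobius_distortion[of r, OF r_less r_summable])

text \<open>
  Each step changes the size of the remainder by at most the distortion of its Moebius map.  Pulling
  the bound back through \<open>m\<close> steps leaves a term \<open>t ^ m\<close>, where \<open>t < 1\<close> bounds the coordinates of \<open>z\<close>; the
  resulting bound no longer depends on \<open>z\<close> and survives the passage to the torus.
\<close>

lemma h_le_tail_bound:
  assumes z: "z \<in> polydisc"
  shows "norm (h n z) \<le> tail_bound n"
proof -
  define t where "t = Max (range (\<lambda>j. norm (z $ j)))"
  have t: "norm (z $ j) \<le> t" for j unfolding t_def by (rule Max_ge) auto
  have "t \<in> range (\<lambda>j. norm (z $ j))" unfolding t_def by (rule Max_in) auto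
  then have t01: "0 \<le> t" "t < 1" using z by (auto simp: polydisc_def)
  have iterate: "norm (h n z) \<le> t ^ m + (\<Sum>j<m. mobius_distortion (r (j + n)))" for m n
  proof (induction m arbitrary: n)
    case 0
    show ?case using h_le[OF z] by simp
  next
    case (Suc m)
    let ?S = "\<Sum>j<m. mobius_distortion (r (j + Suc n))"
    have d0: "mobius_distortion (r j) \<ge> 0" for j
      unfolding mobius_distortion_def using r_less[of j] by auto
    let ?u = "z $ \<nu> (Suc n) * h (Suc n) z"
    have "norm (h n z) \<le> norm ?u + norm (h n z - ?u)"
      using norm_triangle_ineq[of ?u "h n z - ?u"] by simp
    also have "norm (h n z - ?u) \<le> mobius_distortion (r n)"
      using mobius_near_identity[OF r_less step_le[OF z]] h_step[OF z, of n] by simp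
    also have "norm ?u \<le> t * (t ^ m + ?S)"
      unfolding norm_mult using t01 Suc.IH[of "Suc n"] t by (intro mult_mono) auto
    also have "t * (t ^ m + ?S) \<le> t ^ Suc m + ?S"
      using t01 d0 by (simp add: distrib_left) (intro mult_left_le_one_le sum_nonneg, auto)
    finally show ?case by (simp add: sum.lessThan_Suc_shift del: sum.lessThan_Suc)
  qed
  have "(\<lambda>m. t ^ m + (\<Sum>j<m. mobius_distortion (r (j + n)))) \<longlonglongrightarrow> 0 + tail_bound n"
    unfolding tail_bound_def using t01
    by (intro tendsto_add LIMSEQ_realpow_zero summable_LIMSEQ distortion_summable) auto
  then show ?thesis using LIMSEQ_le_const iterate by fastforce
qed

text \<open>
  The values of the remainders at a point of the torus.  The functions \<open>h n\<close> are given on the open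
  polydisc only, so the recursion is solved for the next remainder, starting from the extension \<open>ft\<close>.
\<close>

primrec boundary_iterate :: "(complex ^ 'd) \<Rightarrow> nat \<Rightarrow> complex" where
  "boundary_iterate p 0 = ft p"
| "boundary_iterate p (Suc n) = mobius (- r n) (boundary_iterate p n) / p $ \<nu> (Suc n)"

context
  fixes p :: "complex ^ 'd"
  assumes torus: "norm (p $ j) = 1"
begin

lemma p_closed: "p \<in> closed_polydisc"
  by (simp add: closed_polydisc_def torus)

lemma boundary_iterate_less: "norm (boundary_iterate p n) < 1"
proof (induction n)
  case 0
  show ?case using ft_less[OF p_closed] by simp
next
  case (Suc n)
  then show ?case using norm_mobius_less[of "- r n" "boundary_iterate p n"] r_less[of n]
    by (simp add: norm_divide torus)
qed

lemma boundary_iterate_step: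
  "boundary_iterate p n = mobius (r n) (p $ \<nu> (Suc n) * boundary_iterate p (Suc n))"
proof -
  have "p $ \<nu> (Suc n) \<noteq> 0" using torus[of "\<nu> (Suc n)"] by auto
  then show ?thesis
    using mobius_inverse[OF r_less[of n] less_imp_le[OF boundary_iterate_less[of n]]] by simp
qed

text \<open>
  The recursion on the torus is the continuous extension of the recursion in the polydisc, so radial
  limits can be passed through it step by step.
\<close>

lemma boundary_iterate_limit:
  "((\<lambda>t. h n (\<chi> j. complex_of_real t * p $ j)) \<longlongrightarrow> boundary_iterate p n) (at_left 1)"
proof (induction n)
  let ?q = "\<lambda>t. \<chi> j. complex_of_real t * p $ j"
  have ev: "\<forall>\<^sub>F t in at_left (1::real). 0 < t \<and> t < 1"
    using eventually_at_left_real[of 0 1] by simp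
  have disc: "?q t \<in> polydisc" if "0 < t \<and> t < 1" for t
    using that by (simp add: polydisc_def norm_mult torus)
  have q: "(?q \<longlongrightarrow> p) (at_left 1)"
  proof (rule vec_tendstoI)
    fix j
    have "((\<lambda>t. complex_of_real t * p $ j) \<longlongrightarrow> complex_of_real 1 * p $ j) (at_left 1)"
      by (intro tendsto_intros)
    then show "((\<lambda>t. ?q t $ j) \<longlongrightarrow> p $ j) (at_left 1)" by simp
  qed
  {
    case 0
    have "isCont ft p"
      using ft_continuous U p_closed by (auto simp: continuous_on_eq_continuous_at)
    then have "((\<lambda>t. ft (?q t)) \<longlongrightarrow> ft p) (at_left 1)" by (rule isCont_tendsto_compose[OF _ q])
    moreover have "\<forall>\<^sub>F t in at_left 1. ft (?q t) = h 0 (?q t)"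
      using ev by eventually_elim (rule ft_eq[OF disc])
    ultimately show ?case by (simp add: tendsto_cong)
  next
    case (Suc n)
    let ?s = "boundary_iterate p n"
    have nz: "1 + cnj (- r n) * ?s \<noteq> 0"
      using boundary_iterate_less[of n] r_less[of n]
      by (intro one_plus_cnj_mult_nonzero norm_mult_lt_one) auto
    have pnz: "p $ \<nu> (Suc n) \<noteq> 0" using torus[of "\<nu> (Suc n)"] by auto
    have "((\<lambda>t. mobius (- r n) (h n (?q t)) / (?q t $ \<nu> (Suc n))) \<longlongrightarrow> boundary_iterate p (Suc n)) (at_left 1)"
      unfolding mobius_def boundary_iterate.simps
      by (intro tendsto_intros Suc nz pnz q)
    moreover have "\<forall>\<^sub>F t in at_left 1. mobius (- r n) (h n (?q t)) / (?q t $ \<nu> (Suc n)) = h (Suc n) (?q t)"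
      using ev
    proof eventually_elim
      case (elim t)
      let ?u = "?q t $ \<nu> (Suc n) * h (Suc n) (?q t)"
      have "mobius (- r n) (mobius (- (- r n)) ?u) = ?u"
        using mobius_inverse[of "- r n" ?u] step_le[OF disc[OF elim]] r_less[of n] by simp
      then have "mobius (- r n) (h n (?q t)) = ?u" using h_step[OF disc[OF elim], of n] by simp
      moreover have "?q t $ \<nu> (Suc n) \<noteq> 0" using elim pnz by simp
      ultimately show ?case by simp
    qed
    ultimately show ?case by (simp add: tendsto_cong)
  }
qed

lemma boundary_iterate_le: "norm (boundary_iterate p n) \<le> tail_bound n"
proof (rule tendsto_upperbound[OF tendsto_norm[OF boundary_iterate_limit]])
  have "\<forall>\<^sub>F t in at_left (1::real). 0 < t \<and> t < 1"
    using eventually_at_left_real[of 0 1] by simp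
  then show "\<forall>\<^sub>F t in at_left 1. norm (h n (\<chi> j. complex_of_real t * p $ j)) \<le> tail_bound n"
    by eventually_elim (rule h_le_tail_bound, simp add: polydisc_def norm_mult torus)
qed simp

end

lemma schur_recursion_on_torus_line:
  fixes \<eta> :: "real ^ 'd"
  assumes \<eta>: "\<And>j. \<eta> $ j > 0"
  shows "schur_recursion_on_line r (\<lambda>j. \<eta> $ \<nu> j) (\<lambda>n \<omega>. boundary_iterate (torus_line \<eta> \<omega>) n) tail_bound"
proof
  have torus: "norm (torus_line \<eta> \<omega> $ j) = 1" for \<omega> j by (simp add: torus_line_def)
  show "norm (r n) < 1" for n by (rule r_less)
  show "summable (\<lambda>n. norm (r n))" by (rule r_summable)
  show "\<eta> $ \<nu> n > 0" for n by (rule \<eta>)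
  show "norm (boundary_iterate (torus_line \<eta> \<omega>) n) < 1" for n \<omega> by (rule boundary_iterate_less[OF torus])
  show "norm (boundary_iterate (torus_line \<eta> \<omega>) n) \<le> tail_bound n" for n \<omega> by (rule boundary_iterate_le[OF torus])
  show "tail_bound \<longlonglongrightarrow> 0" by (rule tail_bound_tendsto)
  show "boundary_iterate (torus_line \<eta> \<omega>) n
      = mobius (r n) (exp (\<i> * complex_of_real (\<eta> $ \<nu> (Suc n) * \<omega>)) * boundary_iterate (torus_line \<eta> \<omega>) (Suc n))" for n \<omega>
    by (subst boundary_iterate_step[OF torus]) (simp only: torus_line_def vec_lambda_beta)
  have line: "continuous_on UNIV (torus_line \<eta>)"
    unfolding torus_line_def by (intro continuous_on_vec_lambda continuous_intros)
  show "continuous_on UNIV (\<lambda>\<omega>. boundary_iterate (torus_line \<eta> \<omega>) n)" for n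
  proof (induction n)
    case 0
    have "torus_line \<eta> \<omega> \<in> U" for \<omega> using p_closed[OF torus] U(2) by blast
    then show ?case
      using continuous_on_compose2[OF ft_continuous line] by (auto simp: image_subset_iff)
  next
    case (Suc n)
    have "1 + cnj (- r n) * boundary_iterate (torus_line \<eta> \<omega>) n \<noteq> 0" for \<omega>
      using boundary_iterate_less[OF torus, of \<omega> n] r_less[of n]
      by (intro one_plus_cnj_mult_nonzero norm_mult_lt_one) auto
    moreover have "torus_line \<eta> \<omega> $ \<nu> (Suc n) \<noteq> 0" for \<omega> using torus[of \<omega> "\<nu> (Suc n)"] by auto
    ultimately show ?case
      unfolding boundary_iterate.simps mobius_def
      by (intro continuous_intros Suc line) auto
  qed
qed

end

lemma schur_data_imp_schur_algorithm:
  assumes "schur_data f r \<nu>" "standard_schur f r"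
    and "open U" "closed_polydisc \<subseteq> U" "mv_holomorphic_on ft U"
    and "\<forall>z\<in>closed_polydisc. norm (ft z) < 1" "\<forall>z\<in>polydisc. ft z = f z"
  shows "\<exists>h. schur_algorithm h r \<nu> ft U"
proof -
  obtain h where h: "h 0 = f" "\<And>n. h n \<in> schur_class"
    "\<And>n z. z \<in> polydisc \<Longrightarrow> h n z = g_op (r n) (m_op (\<nu> (Suc n)) (h (Suc n))) z"
    using assms(1) unfolding schur_data_def by blast
  have r: "norm (r n) < 1" for n using assms(2) by (simp add: standard_schur_def)
  have "schur_algorithm h r \<nu> ft U"
  proof
    show "mv_holomorphic_on (h n) polydisc" for n by (rule schur_class_subset_H_space(1)[OF h(2)])
    show "norm (h n z) \<le> 1" if "z \<in> polydisc" for n z by (rule schur_class_subset_H_space(2)[OF h(2) that])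
    show "h n z = mobius (r n) (z $ \<nu> (Suc n) * h (Suc n) z)" if "z \<in> polydisc" for n z
      using h(3)[OF that, of n] r[of n] by (simp add: g_op_def m_op_def mobius_def)
  qed (use assms r h(1) in auto)
  then show ?thesis by blast
qed

theorem theorem5:
  fixes f ft :: "complex ^ 'd::{finite,linorder} \<Rightarrow> complex"
    and r :: "nat \<Rightarrow> complex"
    and \<nu> :: "nat \<Rightarrow> 'd::{finite,linorder}"
    and U :: "(complex ^ 'd::{finite,linorder}) set"
  assumes "f \<in> schur_class"
    and "schur_data f r \<nu>"
    and "standard_schur f r"
    and "open U" and "closed_polydisc \<subseteq> U" and "mv_holomorphic_on ft U"
    and "\<forall>z\<in>closed_polydisc. norm (ft z) < 1"
    and "\<forall>z\<in>polydisc. ft z = f z"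
  shows "\<forall>\<eta> :: real ^ 'd::{finite,linorder}. (\<forall>j. \<eta> $ j > 0) \<longrightarrow>
    (\<forall>p\<ge>1. besicovitch_ap p (ft \<circ> torus_line \<eta>)) \<and>
    (\<forall>\<omega>. (\<lambda>\<alpha>. norm (scattering_weight r \<alpha> *
            exp (\<i> * complex_of_real (pairing \<alpha> (\<lambda>j. \<eta> $ \<nu> j) * \<omega>))))
          summable_on scattering_index \<and>
        ((\<lambda>\<alpha>. scattering_weight r \<alpha> *
            exp (\<i> * complex_of_real (pairing \<alpha> (\<lambda>j. \<eta> $ \<nu> j) * \<omega>)))
          has_sum ((ft \<circ> torus_line \<eta>) \<omega>)) scattering_index) \<and>
    summable (\<lambda>j. - ln (1 - (norm (r (Suc j)))\<^sup>2)) \<and>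
    ((\<lambda>L. mean_over L (\<lambda>\<omega>. - ln (1 - (norm ((ft \<circ> torus_line \<eta>) \<omega>))\<^sup>2)))
       \<longlongrightarrow> (\<Sum>j. - ln (1 - (norm (r (Suc j)))\<^sup>2))) at_top"
proof (intro allI impI)
  fix \<eta> :: "real ^ 'd::{finite,linorder}" assume \<eta>: "\<forall>j. \<eta> $ j > 0"
  obtain h where "schur_algorithm h r \<nu> ft U"
    using schur_data_imp_schur_algorithm[OF assms(2-8)] by blast
  then interpret schur_algorithm h r \<nu> ft U .
  define k where "k n \<omega> = boundary_iterate (torus_line \<eta> \<omega>) n" for n \<omega>
  interpret schur_recursion_on_line r "\<lambda>j. \<eta> $ \<nu> j" k tail_bound
    unfolding k_def using \<eta> by (intro schur_recursion_on_torus_line) simp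
  have k0: "k 0 = ft \<circ> torus_line \<eta>" by (simp add: fun_eq_iff k_def)
  \<comment> \<open>this removes the term of index 0 from the sum over all parameters\<close>
  have r0: "r 0 = 0"
    using assms(2,3) by (auto simp: schur_data_def standard_schur_def)
  let ?l = "\<lambda>n. - ln (1 - (norm (r n))\<^sup>2)"
  have log_summable: "summable (\<lambda>n. ?l (Suc n))"
    using log_parameters_summable by (subst summable_Suc_iff)
  have "(\<Sum>n. ?l n) = (\<Sum>n. ?l (Suc n))"
    using suminf_split_head[OF log_parameters_summable] r0 by simp
  then have "((\<lambda>L. mean_over L (energy 0)) \<longlongrightarrow> (\<Sum>n. ?l (Suc n))) at_top"
    using mean_energy by simp
  moreover have "energy 0 = (\<lambda>\<omega>. - ln (1 - (norm ((ft \<circ> torus_line \<eta>) \<omega>))\<^sup>2))"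
    by (simp add: energy_def k0 fun_eq_iff)
  moreover have "\<forall>p\<ge>1. besicovitch_ap p (ft \<circ> torus_line \<eta>)"
    using k_besicovitch[of _ 0] by (simp only: k0) simp
  moreover have "(\<lambda>\<alpha>. norm (scattering_weight r \<alpha> *
      exp (\<i> * complex_of_real (pairing \<alpha> (\<lambda>j. \<eta> $ \<nu> j) * \<omega>)))) summable_on scattering_index" for \<omega>
    using shifted_weights_summable[of 0] by (simp add: norm_mult)
  moreover have "((\<lambda>\<alpha>. scattering_weight r \<alpha> *
      exp (\<i> * complex_of_real (pairing \<alpha> (\<lambda>j. \<eta> $ \<nu> j) * \<omega>)))
      has_sum ((ft \<circ> torus_line \<eta>) \<omega>)) scattering_index" for \<omega>
    using k_has_sum[of 0 \<omega>] by (simp only: k0 add_0_right)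
  ultimately show "(\<forall>p\<ge>1. besicovitch_ap p (ft \<circ> torus_line \<eta>)) \<and>
    (\<forall>\<omega>. (\<lambda>\<alpha>. norm (scattering_weight r \<alpha> *
            exp (\<i> * complex_of_real (pairing \<alpha> (\<lambda>j. \<eta> $ \<nu> j) * \<omega>))))
          summable_on scattering_index \<and>
        ((\<lambda>\<alpha>. scattering_weight r \<alpha> *
            exp (\<i> * complex_of_real (pairing \<alpha> (\<lambda>j. \<eta> $ \<nu> j) * \<omega>)))
          has_sum ((ft \<circ> torus_line \<eta>) \<omega>)) scattering_index) \<and>
    summable (\<lambda>j. - ln (1 - (norm (r (Suc j)))\<^sup>2)) \<and>
    ((\<lambda>L. mean_over L (\<lambda>\<omega>. - ln (1 - (norm ((ft \<circ> torus_line \<eta>) \<omega>))\<^sup>2)))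
       \<longlongrightarrow> (\<Sum>j. - ln (1 - (norm (r (Suc j)))\<^sup>2))) at_top"
    using log_summable by simp
qed

end
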